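(* Let $R$ be a Dedekind domain that is not a division ring. Then every regularly weakly based $R$-module splits into a direct sum of a finitely generated projective module and a bounded torsion module.
   Context: For a subset $X$ of a module $M$, $\operatorname{Span}(X)$ denotes the submodule generated by $X$. A subset $X$ of a module $M$ is weakly independent if $x \notin \operatorname{Span}(X \setminus \{x\})$ for all $x \in X$. A weak basis of $M$ is a weakly independent subset that generates $M$ (equivalently, a generating set minimal with respect to inclusion). A module $M$ is regularly weakly based if every generating set of $M$ contains a weak basis of $M$. An $R$-module $T$ is torsion if $\operatorname{Ann}(m) \neq 0$ for every $m \in T$. An $R$-module $M$ is bounded if $IM = 0$ for some non-zero ideal $I$ of $R$. *)

theory Defs
  imports "HOL-Algebra.Ring_Divisibility" "HOL-Algebra.Module"
begin

section \<open>Dedekind domains\<close>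

text \<open>
  A pair \<open>a, b\<close> with \<open>b \<noteq> \<zero>\<close> stands for the element \<open>a / b\<close> of the field of fractions of \<open>R\<close>.
  Multiplying a monic equation \<open>(a/b)^n + (\<Sum>i<n. c i * (a/b)^i) = 0\<close> by \<open>b^n\<close> gives the
  equation below, and \<open>a / b\<close> lies in \<open>R\<close> iff \<open>b\<close> divides \<open>a\<close>. Lemma
  \<open>integrally_closed_in_fraction_field\<close> relates this to an arbitrary field of fractions.
\<close>

definition integral_fraction :: "('a, 'm) ring_scheme \<Rightarrow> 'a \<Rightarrow> 'a \<Rightarrow> bool" where
  "integral_fraction R a b \<longleftrightarrow>
    (\<exists>(n::nat) c. c \<in> {..<n} \<rightarrow> carrier R \<and>
       a [^]\<^bsub>R\<^esub> n \<oplus>\<^bsub>R\<^esub> (\<Oplus>\<^bsub>R\<^esub> i \<in> {..<n}. c i \<otimes>\<^bsub>R\<^esub> (a [^]\<^bsub>R\<^esub> i \<otimes>\<^bsub>R\<^esub> b [^]\<^bsub>R\<^esub> (n - i))) = \<zero>\<^bsub>R\<^esub>)"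

definition integrally_closed :: "('a, 'm) ring_scheme \<Rightarrow> bool" where
  "integrally_closed R \<longleftrightarrow>
    (\<forall>a \<in> carrier R. \<forall>b \<in> carrier R - {\<zero>\<^bsub>R\<^esub>}. integral_fraction R a b \<longrightarrow> b divides\<^bsub>R\<^esub> a)"

text \<open>Fields are Dedekind domains under this definition.\<close>

definition dedekind_domain :: "('a, 'm) ring_scheme \<Rightarrow> bool" where
  "dedekind_domain R \<longleftrightarrow>
    noetherian_domain R \<and> integrally_closed R \<and>
    (\<forall>I. primeideal I R \<and> I \<noteq> {\<zero>\<^bsub>R\<^esub>} \<longrightarrow> maximalideal I R)"

definition integral_over_image ::
    "('a, 'm) ring_scheme \<Rightarrow> ('k, 'l) ring_scheme \<Rightarrow> ('a \<Rightarrow> 'k) \<Rightarrow> 'k \<Rightarrow> bool" where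
  "integral_over_image R K h x \<longleftrightarrow>
    (\<exists>(n::nat) c. c \<in> {..<n} \<rightarrow> carrier R \<and>
       x [^]\<^bsub>K\<^esub> n \<oplus>\<^bsub>K\<^esub> (\<Oplus>\<^bsub>K\<^esub> i \<in> {..<n}. h (c i) \<otimes>\<^bsub>K\<^esub> x [^]\<^bsub>K\<^esub> i) = \<zero>\<^bsub>K\<^esub>)"

lemma integrally_closed_in_fraction_field:
  assumes R: "domain R" and K: "field K" and h: "h \<in> ring_hom R K"
    and inj: "inj_on h (carrier R)"
    and frac: "\<And>x. x \<in> carrier K \<Longrightarrow>
      \<exists>a \<in> carrier R. \<exists>b \<in> carrier R - {\<zero>\<^bsub>R\<^esub>}. x = h a \<otimes>\<^bsub>K\<^esub> inv\<^bsub>K\<^esub> (h b)"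
  shows "integrally_closed R \<longleftrightarrow>
    (\<forall>x \<in> carrier K. integral_over_image R K h x \<longrightarrow> x \<in> h ` carrier R)"
proof -
  interpret R: domain R by fact
  interpret K: field K by fact
  interpret h: ring_hom_cring R K h
    using h R.is_cring K.is_cring by (simp add: ring_hom_cring_def ring_hom_cring_axioms_def)
  have nz: "h b \<in> carrier K - {\<zero>\<^bsub>K\<^esub>}" if "b \<in> carrier R - {\<zero>\<^bsub>R\<^esub>}" for b
  proof -
    have "h b \<noteq> h \<zero>\<^bsub>R\<^esub>" using that inj_on_eq_iff[OF inj _ R.zero_closed, of b] by blast
    thus ?thesis using that by simp
  qed
  have int: "integral_over_image R K h (h a \<otimes>\<^bsub>K\<^esub> inv\<^bsub>K\<^esub> (h b)) \<longleftrightarrow> integral_fraction R a b"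
    if a: "a \<in> carrier R" and b: "b \<in> carrier R - {\<zero>\<^bsub>R\<^esub>}" for a b
  proof -
    let ?x = "h a \<otimes>\<^bsub>K\<^esub> inv\<^bsub>K\<^esub> (h b)"
    have bR: "b \<in> carrier R" using b by simp
    have ub: "h b \<in> Units K" using nz[OF b] by (simp add: K.field_Units)
    have x: "?x \<in> carrier K" using a ub by simp
    have hb: "h b \<in> carrier K" using bR by simp
    have xb: "?x \<otimes>\<^bsub>K\<^esub> h b = h a"
      using K.m_assoc[OF h.hom_closed[OF a] K.Units_inv_closed[OF ub] hb] K.Units_l_inv[OF ub] a by simp
    have pow: "?x [^]\<^bsub>K\<^esub> (i::nat) \<otimes>\<^bsub>K\<^esub> h b [^]\<^bsub>K\<^esub> n = h (a [^]\<^bsub>R\<^esub> i \<otimes>\<^bsub>R\<^esub> b [^]\<^bsub>R\<^esub> (n - i))"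
      if "i \<le> n" for i n :: nat
    proof -
      have "h b [^]\<^bsub>K\<^esub> n = h b [^]\<^bsub>K\<^esub> i \<otimes>\<^bsub>K\<^esub> h b [^]\<^bsub>K\<^esub> (n - i)"
        using that hb by (simp add: K.nat_pow_mult)
      hence "?x [^]\<^bsub>K\<^esub> i \<otimes>\<^bsub>K\<^esub> h b [^]\<^bsub>K\<^esub> n = (?x [^]\<^bsub>K\<^esub> i \<otimes>\<^bsub>K\<^esub> h b [^]\<^bsub>K\<^esub> i) \<otimes>\<^bsub>K\<^esub> h b [^]\<^bsub>K\<^esub> (n - i)"
        using x hb by (simp only: K.m_assoc K.nat_pow_closed)
      also have "?x [^]\<^bsub>K\<^esub> i \<otimes>\<^bsub>K\<^esub> h b [^]\<^bsub>K\<^esub> i = h a [^]\<^bsub>K\<^esub> i"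
        using K.nat_pow_distrib[OF x hb, of i] xb by simp
      finally show ?thesis using a bR by (simp add: h.ring.hom_nat_pow)
    qed
    have key: "?x [^]\<^bsub>K\<^esub> n \<oplus>\<^bsub>K\<^esub> (\<Oplus>\<^bsub>K\<^esub> i \<in> {..<n}. h (c i) \<otimes>\<^bsub>K\<^esub> ?x [^]\<^bsub>K\<^esub> i) = \<zero>\<^bsub>K\<^esub> \<longleftrightarrow>
       a [^]\<^bsub>R\<^esub> n \<oplus>\<^bsub>R\<^esub> (\<Oplus>\<^bsub>R\<^esub> i \<in> {..<n}. c i \<otimes>\<^bsub>R\<^esub> (a [^]\<^bsub>R\<^esub> i \<otimes>\<^bsub>R\<^esub> b [^]\<^bsub>R\<^esub> (n - i))) = \<zero>\<^bsub>R\<^esub>"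
      (is "?L = \<zero>\<^bsub>K\<^esub> \<longleftrightarrow> ?E = \<zero>\<^bsub>R\<^esub>")
      if c: "c \<in> {..<n} \<rightarrow> carrier R" for n :: nat and c
    proof -
      have bn: "h b [^]\<^bsub>K\<^esub> n \<in> Units K" using ub by (rule K.Units_pow_closed)
      have cl1: "(\<lambda>i. h (c i) \<otimes>\<^bsub>K\<^esub> ?x [^]\<^bsub>K\<^esub> i) \<in> {..<n} \<rightarrow> carrier K"
        using c x by (auto intro!: K.m_closed K.nat_pow_closed)
      have cl2: "(\<lambda>i. c i \<otimes>\<^bsub>R\<^esub> (a [^]\<^bsub>R\<^esub> i \<otimes>\<^bsub>R\<^esub> b [^]\<^bsub>R\<^esub> (n - i))) \<in> {..<n} \<rightarrow> carrier R"
        using c a bR by auto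
      have L: "?L \<in> carrier K"
        using x cl1 by (intro K.add.m_closed K.nat_pow_closed K.finsum_closed)
      have E: "?E \<in> carrier R"
        using a cl2 by (intro R.add.m_closed R.nat_pow_closed R.finsum_closed)
      have hbn: "h b [^]\<^bsub>K\<^esub> n \<in> carrier K" using hb by simp
      have xn: "?x [^]\<^bsub>K\<^esub> n \<in> carrier K" using x by simp
      have "(\<Oplus>\<^bsub>K\<^esub> i \<in> {..<n}. h (c i) \<otimes>\<^bsub>K\<^esub> ?x [^]\<^bsub>K\<^esub> i) \<otimes>\<^bsub>K\<^esub> h b [^]\<^bsub>K\<^esub> n
          = (\<Oplus>\<^bsub>K\<^esub> i \<in> {..<n}. h (c i) \<otimes>\<^bsub>K\<^esub> ?x [^]\<^bsub>K\<^esub> i \<otimes>\<^bsub>K\<^esub> h b [^]\<^bsub>K\<^esub> n)"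
        by (rule K.finsum_ldistr[OF finite_lessThan hbn cl1])
      also have "\<dots> = (\<Oplus>\<^bsub>K\<^esub> i \<in> {..<n}. h (c i \<otimes>\<^bsub>R\<^esub> (a [^]\<^bsub>R\<^esub> i \<otimes>\<^bsub>R\<^esub> b [^]\<^bsub>R\<^esub> (n - i))))"
      proof (rule K.finsum_cong')
        fix i assume i: "i \<in> {..<n}"
        have ci: "c i \<in> carrier R" using c i by auto
        have xi: "?x [^]\<^bsub>K\<^esub> i \<in> carrier K" using x by simp
        have "h (c i) \<otimes>\<^bsub>K\<^esub> ?x [^]\<^bsub>K\<^esub> i \<otimes>\<^bsub>K\<^esub> h b [^]\<^bsub>K\<^esub> n = h (c i) \<otimes>\<^bsub>K\<^esub> (?x [^]\<^bsub>K\<^esub> i \<otimes>\<^bsub>K\<^esub> h b [^]\<^bsub>K\<^esub> n)"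
          by (rule K.m_assoc[OF h.hom_closed[OF ci] xi hbn])
        also have "\<dots> = h (c i) \<otimes>\<^bsub>K\<^esub> h (a [^]\<^bsub>R\<^esub> i \<otimes>\<^bsub>R\<^esub> b [^]\<^bsub>R\<^esub> (n - i))"
          using pow[of i n] i by simp
        also have "\<dots> = h (c i \<otimes>\<^bsub>R\<^esub> (a [^]\<^bsub>R\<^esub> i \<otimes>\<^bsub>R\<^esub> b [^]\<^bsub>R\<^esub> (n - i)))"
          using ci a bR by simp
        finally show "h (c i) \<otimes>\<^bsub>K\<^esub> ?x [^]\<^bsub>K\<^esub> i \<otimes>\<^bsub>K\<^esub> h b [^]\<^bsub>K\<^esub> n = h (c i \<otimes>\<^bsub>R\<^esub> (a [^]\<^bsub>R\<^esub> i \<otimes>\<^bsub>R\<^esub> b [^]\<^bsub>R\<^esub> (n - i)))" .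
      qed (use cl2 in auto)
      also have "\<dots> = h (\<Oplus>\<^bsub>R\<^esub> i \<in> {..<n}. c i \<otimes>\<^bsub>R\<^esub> (a [^]\<^bsub>R\<^esub> i \<otimes>\<^bsub>R\<^esub> b [^]\<^bsub>R\<^esub> (n - i)))"
        using h.hom_finsum[OF cl2] by (simp only: comp_def)
      finally have hs: "(\<Oplus>\<^bsub>K\<^esub> i \<in> {..<n}. h (c i) \<otimes>\<^bsub>K\<^esub> ?x [^]\<^bsub>K\<^esub> i) \<otimes>\<^bsub>K\<^esub> h b [^]\<^bsub>K\<^esub> n
          = h (\<Oplus>\<^bsub>R\<^esub> i \<in> {..<n}. c i \<otimes>\<^bsub>R\<^esub> (a [^]\<^bsub>R\<^esub> i \<otimes>\<^bsub>R\<^esub> b [^]\<^bsub>R\<^esub> (n - i)))" .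
      have hp: "?x [^]\<^bsub>K\<^esub> n \<otimes>\<^bsub>K\<^esub> h b [^]\<^bsub>K\<^esub> n = h (a [^]\<^bsub>R\<^esub> n)"
        using pow[of n n] a by simp
      have "?L \<otimes>\<^bsub>K\<^esub> h b [^]\<^bsub>K\<^esub> n = h ?E"
        using K.l_distr[OF xn K.finsum_closed[OF cl1] hbn] hs hp
          h.hom_add[OF R.nat_pow_closed[OF a, of n] R.finsum_closed[OF cl2]]
        by (simp only:)
      moreover have "?L \<otimes>\<^bsub>K\<^esub> h b [^]\<^bsub>K\<^esub> n = \<zero>\<^bsub>K\<^esub> \<longleftrightarrow> ?L = \<zero>\<^bsub>K\<^esub>"
        using K.integral_iff[OF L hbn] bn K.field_Units by auto
      moreover have "h ?E = \<zero>\<^bsub>K\<^esub> \<longleftrightarrow> ?E = \<zero>\<^bsub>R\<^esub>"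
        using inj_on_eq_iff[OF inj E R.zero_closed] h.hom_zero by (simp only:)
      ultimately show ?thesis by simp
    qed
    show ?thesis
      unfolding integral_over_image_def integral_fraction_def
      by (intro iff_exI conj_cong refl key)
  qed
  have mem: "h a \<otimes>\<^bsub>K\<^esub> inv\<^bsub>K\<^esub> (h b) \<in> h ` carrier R \<longleftrightarrow> b divides\<^bsub>R\<^esub> a"
    if a: "a \<in> carrier R" and b: "b \<in> carrier R - {\<zero>\<^bsub>R\<^esub>}" for a b
  proof -
    have bR: "b \<in> carrier R" using b by simp
    have ub: "h b \<in> Units K" using nz[OF b] by (simp add: K.field_Units)
    have hb: "h b \<in> carrier K" using bR by simp
    have "h a \<otimes>\<^bsub>K\<^esub> inv\<^bsub>K\<^esub> (h b) = h c \<longleftrightarrow> a = b \<otimes>\<^bsub>R\<^esub> c" if c: "c \<in> carrier R" for c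
    proof
      assume "h a \<otimes>\<^bsub>K\<^esub> inv\<^bsub>K\<^esub> (h b) = h c"
      hence "h a \<otimes>\<^bsub>K\<^esub> inv\<^bsub>K\<^esub> (h b) \<otimes>\<^bsub>K\<^esub> h b = h c \<otimes>\<^bsub>K\<^esub> h b" by simp
      hence "h a = h (b \<otimes>\<^bsub>R\<^esub> c)"
        using K.m_assoc[OF h.hom_closed[OF a] K.Units_inv_closed[OF ub] hb] K.Units_l_inv[OF ub]
          K.m_comm[OF h.hom_closed[OF c] hb] a bR c by simp
      thus "a = b \<otimes>\<^bsub>R\<^esub> c" using inj_onD[OF inj _ a R.m_closed[OF bR c]] by blast
    next
      assume "a = b \<otimes>\<^bsub>R\<^esub> c"
      hence "h a = h c \<otimes>\<^bsub>K\<^esub> h b"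
        using h.hom_mult[OF bR c] K.m_comm[OF h.hom_closed[OF c] hb] by simp
      thus "h a \<otimes>\<^bsub>K\<^esub> inv\<^bsub>K\<^esub> (h b) = h c"
        using K.m_assoc[OF h.hom_closed[OF c] hb K.Units_inv_closed[OF ub]] K.Units_r_inv[OF ub] c by simp
    qed
    thus ?thesis unfolding factor_def by auto
  qed
  show ?thesis
  proof
    assume ic: "integrally_closed R"
    show "\<forall>x \<in> carrier K. integral_over_image R K h x \<longrightarrow> x \<in> h ` carrier R"
    proof (intro ballI impI)
      fix x assume x: "x \<in> carrier K" and i: "integral_over_image R K h x"
      obtain a b where a: "a \<in> carrier R" and b: "b \<in> carrier R - {\<zero>\<^bsub>R\<^esub>}"
        and eq: "x = h a \<otimes>\<^bsub>K\<^esub> inv\<^bsub>K\<^esub> (h b)"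
        using frac[OF x] by blast
      have "integral_fraction R a b" using i int[OF a b] eq by simp
      hence "b divides\<^bsub>R\<^esub> a" using ic a b unfolding integrally_closed_def by blast
      thus "x \<in> h ` carrier R" using mem[OF a b] eq by simp
    qed
  next
    assume *: "\<forall>x \<in> carrier K. integral_over_image R K h x \<longrightarrow> x \<in> h ` carrier R"
    show "integrally_closed R" unfolding integrally_closed_def
    proof (intro ballI impI)
      fix a b assume a: "a \<in> carrier R" and b: "b \<in> carrier R - {\<zero>\<^bsub>R\<^esub>}" and i: "integral_fraction R a b"
      have "h b \<in> Units K" using nz[OF b] by (simp add: K.field_Units)
      hence "h a \<otimes>\<^bsub>K\<^esub> inv\<^bsub>K\<^esub> (h b) \<in> carrier K" using a by simp
      thus "b divides\<^bsub>R\<^esub> a" using * i int[OF a b] mem[OF a b] by blast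
    qed
  qed
qed


section \<open>Weak bases\<close>

definition module_span :: "('a, 'm) ring_scheme \<Rightarrow> ('a, 'b, 'n) module_scheme \<Rightarrow> 'b set \<Rightarrow> 'b set" where
  "module_span R M X = \<Inter>{N. submodule N R M \<and> X \<subseteq> N}"

definition generates :: "('a, 'm) ring_scheme \<Rightarrow> ('a, 'b, 'n) module_scheme \<Rightarrow> 'b set \<Rightarrow> bool" where
  "generates R M X \<longleftrightarrow> X \<subseteq> carrier M \<and> module_span R M X = carrier M"

definition weakly_independent ::
    "('a, 'm) ring_scheme \<Rightarrow> ('a, 'b, 'n) module_scheme \<Rightarrow> 'b set \<Rightarrow> bool" where
  "weakly_independent R M X \<longleftrightarrow>
    X \<subseteq> carrier M \<and> (\<forall>x \<in> X. x \<notin> module_span R M (X - {x}))"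

definition weak_basis :: "('a, 'm) ring_scheme \<Rightarrow> ('a, 'b, 'n) module_scheme \<Rightarrow> 'b set \<Rightarrow> bool" where
  "weak_basis R M X \<longleftrightarrow> weakly_independent R M X \<and> generates R M X"

definition regularly_weakly_based ::
    "('a, 'm) ring_scheme \<Rightarrow> ('a, 'b, 'n) module_scheme \<Rightarrow> bool" where
  "regularly_weakly_based R M \<longleftrightarrow>
    (\<forall>X. generates R M X \<longrightarrow> (\<exists>Y \<subseteq> X. weak_basis R M Y))"


section \<open>Torsion, bounded and finitely generated modules, direct sums\<close>

definition annihilator :: "('a, 'm) ring_scheme \<Rightarrow> ('a, 'b, 'n) module_scheme \<Rightarrow> 'b \<Rightarrow> 'a set" where
  "annihilator R M x = {a \<in> carrier R. a \<odot>\<^bsub>M\<^esub> x = \<zero>\<^bsub>M\<^esub>}"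

definition torsion_module :: "('a, 'm) ring_scheme \<Rightarrow> ('a, 'b, 'n) module_scheme \<Rightarrow> bool" where
  "torsion_module R M \<longleftrightarrow> (\<forall>x \<in> carrier M. annihilator R M x \<noteq> {\<zero>\<^bsub>R\<^esub>})"

definition ideal_smult :: "('a, 'm) ring_scheme \<Rightarrow> 'a set \<Rightarrow> ('a, 'b, 'n) module_scheme \<Rightarrow> 'b set" where
  "ideal_smult R I M = module_span R M {a \<odot>\<^bsub>M\<^esub> x | a x. a \<in> I \<and> x \<in> carrier M}"

definition bounded_module :: "('a, 'm) ring_scheme \<Rightarrow> ('a, 'b, 'n) module_scheme \<Rightarrow> bool" where
  "bounded_module R M \<longleftrightarrow>
    (\<exists>I. ideal I R \<and> I \<noteq> {\<zero>\<^bsub>R\<^esub>} \<and> ideal_smult R I M = {\<zero>\<^bsub>M\<^esub>})"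

definition finitely_generated_module ::
    "('a, 'm) ring_scheme \<Rightarrow> ('a, 'b, 'n) module_scheme \<Rightarrow> bool" where
  "finitely_generated_module R M \<longleftrightarrow> (\<exists>X. finite X \<and> generates R M X)"

definition direct_sum_decomposition ::
    "('a, 'm) ring_scheme \<Rightarrow> ('a, 'b, 'n) module_scheme \<Rightarrow> 'b set \<Rightarrow> 'b set \<Rightarrow> bool" where
  "direct_sum_decomposition R M P T \<longleftrightarrow>
    submodule P R M \<and> submodule T R M \<and> P \<inter> T = {\<zero>\<^bsub>M\<^esub>} \<and> P <+>\<^bsub>M\<^esub> T = carrier M"


section \<open>Projective modules\<close>

definition module_hom ::
    "('a, 'm) ring_scheme \<Rightarrow> ('a, 'b, 'n) module_scheme \<Rightarrow> ('a, 'c, 'l) module_scheme \<Rightarrow> ('b \<Rightarrow> 'c) set" where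
  "module_hom R M N =
    {f \<in> carrier M \<rightarrow> carrier N.
       (\<forall>x \<in> carrier M. \<forall>y \<in> carrier M. f (x \<oplus>\<^bsub>M\<^esub> y) = f x \<oplus>\<^bsub>N\<^esub> f y) \<and>
       (\<forall>a \<in> carrier R. \<forall>x \<in> carrier M. f (a \<odot>\<^bsub>M\<^esub> x) = a \<odot>\<^bsub>N\<^esub> f x)}"

text \<open>
  HOL does not allow quantification over modules with carriers in all types inside a definition,
  so the lifting property is required for test modules \<open>A\<close>, \<open>B\<close> over two fixed types, chosen
  large enough to contain the free module on \<open>carrier P\<close> and \<open>P\<close> itself. Lemma
  \<open>projective_module_lift\<close> shows that the lifting property then holds for test modules over any
  types.
\<close>

definition projective_module :: "('a, 'm) ring_scheme \<Rightarrow> ('a, 'b, 'n) module_scheme \<Rightarrow> bool" where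
  "projective_module R P \<longleftrightarrow> module R P \<and>
    (\<forall>(A :: ('a, 'b \<Rightarrow> 'a) module) (B :: ('a, 'b, 'n) module_scheme) f g.
       module R A \<and> module R B \<and>
       f \<in> module_hom R A B \<and> f ` carrier A = carrier B \<and> g \<in> module_hom R P B \<longrightarrow>
       (\<exists>h \<in> module_hom R P A. \<forall>x \<in> carrier P. f (h x) = g x))"

definition free_module :: "('a, 'm) ring_scheme \<Rightarrow> 'b set \<Rightarrow> ('a, 'b \<Rightarrow> 'a) module" where
  "free_module R X =
    \<lparr>carrier = {c. (\<forall>x \<in> X. c x \<in> carrier R) \<and> (\<forall>x. x \<notin> X \<longrightarrow> c x = \<zero>\<^bsub>R\<^esub>) \<and> finite {x. c x \<noteq> \<zero>\<^bsub>R\<^esub>}},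
     mult = (\<lambda>_ _. undefined), one = undefined, zero = (\<lambda>_. \<zero>\<^bsub>R\<^esub>), add = (\<lambda>c d x. c x \<oplus>\<^bsub>R\<^esub> d x),
     smult = (\<lambda>a c x. a \<otimes>\<^bsub>R\<^esub> c x)\<rparr>"

lemma free_module_module:
  assumes "cring R"
  shows "module R (free_module R X)"
proof -
  interpret R: cring R by fact
  let ?F = "free_module R X"
  have C: "c x \<in> carrier R" if "c \<in> carrier ?F" for c x
    using that by (cases "x \<in> X") (auto simp: free_module_def)
  have add: "c \<oplus>\<^bsub>?F\<^esub> d \<in> carrier ?F" if "c \<in> carrier ?F" "d \<in> carrier ?F" for c d
  proof -
    have "{x. c x \<oplus>\<^bsub>R\<^esub> d x \<noteq> \<zero>\<^bsub>R\<^esub>} \<subseteq> {x. c x \<noteq> \<zero>\<^bsub>R\<^esub>} \<union> {x. d x \<noteq> \<zero>\<^bsub>R\<^esub>}" by auto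
    thus ?thesis using that by (auto simp: free_module_def intro: finite_subset)
  qed
  have sm: "a \<odot>\<^bsub>?F\<^esub> c \<in> carrier ?F" if "a \<in> carrier R" "c \<in> carrier ?F" for a c
  proof -
    have "{x. a \<otimes>\<^bsub>R\<^esub> c x \<noteq> \<zero>\<^bsub>R\<^esub>} \<subseteq> {x. c x \<noteq> \<zero>\<^bsub>R\<^esub>}" using that by auto
    thus ?thesis using that by (auto simp: free_module_def intro: finite_subset)
  qed
  have ag: "abelian_group ?F"
  proof (rule abelian_groupI)
    fix c assume c: "c \<in> carrier ?F"
    have "{x. \<ominus>\<^bsub>R\<^esub> c x \<noteq> \<zero>\<^bsub>R\<^esub>} \<subseteq> {x. c x \<noteq> \<zero>\<^bsub>R\<^esub>}" by auto
    hence "(\<lambda>x. \<ominus>\<^bsub>R\<^esub> c x) \<in> carrier ?F"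
      using c by (auto simp: free_module_def intro: finite_subset)
    moreover have "(\<lambda>x. \<ominus>\<^bsub>R\<^esub> c x) \<oplus>\<^bsub>?F\<^esub> c = \<zero>\<^bsub>?F\<^esub>"
      using C[OF c] by (simp add: free_module_def R.l_neg)
    ultimately show "\<exists>y \<in> carrier ?F. y \<oplus>\<^bsub>?F\<^esub> c = \<zero>\<^bsub>?F\<^esub>" by blast
  next
    fix c d e assume "c \<in> carrier ?F" "d \<in> carrier ?F" "e \<in> carrier ?F"
    note this[THEN C]
    thus "c \<oplus>\<^bsub>?F\<^esub> d \<oplus>\<^bsub>?F\<^esub> e = c \<oplus>\<^bsub>?F\<^esub> (d \<oplus>\<^bsub>?F\<^esub> e)"
      by (simp add: free_module_def R.a_assoc)
  next
    fix c d assume "c \<in> carrier ?F" "d \<in> carrier ?F"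
    note this[THEN C]
    thus "c \<oplus>\<^bsub>?F\<^esub> d = d \<oplus>\<^bsub>?F\<^esub> c"
      by (simp add: free_module_def R.a_comm)
  next
    fix c assume "c \<in> carrier ?F"
    note C[OF this]
    thus "\<zero>\<^bsub>?F\<^esub> \<oplus>\<^bsub>?F\<^esub> c = c" by (simp add: free_module_def)
  qed (use add in \<open>auto simp: free_module_def\<close>)
  show ?thesis
  proof (rule moduleI)
    fix a b c assume "a \<in> carrier R" "b \<in> carrier R" and c: "c \<in> carrier ?F"
    thus "(a \<oplus>\<^bsub>R\<^esub> b) \<odot>\<^bsub>?F\<^esub> c = a \<odot>\<^bsub>?F\<^esub> c \<oplus>\<^bsub>?F\<^esub> b \<odot>\<^bsub>?F\<^esub> c"
      and "(a \<otimes>\<^bsub>R\<^esub> b) \<odot>\<^bsub>?F\<^esub> c = a \<odot>\<^bsub>?F\<^esub> (b \<odot>\<^bsub>?F\<^esub> c)"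
      using C[OF c] by (simp_all add: free_module_def R.l_distr R.m_assoc)
  next
    fix a c d assume "a \<in> carrier R" and c: "c \<in> carrier ?F" and d: "d \<in> carrier ?F"
    thus "a \<odot>\<^bsub>?F\<^esub> (c \<oplus>\<^bsub>?F\<^esub> d) = a \<odot>\<^bsub>?F\<^esub> c \<oplus>\<^bsub>?F\<^esub> a \<odot>\<^bsub>?F\<^esub> d"
      using C[OF c] C[OF d] by (simp add: free_module_def R.r_distr)
  next
    fix c assume c: "c \<in> carrier ?F"
    show "\<one>\<^bsub>R\<^esub> \<odot>\<^bsub>?F\<^esub> c = c" using C[OF c] by (simp add: free_module_def)
  qed (use ag sm R.is_cring in auto)
qed

definition lin_comb ::
    "('a, 'm) ring_scheme \<Rightarrow> ('a, 'c, 'l) module_scheme \<Rightarrow> ('b \<Rightarrow> 'c) \<Rightarrow> ('b \<Rightarrow> 'a) \<Rightarrow> 'c" where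
  "lin_comb R A t c = (\<Oplus>\<^bsub>A\<^esub> x \<in> {x. c x \<noteq> \<zero>\<^bsub>R\<^esub>}. c x \<odot>\<^bsub>A\<^esub> t x)"

lemma lin_comb_superset:
  assumes "module R A" "t \<in> X \<rightarrow> carrier A" "c \<in> carrier (free_module R X)"
    "finite S" "{x. c x \<noteq> \<zero>\<^bsub>R\<^esub>} \<subseteq> S" "S \<subseteq> X"
  shows "lin_comb R A t c = (\<Oplus>\<^bsub>A\<^esub> x \<in> S. c x \<odot>\<^bsub>A\<^esub> t x)"
proof -
  interpret A: module R A by fact
  have "t x \<in> carrier A" "c x \<in> carrier R" if "x \<in> S" for x
    using that assms by (auto simp: free_module_def)
  thus ?thesis unfolding lin_comb_def
    using assms(4,5) by (intro A.M.add.finprod_mono_neutral_cong_left) auto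
qed

lemma lin_comb_hom:
  assumes A: "module R A" and t: "t \<in> X \<rightarrow> carrier A"
  shows "lin_comb R A t \<in> module_hom R (free_module R X) A"
proof -
  interpret A: module R A by fact
  let ?F = "free_module R X"
  interpret F: module R ?F by (rule free_module_module) (rule A.R.is_cring)
  have sup: "finite {x. c x \<noteq> \<zero>\<^bsub>R\<^esub>}" "{x. c x \<noteq> \<zero>\<^bsub>R\<^esub>} \<subseteq> X" if "c \<in> carrier ?F" for c
    using that by (auto simp: free_module_def)
  have C: "c x \<in> carrier R" if "c \<in> carrier ?F" for c x
    using that by (cases "x \<in> X") (auto simp: free_module_def)
  have cl: "(\<lambda>x. c x \<odot>\<^bsub>A\<^esub> t x) \<in> S \<rightarrow> carrier A" if "c \<in> carrier ?F" "S \<subseteq> X" for c S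
    using that t C[OF that(1)] by (auto intro!: A.smult_closed)
  have "lin_comb R A t c \<in> carrier A" if "c \<in> carrier ?F" for c
    unfolding lin_comb_def using cl[OF that sup(2)[OF that]] by (rule A.M.finsum_closed)
  moreover have "lin_comb R A t (c \<oplus>\<^bsub>?F\<^esub> d) = lin_comb R A t c \<oplus>\<^bsub>A\<^esub> lin_comb R A t d"
    if c: "c \<in> carrier ?F" and d: "d \<in> carrier ?F" for c d
  proof -
    let ?S = "{x. c x \<noteq> \<zero>\<^bsub>R\<^esub>} \<union> {x. d x \<noteq> \<zero>\<^bsub>R\<^esub>}"
    have S: "finite ?S" "?S \<subseteq> X" using sup[OF c] sup[OF d] by auto
    have e: "c \<oplus>\<^bsub>?F\<^esub> d \<in> carrier ?F" using c d by simp
    have ev: "(c \<oplus>\<^bsub>?F\<^esub> d) x = c x \<oplus>\<^bsub>R\<^esub> d x" for x by (simp add: free_module_def)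
    have "{x. (c \<oplus>\<^bsub>?F\<^esub> d) x \<noteq> \<zero>\<^bsub>R\<^esub>} \<subseteq> ?S" by (auto simp: ev)
    hence "lin_comb R A t (c \<oplus>\<^bsub>?F\<^esub> d) = (\<Oplus>\<^bsub>A\<^esub> x \<in> ?S. (c \<oplus>\<^bsub>?F\<^esub> d) x \<odot>\<^bsub>A\<^esub> t x)"
      using lin_comb_superset[OF A t e S(1) _ S(2)] by simp
    also have "\<dots> = (\<Oplus>\<^bsub>A\<^esub> x \<in> ?S. c x \<odot>\<^bsub>A\<^esub> t x \<oplus>\<^bsub>A\<^esub> d x \<odot>\<^bsub>A\<^esub> t x)"
    proof (rule A.M.finsum_cong')
      fix x assume "x \<in> ?S"
      hence "t x \<in> carrier A" using S(2) t by auto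
      thus "(c \<oplus>\<^bsub>?F\<^esub> d) x \<odot>\<^bsub>A\<^esub> t x = c x \<odot>\<^bsub>A\<^esub> t x \<oplus>\<^bsub>A\<^esub> d x \<odot>\<^bsub>A\<^esub> t x"
        by (simp add: ev A.smult_l_distr C[OF c] C[OF d])
    qed (use cl[OF c S(2)] cl[OF d S(2)] in \<open>auto intro!: A.M.add.m_closed\<close>)
    also have "\<dots> = (\<Oplus>\<^bsub>A\<^esub> x \<in> ?S. c x \<odot>\<^bsub>A\<^esub> t x) \<oplus>\<^bsub>A\<^esub> (\<Oplus>\<^bsub>A\<^esub> x \<in> ?S. d x \<odot>\<^bsub>A\<^esub> t x)"
      by (rule A.M.finsum_addf[OF cl[OF c S(2)] cl[OF d S(2)]])
    also have "(\<Oplus>\<^bsub>A\<^esub> x \<in> ?S. c x \<odot>\<^bsub>A\<^esub> t x) = lin_comb R A t c"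
      by (rule lin_comb_superset[OF A t c S(1) _ S(2), symmetric]) auto
    also have "(\<Oplus>\<^bsub>A\<^esub> x \<in> ?S. d x \<odot>\<^bsub>A\<^esub> t x) = lin_comb R A t d"
      by (rule lin_comb_superset[OF A t d S(1) _ S(2), symmetric]) auto
    finally show ?thesis .
  qed
  moreover have "lin_comb R A t (a \<odot>\<^bsub>?F\<^esub> c) = a \<odot>\<^bsub>A\<^esub> lin_comb R A t c"
    if a: "a \<in> carrier R" and c: "c \<in> carrier ?F" for a c
  proof -
    let ?S = "{x. c x \<noteq> \<zero>\<^bsub>R\<^esub>}"
    note S = sup[OF c]
    have e: "a \<odot>\<^bsub>?F\<^esub> c \<in> carrier ?F" using a c by simp
    have ev: "(a \<odot>\<^bsub>?F\<^esub> c) x = a \<otimes>\<^bsub>R\<^esub> c x" for x by (simp add: free_module_def)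
    have "{x. (a \<odot>\<^bsub>?F\<^esub> c) x \<noteq> \<zero>\<^bsub>R\<^esub>} \<subseteq> ?S" using a by (auto simp: ev)
    hence "lin_comb R A t (a \<odot>\<^bsub>?F\<^esub> c) = (\<Oplus>\<^bsub>A\<^esub> x \<in> ?S. (a \<odot>\<^bsub>?F\<^esub> c) x \<odot>\<^bsub>A\<^esub> t x)"
      by (rule lin_comb_superset[OF A t e S(1) _ S(2)])
    also have "\<dots> = (\<Oplus>\<^bsub>A\<^esub> x \<in> ?S. a \<odot>\<^bsub>A\<^esub> (c x \<odot>\<^bsub>A\<^esub> t x))"
    proof (rule A.M.finsum_cong')
      fix x assume "x \<in> ?S"
      hence "t x \<in> carrier A" using S(2) t by auto
      thus "(a \<odot>\<^bsub>?F\<^esub> c) x \<odot>\<^bsub>A\<^esub> t x = a \<odot>\<^bsub>A\<^esub> (c x \<odot>\<^bsub>A\<^esub> t x)"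
        by (simp add: ev A.smult_assoc1 C[OF c] a)
    qed (use cl[OF c S(2)] a in auto)
    also have "\<dots> = a \<odot>\<^bsub>A\<^esub> lin_comb R A t c"
      unfolding lin_comb_def by (rule A.finsum_smult_ldistr[OF S(1) a cl[OF c S(2)], symmetric])
    finally show ?thesis .
  qed
  ultimately show ?thesis unfolding module_hom_def by auto
qed

lemma module_hom_finsum:
  assumes A: "module R A" and B: "module R B" and f: "f \<in> module_hom R A B"
    and S: "finite S" and u: "u \<in> S \<rightarrow> carrier A"
  shows "f (\<Oplus>\<^bsub>A\<^esub> x \<in> S. u x) = (\<Oplus>\<^bsub>B\<^esub> x \<in> S. f (u x))"
proof -
  interpret A: module R A by fact
  interpret B: module R B by fact
  have fc: "f x \<in> carrier B" if "x \<in> carrier A" for x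
    using f that by (auto simp: module_hom_def)
  have "f \<zero>\<^bsub>A\<^esub> = f (\<zero>\<^bsub>R\<^esub> \<odot>\<^bsub>A\<^esub> \<zero>\<^bsub>A\<^esub>)" by simp
  also have "\<dots> = \<zero>\<^bsub>R\<^esub> \<odot>\<^bsub>B\<^esub> f \<zero>\<^bsub>A\<^esub>"
    using f A.M.zero_closed A.R.zero_closed unfolding module_hom_def by blast
  finally have z: "f \<zero>\<^bsub>A\<^esub> = \<zero>\<^bsub>B\<^esub>" using fc by simp
  show ?thesis using S u
  proof (induction S rule: finite_induct)
    case empty thus ?case using z by simp
  next
    case (insert x S)
    have "(\<Oplus>\<^bsub>A\<^esub> y \<in> S. u y) \<in> carrier A"
      using insert.prems by (intro A.M.finsum_closed) auto
    hence "f (u x \<oplus>\<^bsub>A\<^esub> (\<Oplus>\<^bsub>A\<^esub> y \<in> S. u y)) = f (u x) \<oplus>\<^bsub>B\<^esub> f (\<Oplus>\<^bsub>A\<^esub> y \<in> S. u y)"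
      using f insert.prems unfolding module_hom_def by auto
    thus ?case using insert fc by (simp add: Pi_def)
  qed
qed

lemma module_hom_lin_comb:
  assumes A: "module R A" and B: "module R B" and f: "f \<in> module_hom R A B"
    and t: "t \<in> X \<rightarrow> carrier A" and c: "c \<in> carrier (free_module R X)"
  shows "f (lin_comb R A t c) = lin_comb R B (\<lambda>x. f (t x)) c"
proof -
  interpret A: module R A by fact
  interpret B: module R B by fact
  let ?S = "{x. c x \<noteq> \<zero>\<^bsub>R\<^esub>}"
  have S: "finite ?S" "?S \<subseteq> X" using c by (auto simp: free_module_def)
  have C: "c x \<in> carrier R" "t x \<in> carrier A" "f (t x) \<in> carrier B" if "x \<in> ?S" for x
    using that c S t f by (auto simp: free_module_def module_hom_def)
  have "f (lin_comb R A t c) = (\<Oplus>\<^bsub>B\<^esub> x \<in> ?S. f (c x \<odot>\<^bsub>A\<^esub> t x))"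
    unfolding lin_comb_def using C by (intro module_hom_finsum[OF A B f S(1)]) auto
  also have "\<dots> = (\<Oplus>\<^bsub>B\<^esub> x \<in> ?S. c x \<odot>\<^bsub>B\<^esub> f (t x))"
    using C f by (intro B.M.finsum_cong') (auto simp: module_hom_def)
  finally show ?thesis unfolding lin_comb_def .
qed

lemma module_hom_comp:
  "f \<in> module_hom R A B \<Longrightarrow> g \<in> module_hom R B C \<Longrightarrow> (\<lambda>x. g (f x)) \<in> module_hom R A C"
  unfolding module_hom_def by (auto simp: Pi_iff)

lemma projective_module_lift:
  assumes P: "projective_module R P" and A: "module R A" and B: "module R B"
    and f: "f \<in> module_hom R A B" and surj: "f ` carrier A = carrier B"
    and g: "g \<in> module_hom R P B"
  shows "\<exists>h \<in> module_hom R P A. \<forall>x \<in> carrier P. f (h x) = g x"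
proof -
  have mP: "module R P" using P by (simp add: projective_module_def)
  interpret P: module R P by fact
  interpret A: module R A by fact
  interpret B: module R B by fact
  let ?F = "free_module R (carrier P)"
  let ?e = "lin_comb R P (\<lambda>x. x)"
  have F: "module R ?F" by (rule free_module_module) (rule P.R.is_cring)
  have e: "?e \<in> module_hom R ?F P" by (rule lin_comb_hom[OF mP]) auto
  have "x \<in> ?e ` carrier ?F" if x: "x \<in> carrier P" for x
  proof (rule image_eqI)
    let ?d = "\<lambda>y. if y = x then \<one>\<^bsub>R\<^esub> else \<zero>\<^bsub>R\<^esub>"
    show d: "?d \<in> carrier ?F" using x by (auto simp: free_module_def)
    have "?e ?d = (\<Oplus>\<^bsub>P\<^esub> y \<in> {x}. ?d y \<odot>\<^bsub>P\<^esub> y)"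
      using x by (intro lin_comb_superset[OF mP _ d]) auto
    thus "x = ?e ?d" using x by simp
  qed
  hence "?e ` carrier ?F = carrier P" using e by (auto simp: module_hom_def)
  moreover have "(\<lambda>x. x) \<in> module_hom R P P" by (auto simp: module_hom_def)
  ultimately obtain s where s: "s \<in> module_hom R P ?F" "\<And>x. x \<in> carrier P \<Longrightarrow> ?e (s x) = x"
    using P F mP e unfolding projective_module_def by blast
  have "\<forall>x \<in> carrier P. \<exists>y \<in> carrier A. f y = g x"
  proof
    fix x assume "x \<in> carrier P"
    hence "g x \<in> f ` carrier A" using g surj by (auto simp: module_hom_def)
    thus "\<exists>y \<in> carrier A. f y = g x" by auto
  qed
  then obtain t where t: "\<And>x. x \<in> carrier P \<Longrightarrow> t x \<in> carrier A \<and> f (t x) = g x" by metis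
  hence tA: "t \<in> carrier P \<rightarrow> carrier A" by auto
  let ?h = "\<lambda>x. lin_comb R A t (s x)"
  have "?h \<in> module_hom R P A"
    by (rule module_hom_comp[OF s(1) lin_comb_hom[OF A tA]])
  moreover have "f (?h x) = g x" if x: "x \<in> carrier P" for x
  proof -
    have sx: "s x \<in> carrier ?F" using s(1) x by (auto simp: module_hom_def)
    have supp: "y \<in> carrier P" "s x y \<in> carrier R" if "s x y \<noteq> \<zero>\<^bsub>R\<^esub>" for y
      using sx that by (auto simp: free_module_def)
    have gB: "g y \<in> carrier B" if "y \<in> carrier P" for y
      using g that by (auto simp: module_hom_def)
    have "f (?h x) = lin_comb R B (\<lambda>y. f (t y)) (s x)"
      by (rule module_hom_lin_comb[OF A B f tA sx])
    also have "\<dots> = lin_comb R B g (s x)"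
      unfolding lin_comb_def
    proof (rule B.M.finsum_cong')
      show "(\<lambda>y. s x y \<odot>\<^bsub>B\<^esub> g y) \<in> {y. s x y \<noteq> \<zero>\<^bsub>R\<^esub>} \<rightarrow> carrier B"
        using supp gB by (intro Pi_I B.smult_closed) simp_all
    next
      fix y assume "y \<in> {y. s x y \<noteq> \<zero>\<^bsub>R\<^esub>}"
      hence "f (t y) = g y" using supp(1) t by blast
      thus "s x y \<odot>\<^bsub>B\<^esub> f (t y) = s x y \<odot>\<^bsub>B\<^esub> g y" by (rule arg_cong)
    qed (rule refl)
    also have "\<dots> = g (?e (s x))"
      by (rule module_hom_lin_comb[OF mP B g _ sx, symmetric]) auto
    also have "\<dots> = g x" by (simp only: s(2)[OF x])
    finally show ?thesis .
  qed
  ultimately show ?thesis by (intro bexI ballI)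
qed

end

theory Submission
  imports Defs
begin

text \<open>
  The theorem follows once a single nonzero \<open>c \<in> R\<close> with \<open>c M\<close> contained in a finitely generated free
  submodule is known. Then \<open>T = {x. c x = 0}\<close> is bounded, and \<open>M / T\<close> is isomorphic to \<open>c M\<close>, a
  submodule of some \<open>R\<^sup>n\<close>, hence finitely generated and projective, and the projection onto \<open>M / T\<close>
  splits. This last part is done with an explicit dual basis that is found locally, where every
  ideal of \<open>R\<close> is principal (\<open>local_dual_system\<close>), and glued because the admissible denominators form an
  ideal (\<open>global_dual_system\<close>).

  The element \<open>c\<close> comes from quotients. Being regularly weakly based does not obviously pass to
  quotients, but it does in three cases: the quotient by finitely many elements
  (\<open>rwb_mod_finite\<close>), the quotient by a direct summand (\<open>rwb_mod_complement\<close>), and, most importantly,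
  the quotient by the span of a set \<open>B\<close> which is a weak basis modulo some submodule \<open>L\<close>
  (\<open>rwb_mod_irredundant\<close>). In the last case the elements of \<open>B\<close> can be changed freely by elements of
  \<open>L\<close>, and for a suitable choice the quotient becomes so degenerate that it has no weak basis.

  This gives the torsion case (\<open>torsion_bounded\<close>). If \<open>M\<close> is \<open>p\<close>-primary, then \<open>p M\<close> is superfluous, since
  lifts of a basis of \<open>M / p M\<close> may be divided out and what remains is \<open>p\<close>-divisible. On the other
  hand an unbounded primary module has a nonzero divisible quotient, that is, a proper submodule \<open>K\<close> with
  \<open>K + p M = M\<close>. So every primary component is bounded, and only finitely many of them are nonzero, because
  infinitely many would produce a generating set that runs up an infinite chain of cyclic
  submodules.

  For general \<open>M\<close> let \<open>G\<close> be a maximal linearly independent subset of a weak basis. If \<open>G\<close> is finite, then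
  \<open>M / span G\<close> is a torsion module to which the torsion case applies, and this is the desired \<open>c\<close>.
  If \<open>G\<close> is infinite, then the elements \<open>f n\<close> of a sequence in \<open>G\<close> may be replaced by
  \<open>f n - a n f (n + 1)\<close> with non-units \<open>a n\<close>; dividing by them, by \<open>f 0\<close> and by the rest of \<open>G\<close> leaves a
  torsion module that contains \<open>f n\<close> as a copy of \<open>1 / (a 0 \<cdots> a (n - 1))\<close> modulo \<open>R\<close> and therefore is
  not bounded, contrary to the torsion case.
\<close>

section \<open>Submodules and spans\<close>

context module
begin

text \<open>The undecorated ring symbols are left to \<open>R\<close>.\<close>

abbreviation smult_M (infixl "\<cdot>" 70) where "r \<cdot> x \<equiv> r \<odot>\<^bsub>M\<^esub> x"
abbreviation add_M (infixl "\<boxplus>" 65) where "x \<boxplus> y \<equiv> x \<oplus>\<^bsub>M\<^esub> y"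
abbreviation minus_M (infixl "\<boxminus>" 65) where "x \<boxminus> y \<equiv> x \<ominus>\<^bsub>M\<^esub> y"

abbreviation span :: "'c set \<Rightarrow> 'c set" where
  "span X \<equiv> module_span R M X"

abbreviation submod :: "'c set \<Rightarrow> bool" where
  "submod N \<equiv> submodule N R M"

lemma submodI:
  assumes N: "N \<subseteq> carrier M" "\<zero>\<^bsub>M\<^esub> \<in> N" "\<And>a b. a \<in> N \<Longrightarrow> b \<in> N \<Longrightarrow> a \<boxplus> b \<in> N"
    and smult: "\<And>r a. r \<in> carrier R \<Longrightarrow> a \<in> N \<Longrightarrow> r \<cdot> a \<in> N"
  shows "submod N"
proof (rule submoduleI)
  fix a assume a: "a \<in> N"
  hence "\<ominus>\<^bsub>M\<^esub> a = (\<ominus> \<one>) \<cdot> a" using N(1) by (auto simp: smult_l_minus)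
  thus "\<ominus>\<^bsub>M\<^esub> a \<in> N" using smult[of "\<ominus> \<one>", OF _ a] by simp
qed (use assms in auto)

lemma submod_carrier: "submod N \<Longrightarrow> x \<in> N \<Longrightarrow> x \<in> carrier M"
  using submoduleE(1) by blast

lemma submod_zero: "submod N \<Longrightarrow> \<zero>\<^bsub>M\<^esub> \<in> N"
  using submodule.axioms(1) subgroup.one_closed by fastforce

lemma submod_diff: "submod N \<Longrightarrow> x \<in> N \<Longrightarrow> y \<in> N \<Longrightarrow> x \<boxminus> y \<in> N"
  by (simp add: M.minus_eq submoduleE(3,5))

lemma submod_add_cancel:
  assumes "submod N" "x \<in> carrier M" "y \<in> N" "x \<boxplus> y \<in> N"
  shows "x \<in> N"
proof -
  have "x = (x \<boxplus> y) \<boxminus> y"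
    using assms submod_carrier by (simp add: M.minus_eq M.a_assoc M.r_neg)
  thus ?thesis using assms submod_diff by metis
qed

lemma submod_diff_cancel:
  assumes "submod N" "x \<in> carrier M" "y \<in> N" "x \<boxminus> y \<in> N"
  shows "x \<in> N"
  using assms submod_add_cancel[of N x "\<ominus>\<^bsub>M\<^esub> y"] submoduleE(3) by (simp add: M.minus_eq)

lemma diff_add: "x \<in> carrier M \<Longrightarrow> y \<in> carrier M \<Longrightarrow> (x \<boxminus> y) \<boxplus> y = x"
  by (simp add: M.minus_eq M.a_assoc M.l_neg)

lemma add_diff: "x \<in> carrier M \<Longrightarrow> y \<in> carrier M \<Longrightarrow> (x \<boxplus> y) \<boxminus> y = x"
  by (simp add: M.minus_eq M.a_assoc M.r_neg)

lemma smult_diff_r: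
  "a \<in> carrier R \<Longrightarrow> x \<in> carrier M \<Longrightarrow> y \<in> carrier M \<Longrightarrow>
    a \<cdot> (x \<boxminus> y) = a \<cdot> x \<boxminus> a \<cdot> y"
  by (simp add: M.minus_eq smult_r_distr smult_r_minus)

lemma smult_diff_l:
  "a \<in> carrier R \<Longrightarrow> b \<in> carrier R \<Longrightarrow> x \<in> carrier M \<Longrightarrow>
    (a \<ominus> b) \<cdot> x = a \<cdot> x \<boxminus> b \<cdot> x"
  by (simp add: R.minus_eq M.minus_eq smult_l_distr smult_l_minus)

lemma smult_commute:
  "a \<in> carrier R \<Longrightarrow> b \<in> carrier R \<Longrightarrow> x \<in> carrier M \<Longrightarrow>
    a \<cdot> (b \<cdot> x) = b \<cdot> (a \<cdot> x)"
  by (metis smult_assoc1 R.m_comm)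

text \<open>\<open>x = (1 - r s) x + r (s x)\<close>.\<close>
lemma submod_comaximal:
  assumes "submod N" "x \<in> carrier M" "r \<in> carrier R" "s \<in> carrier R"
    and "(\<one> \<ominus> r \<otimes> s) \<cdot> x \<in> N" "s \<cdot> x \<in> N"
  shows "x \<in> N"
proof -
  have "x \<boxminus> r \<cdot> (s \<cdot> x) \<in> N"
    using assms(2-5) by (simp add: smult_diff_l smult_assoc1)
  thus ?thesis
    using assms submod_diff_cancel submoduleE(4) by blast
qed

lemma submod_singleton_zero: "submod {\<zero>\<^bsub>M\<^esub>}"
  by (rule submoduleI) auto

lemma submod_Inter:
  assumes "\<And>N. N \<in> C \<Longrightarrow> submod N" "C \<noteq> {}"
  shows "submod (\<Inter>C)"
proof (rule submodI)
  show "\<Inter>C \<subseteq> carrier M" using assms submod_carrier by fastforce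
qed (use assms submod_zero submoduleE(3,4,5) in \<open>auto\<close>)

lemma submod_chain_Union:
  assumes "subset.chain (Collect submod) C" "C \<noteq> {}"
  shows "submod (\<Union>C)"
proof -
  have s: "\<And>N. N \<in> C \<Longrightarrow> submod N" using assms by (auto simp: pred_on.chain_def)
  have two: "\<exists>N \<in> C. a \<in> N \<and> b \<in> N" if "a \<in> \<Union>C" "b \<in> \<Union>C" for a b
    using that assms(1) unfolding pred_on.chain_def by blast
  show ?thesis
  proof (rule submodI)
    show "\<Union>C \<subseteq> carrier M" using s submod_carrier by auto
    show "\<zero>\<^bsub>M\<^esub> \<in> \<Union>C" using s submod_zero assms(2) by auto
    show "r \<cdot> a \<in> \<Union>C" if "r \<in> carrier R" "a \<in> \<Union>C" for r a
      using that s submoduleE(4) by blast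
    fix a b assume "a \<in> \<Union>C" "b \<in> \<Union>C"
    then obtain N where "N \<in> C" "a \<in> N" "b \<in> N" using two by blast
    thus "a \<boxplus> b \<in> \<Union>C" using s submoduleE(5) by blast
  qed
qed

lemma submod_span: "X \<subseteq> carrier M \<Longrightarrow> submod (span X)"
  unfolding module_span_def using carrier_is_submodule by (intro submod_Inter) auto

lemma span_base: "x \<in> X \<Longrightarrow> x \<in> span X"
  unfolding module_span_def by auto

lemma span_superset: "X \<subseteq> span X"
  using span_base by auto

lemma span_least: "submod N \<Longrightarrow> X \<subseteq> N \<Longrightarrow> span X \<subseteq> N"
  unfolding module_span_def by auto

lemma span_mono: "X \<subseteq> Y \<Longrightarrow> span X \<subseteq> span Y"
  unfolding module_span_def by auto

lemma span_carrier: "X \<subseteq> carrier M \<Longrightarrow> span X \<subseteq> carrier M"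
  using span_least carrier_is_submodule by auto

lemma span_submod: "submod N \<Longrightarrow> span N = N"
  using span_least span_superset by blast

lemma span_least_span: "X \<subseteq> span Y \<Longrightarrow> Y \<subseteq> carrier M \<Longrightarrow> span X \<subseteq> span Y"
  using span_least submod_span by auto

lemma span_eqI: "X \<subseteq> span Y \<Longrightarrow> Y \<subseteq> span X \<Longrightarrow> X \<subseteq> carrier M \<Longrightarrow> Y \<subseteq> carrier M \<Longrightarrow> span X = span Y"
  using span_least_span by (intro equalityI) auto

lemma submod_sum:
  assumes "submod A" "submod B"
  shows "submod {a \<boxplus> b | a b. a \<in> A \<and> b \<in> B}"
proof (rule submodI)
  show "{a \<boxplus> b | a b. a \<in> A \<and> b \<in> B} \<subseteq> carrier M"
    using assms submod_carrier by auto
  show "\<zero>\<^bsub>M\<^esub> \<in> {a \<boxplus> b | a b. a \<in> A \<and> b \<in> B}"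
    using assms submod_zero by (intro CollectI exI[of _ "\<zero>\<^bsub>M\<^esub>"]) auto
next
  fix x y assume "x \<in> {a \<boxplus> b | a b. a \<in> A \<and> b \<in> B}" "y \<in> {a \<boxplus> b | a b. a \<in> A \<and> b \<in> B}"
  then obtain a b c d where ab: "a \<in> A" "b \<in> B" "x = a \<boxplus> b"
    and cd: "c \<in> A" "d \<in> B" "y = c \<boxplus> d" by auto
  have "x \<boxplus> y = (a \<boxplus> c) \<boxplus> (b \<boxplus> d)"
    using ab cd assms submod_carrier by (simp add: M.a_ac)
  thus "x \<boxplus> y \<in> {a \<boxplus> b | a b. a \<in> A \<and> b \<in> B}"
    using ab cd assms submoduleE(5) by blast
next
  fix r x assume r: "r \<in> carrier R" and "x \<in> {a \<boxplus> b | a b. a \<in> A \<and> b \<in> B}"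
  then obtain a b where ab: "a \<in> A" "b \<in> B" "x = a \<boxplus> b" by auto
  hence "r \<cdot> x = r \<cdot> a \<boxplus> r \<cdot> b"
    using assms submod_carrier r smult_r_distr by metis
  thus "r \<cdot> x \<in> {a \<boxplus> b | a b. a \<in> A \<and> b \<in> B}"
    using ab assms r submoduleE(4) by blast
qed

lemma span_Un_decompose:
  assumes "A \<subseteq> carrier M" "B \<subseteq> carrier M" "x \<in> span (A \<union> B)"
  obtains a b where "a \<in> span A" "b \<in> span B" "x = a \<boxplus> b"
proof -
  let ?S = "{a \<boxplus> b | a b. a \<in> span A \<and> b \<in> span B}"
  have z: "\<zero>\<^bsub>M\<^esub> \<in> span A" "\<zero>\<^bsub>M\<^esub> \<in> span B" using assms submod_span submod_zero by auto
  have "A \<union> B \<subseteq> ?S"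
  proof
    fix y assume y: "y \<in> A \<union> B"
    hence "y = y \<boxplus> \<zero>\<^bsub>M\<^esub>" "y = \<zero>\<^bsub>M\<^esub> \<boxplus> y" using assms by auto
    thus "y \<in> ?S" using y z span_base by blast
  qed
  hence "span (A \<union> B) \<subseteq> ?S" using assms submod_span by (intro span_least submod_sum) auto
  thus ?thesis using assms(3) that by auto
qed

lemma span_Un_submods:
  assumes "submod A" "submod B" "x \<in> span (A \<union> B)"
  obtains a b where "a \<in> A" "b \<in> B" "x = a \<boxplus> b"
  using span_Un_decompose[of A B x] assms by (metis span_submod submoduleE(1))

lemma submod_multiples: "x \<in> carrier M \<Longrightarrow> submod {r \<cdot> x | r. r \<in> carrier R}"
proof (rule submodI)
  assume x: "x \<in> carrier M"
  show "{r \<cdot> x | r. r \<in> carrier R} \<subseteq> carrier M" using x by auto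
  show "\<zero>\<^bsub>M\<^esub> \<in> {r \<cdot> x | r. r \<in> carrier R}" 
    using x by (intro CollectI exI[of _ \<zero>]) auto
next
  fix a b assume "x \<in> carrier M" "a \<in> {r \<cdot> x | r. r \<in> carrier R}" "b \<in> {r \<cdot> x | r. r \<in> carrier R}"
  then obtain r s where "x \<in> carrier M" "r \<in> carrier R" "a = r \<cdot> x" "s \<in> carrier R" "b = s \<cdot> x"
    by auto
  thus "a \<boxplus> b \<in> {r \<cdot> x | r. r \<in> carrier R}"
    by (intro CollectI exI[of _ "r \<oplus> s"]) (simp add: smult_l_distr)
next
  fix a b assume "x \<in> carrier M" "a \<in> carrier R" "b \<in> {r \<cdot> x | r. r \<in> carrier R}"
  then obtain r where "x \<in> carrier M" "a \<in> carrier R" "r \<in> carrier R" "b = r \<cdot> x" by auto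
  thus "a \<cdot> b \<in> {r \<cdot> x | r. r \<in> carrier R}"
    by (intro CollectI exI[of _ "a \<otimes> r"]) (simp add: smult_assoc1)
qed

lemma span_insert_decompose:
  assumes "A \<subseteq> carrier M" "y \<in> carrier M" "x \<in> span (insert y A)"
  obtains a r where "a \<in> span A" "r \<in> carrier R" "x = a \<boxplus> r \<cdot> y"
proof -
  have "x \<in> span (A \<union> {y})" using assms by simp
  then obtain a b where ab: "a \<in> span A" "b \<in> span {y}" "x = a \<boxplus> b"
    using span_Un_decompose assms by (metis empty_subsetI insert_subset)
  have "y = \<one> \<cdot> y" using assms by simp
  hence "{y} \<subseteq> {r \<cdot> y | r. r \<in> carrier R}" by blast
  hence "span {y} \<subseteq> {r \<cdot> y | r. r \<in> carrier R}" using assms submod_multiples span_least by simp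
  thus ?thesis using ab that by auto
qed

lemma span_finitary:
  assumes "X \<subseteq> carrier M" "x \<in> span X"
  obtains F where "finite F" "F \<subseteq> X" "x \<in> span F"
proof -
  let ?S = "{x. \<exists>F. finite F \<and> F \<subseteq> X \<and> x \<in> span F}"
  have sF: "submod (span F)" if "F \<subseteq> X" for F using that assms(1) by (intro submod_span) auto
  have up: "\<exists>G. finite G \<and> G \<subseteq> X \<and> a \<in> span G \<and> b \<in> span G" if ab: "a \<in> ?S" "b \<in> ?S" for a b
  proof -
    from ab(1) obtain F where F: "finite F" "F \<subseteq> X" "a \<in> span F" by blast
    from ab(2) obtain G where G: "finite G" "G \<subseteq> X" "b \<in> span G" by blast
    have "a \<in> span (F \<union> G)" "b \<in> span (F \<union> G)"
      using F(3) G(3) span_mono[of F "F \<union> G"] span_mono[of G "F \<union> G"] by auto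
    thus ?thesis using F G by (intro exI[of _ "F \<union> G"]) auto
  qed
  have "submod ?S"
  proof (rule submodI)
    show "?S \<subseteq> carrier M" using sF submod_carrier by blast
    have "{} \<subseteq> X" "finite {}" "\<zero>\<^bsub>M\<^esub> \<in> span {}" using sF[of "{}"] submod_zero by auto
    thus "\<zero>\<^bsub>M\<^esub> \<in> ?S" by blast
  next
    fix a b assume "a \<in> ?S" "b \<in> ?S"
    from up[OF this] obtain F where F: "finite F" "F \<subseteq> X" "a \<in> span F" "b \<in> span F" by blast
    hence "a \<boxplus> b \<in> span F" using sF submoduleE(5) by simp
    thus "a \<boxplus> b \<in> ?S" using F by blast
  next
    fix r a assume r: "r \<in> carrier R" and "a \<in> ?S"
    then obtain F where F: "finite F" "F \<subseteq> X" "a \<in> span F" by blast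
    hence "r \<cdot> a \<in> span F" using sF r submoduleE(4) by simp
    thus "r \<cdot> a \<in> ?S" using F by blast
  qed
  moreover have "X \<subseteq> ?S"
  proof
    fix y assume "y \<in> X"
    hence "finite {y}" "{y} \<subseteq> X" "y \<in> span {y}" by (auto intro: span_base)
    thus "y \<in> ?S" by blast
  qed
  ultimately have "span X \<subseteq> ?S" by (rule span_least)
  thus ?thesis using assms(2) that by auto
qed

text \<open>Zorn's lemma yields a quotient \<open>M / L\<close> in which every nonzero submodule contains the image of \<open>e\<close>.\<close>
lemma maximal_submod_avoiding:
  assumes "submod N" "e \<in> carrier M" "e \<notin> N"
  obtains L where "submod L" "N \<subseteq> L" "e \<notin> L"
    "\<And>x. x \<in> carrier M \<Longrightarrow> x \<notin> L \<Longrightarrow> \<exists>l \<in> L. \<exists>r \<in> carrier R. e = l \<boxplus> r \<cdot> x"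
proof -
  let ?A = "{L. submod L \<and> N \<subseteq> L \<and> e \<notin> L}"
  have "\<exists>L \<in> ?A. \<forall>X \<in> ?A. L \<subseteq> X \<longrightarrow> X = L"
  proof (rule subset_Zorn_nonempty)
    show "?A \<noteq> {}" using assms by auto
    fix C assume C: "C \<noteq> {}" "subset.chain ?A C"
    hence "submod (\<Union>C)" by (intro submod_chain_Union) (auto simp: pred_on.chain_def)
    moreover have "N \<subseteq> \<Union>C \<and> e \<notin> \<Union>C" using C by (auto simp: pred_on.chain_def)
    ultimately show "\<Union>C \<in> ?A" by simp
  qed
  then obtain L where L: "submod L" "N \<subseteq> L" "e \<notin> L"
    and m: "\<And>X. submod X \<Longrightarrow> e \<notin> X \<Longrightarrow> L \<subseteq> X \<Longrightarrow> X = L" by auto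
  have "\<exists>l \<in> L. \<exists>r \<in> carrier R. e = l \<boxplus> r \<cdot> x" if x: "x \<in> carrier M" "x \<notin> L" for x
  proof -
    have Lc: "L \<subseteq> carrier M" using L submoduleE(1) by simp
    hence "submod (span (insert x L))" using x by (intro submod_span) auto
    moreover have "L \<subseteq> span (insert x L)" "x \<in> span (insert x L)" using span_base by auto
    ultimately have "e \<in> span (insert x L)" using m x by blast
    thus ?thesis using span_insert_decompose[OF Lc x(1)] span_submod[OF L(1)] by metis
  qed
  thus ?thesis using that L by blast
qed

end


section \<open>Independent generating subsets\<close>

text \<open>
  The Steinitz argument works for every finitary closure operator with the exchange property. It
  is applied to the span modulo a submodule \<open>L\<close> for which \<open>M / L\<close> is a vector space over \<open>R / p\<close>, and to
  the span up to torsion.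
\<close>
lemma exists_independent_spanning_subset:
  fixes cl :: "'a set \<Rightarrow> 'a set"
  assumes mono: "\<And>A B. A \<subseteq> B \<Longrightarrow> B \<subseteq> X \<Longrightarrow> cl A \<subseteq> cl B"
    and ext: "\<And>A. A \<subseteq> X \<Longrightarrow> A \<subseteq> cl A"
    and fin: "\<And>A x. A \<subseteq> X \<Longrightarrow> x \<in> cl A \<Longrightarrow> \<exists>F. finite F \<and> F \<subseteq> A \<and> x \<in> cl F"
    and exch: "\<And>A x y. A \<subseteq> X \<Longrightarrow> x \<in> X \<Longrightarrow> y \<in> X \<Longrightarrow> y \<in> cl (insert x A) \<Longrightarrow> y \<notin> cl A
      \<Longrightarrow> x \<in> cl (insert y A)"
  obtains B where "B \<subseteq> X" "\<forall>b \<in> B. b \<notin> cl (B - {b})" "X \<subseteq> cl B"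
proof -
  let ?I = "{B. B \<subseteq> X \<and> (\<forall>b \<in> B. b \<notin> cl (B - {b}))}"
  have "\<exists>B \<in> ?I. \<forall>D \<in> ?I. B \<subseteq> D \<longrightarrow> D = B"
  proof (rule subset_Zorn_nonempty)
    show "?I \<noteq> {}" by blast
    fix C assume C: "C \<noteq> {}" "subset.chain ?I C"
    hence sub: "\<Union>C \<subseteq> X" by (auto simp: pred_on.chain_def)
    have "b \<notin> cl (\<Union>C - {b})" if b: "b \<in> \<Union>C" for b
    proof
      assume "b \<in> cl (\<Union>C - {b})"
      moreover have "\<Union>C - {b} \<subseteq> X" using sub by auto
      ultimately obtain F where F: "finite F" "F \<subseteq> \<Union>C - {b}" "b \<in> cl F"
        using fin by meson
      hence "finite (insert b F)" "insert b F \<subseteq> \<Union>C" using b by auto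
      then obtain D where D: "D \<in> C" "insert b F \<subseteq> D"
        using finite_subset_Union_chain[OF _ _ C(1,2)] by metis
      have DI: "D \<in> ?I" using C D by (auto simp: pred_on.chain_def)
      hence "b \<notin> cl (D - {b})" "D - {b} \<subseteq> X" using D by auto
      moreover have "F \<subseteq> D - {b}" using D F by auto
      ultimately show False using mono[of F "D - {b}"] F(3) by auto
    qed
    thus "\<Union>C \<in> ?I" using sub by blast
  qed
  then obtain B where B: "B \<in> ?I" and m: "\<forall>D \<in> ?I. B \<subseteq> D \<longrightarrow> D = B" by (rule bexE)
  have "x \<in> cl B" if x: "x \<in> X" for x
  proof (rule ccontr)
    assume n: "x \<notin> cl B"
    hence xB: "x \<notin> B" using ext[of B] B by auto
    have "b \<notin> cl (insert x B - {b})" if b: "b \<in> insert x B" for b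
    proof (cases "b = x")
      case True
      thus ?thesis using n xB by simp
    next
      case False
      hence bB: "b \<in> B" "insert x B - {b} = insert x (B - {b})" "insert b (B - {b}) = B"
        using b by auto
      show ?thesis
      proof
        assume "b \<in> cl (insert x B - {b})"
        hence "x \<in> cl (insert b (B - {b}))"
          using exch[of "B - {b}" x b] bB B x by auto
        thus False using n bB by simp
      qed
    qed
    hence "insert x B \<in> ?I" using x B by blast
    hence "insert x B = B" using m by (meson subset_insertI)
    thus False using xB by auto
  qed
  hence "X \<subseteq> cl B" by auto
  thus ?thesis using that[of B] B by auto
qed


section \<open>Weak bases relative to a submodule\<close>

context module
begin

text \<open>
  All quotients \<open>M / K\<close> are handled inside \<open>M\<close>: lifts of a weak basis of \<open>M / K\<close> are a set that
  generates \<open>M\<close> together with \<open>K\<close> and is irredundant in doing so.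
\<close>
definition weak_basis_mod :: "'c set \<Rightarrow> 'c set \<Rightarrow> bool" where
  "weak_basis_mod K Y \<longleftrightarrow> Y \<subseteq> carrier M \<and> span (K \<union> Y) = carrier M \<and>
     (\<forall>y \<in> Y. y \<notin> span (K \<union> (Y - {y})))"

definition rwb_mod :: "'c set \<Rightarrow> bool" where
  "rwb_mod K \<longleftrightarrow> (\<forall>X \<subseteq> carrier M. span (K \<union> X) = carrier M \<longrightarrow> (\<exists>Y \<subseteq> X. weak_basis_mod K Y))"

lemma span_zero_Un: "X \<subseteq> carrier M \<Longrightarrow> span ({\<zero>\<^bsub>M\<^esub>} \<union> X) = span X"
  using submod_zero[OF submod_span] span_base by (intro span_eqI) auto

lemma rwb_mod_zero:
  assumes "regularly_weakly_based R M"
  shows "rwb_mod {\<zero>\<^bsub>M\<^esub>}"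
  unfolding rwb_mod_def
proof (intro allI impI)
  fix X assume X: "X \<subseteq> carrier M" "span ({\<zero>\<^bsub>M\<^esub>} \<union> X) = carrier M"
  hence "generates R M X" using span_zero_Un[of X] by (simp add: generates_def)
  then obtain Y where Y: "Y \<subseteq> X" "weak_basis R M Y"
    using assms by (auto simp: regularly_weakly_based_def)
  hence "weak_basis_mod {\<zero>\<^bsub>M\<^esub>} Y"
    using X unfolding weak_basis_mod_def weak_basis_def generates_def weakly_independent_def
    by (metis Diff_subset span_zero_Un subset_trans)
  thus "\<exists>Y \<subseteq> X. weak_basis_mod {\<zero>\<^bsub>M\<^esub>} Y" using Y by blast
qed

lemma span_Un_span: "A \<subseteq> carrier M \<Longrightarrow> B \<subseteq> carrier M \<Longrightarrow> span (span A \<union> B) = span (A \<union> B)"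
  using span_mono[of A "A \<union> B"] span_superset[of "A \<union> B"] span_superset[of A] span_superset[of "span A \<union> B"]
    span_carrier[of A]
  by (intro span_eqI) auto

text \<open>
  Replacing each element of \<open>X\<close> by a lift of its class to \<open>L\<close> changes neither the span together with \<open>K\<close>
  nor irredundancy. One preimage in \<open>X\<close> for each lift turns a weak basis among the lifts into one in \<open>X\<close>.
\<close>
lemma rwb_mod_lifts:
  assumes K: "submod K" and L: "submod L"
    and LK: "\<And>x. x \<in> carrier M \<Longrightarrow> \<exists>l \<in> L. x \<boxminus> l \<in> K"
    and test: "\<And>X. X \<subseteq> L \<Longrightarrow> span (K \<union> X) = carrier M \<Longrightarrow> \<exists>Z \<subseteq> X. weak_basis_mod K Z"
  shows "rwb_mod K"
  unfolding rwb_mod_def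
proof (intro allI impI)
  fix X assume X: "X \<subseteq> carrier M" "span (K \<union> X) = carrier M"
  obtain f where f: "\<And>x. x \<in> carrier M \<Longrightarrow> f x \<in> L \<and> x \<boxminus> f x \<in> K"
    using LK by metis
  have Kc: "K \<subseteq> carrier M" and Lc: "L \<subseteq> carrier M" using K L submoduleE(1) by auto
  have fc: "f x \<in> carrier M" if "x \<in> carrier M" for x using f[OF that] Lc by auto
  have down: "f x \<in> N \<longleftrightarrow> x \<in> N" if N: "submod N" "K \<subseteq> N" and x: "x \<in> carrier M" for N x
  proof
    assume "f x \<in> N"
    thus "x \<in> N" using submod_diff_cancel[OF N(1) x] f[OF x] N(2) by auto
  next
    assume "x \<in> N"
    hence "x \<boxminus> (x \<boxminus> f x) \<in> N" using submod_diff[OF N(1)] f[OF x] N(2) by auto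
    moreover have "x \<boxminus> (x \<boxminus> f x) = f x"
      using x fc[OF x] by (simp add: M.minus_eq M.minus_add M.a_assoc[symmetric] M.r_neg)
    ultimately show "f x \<in> N" by simp
  qed
  have sp: "submod (span (K \<union> A))" "K \<subseteq> span (K \<union> A)" "A \<subseteq> span (K \<union> A)" if "A \<subseteq> carrier M" for A
    using that Kc span_superset[of "K \<union> A"] by (auto intro!: submod_span)
  have eq: "span (K \<union> f ` A) = span (K \<union> A)" if A: "A \<subseteq> carrier M" for A
  proof (rule span_eqI)
    have fA: "f ` A \<subseteq> carrier M" using A fc by auto
    show "K \<union> f ` A \<subseteq> carrier M" "K \<union> A \<subseteq> carrier M" using Kc A fA by auto
    show "K \<union> f ` A \<subseteq> span (K \<union> A)"
      using sp[OF A] down[OF sp(1,2)[OF A]] A by auto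
    show "K \<union> A \<subseteq> span (K \<union> f ` A)"
      using sp[OF fA] down[OF sp(1,2)[OF fA]] A by auto
  qed
  have "f ` X \<subseteq> L" using f X by auto
  then obtain Z where Z: "Z \<subseteq> f ` X" "weak_basis_mod K Z"
    using test[of "f ` X"] eq[OF X(1)] X(2) by auto
  then obtain Y where Y: "Y \<subseteq> X" "inj_on f Y" "Z = f ` Y"
    by (metis subset_image_inj)
  have Yc: "Y \<subseteq> carrier M" using Y X by auto
  have "y \<notin> span (K \<union> (Y - {y}))" if y: "y \<in> Y" for y
  proof
    have Yy: "Y - {y} \<subseteq> carrier M" using Yc by auto
    assume "y \<in> span (K \<union> (Y - {y}))"
    hence "f y \<in> span (K \<union> f ` (Y - {y}))"
      using down[OF sp(1,2)[OF Yy]] eq[OF Yy] y Yc by auto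
    moreover have "f ` (Y - {y}) = Z - {f y}" using Y y by (auto simp: inj_on_def)
    ultimately show False using Z Y y by (auto simp: weak_basis_mod_def)
  qed
  hence "weak_basis_mod K Y"
    using Z Y Yc eq[OF Yc] by (auto simp: weak_basis_mod_def)
  thus "\<exists>Y \<subseteq> X. weak_basis_mod K Y" using Y by blast
qed

text \<open>
  A weak basis chosen from \<open>X \<union> F\<close> contains a finite part \<open>E\<close> that already generates \<open>F\<close>. Every element
  outside \<open>E\<close> therefore stays irredundant when \<open>F\<close> is added, and only the finite set \<open>E\<close> has to
  be thinned out.
\<close>
lemma rwb_mod_finite:
  assumes rwb: "rwb_mod K" and K: "submod K" and F: "finite F" "F \<subseteq> carrier M"
  shows "rwb_mod (span (K \<union> F))"
  unfolding rwb_mod_def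
proof (intro allI impI)
  have Kc: "K \<subseteq> carrier M" using K submoduleE(1) by auto
  fix X assume X: "X \<subseteq> carrier M" "span (span (K \<union> F) \<union> X) = carrier M"
  have sp: "span (span (K \<union> F) \<union> A) = span (K \<union> F \<union> A)" if "A \<subseteq> carrier M" for A
    using that Kc F by (intro span_Un_span) auto
  have "span (K \<union> (F \<union> X)) = carrier M" using sp[OF X(1)] X(2) by (simp add: Un_assoc)
  then obtain Y where Y: "Y \<subseteq> F \<union> X" "weak_basis_mod K Y"
    using rwb X F unfolding rwb_mod_def by (metis Un_least)
  hence Yc: "Y \<subseteq> carrier M" "span (K \<union> Y) = carrier M"
    and Yi: "\<And>y. y \<in> Y \<Longrightarrow> y \<notin> span (K \<union> (Y - {y}))" by (auto simp: weak_basis_mod_def)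
  have "\<exists>E. finite E \<and> E \<subseteq> Y \<and> F \<subseteq> span (K \<union> E)"
    using F
  proof (induction F rule: finite_induct)
    case empty
    thus ?case by blast
  next
    case (insert x F)
    then obtain E where E: "finite E" "E \<subseteq> Y" "F \<subseteq> span (K \<union> E)" by auto
    have "K \<union> Y \<subseteq> carrier M" "x \<in> span (K \<union> Y)" using Kc Yc insert.prems by auto
    then obtain D where D: "finite D" "D \<subseteq> K \<union> Y" "x \<in> span D" by (rule span_finitary)
    have "D \<subseteq> K \<union> (E \<union> D \<inter> Y)" using D by auto
    hence "x \<in> span (K \<union> (E \<union> D \<inter> Y))" using D(3) span_mono by blast
    moreover have "F \<subseteq> span (K \<union> (E \<union> D \<inter> Y))"
      using E(3) span_mono[of "K \<union> E" "K \<union> (E \<union> D \<inter> Y)"] by auto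
    ultimately show ?case using E D by (intro exI[of _ "E \<union> D \<inter> Y"]) auto
  qed
  then obtain E where E: "finite E" "E \<subseteq> Y" "F \<subseteq> span (K \<union> E)" by blast
  define P where "P = (\<lambda>D. span (K \<union> F \<union> ((Y - F - E) \<union> D)) = carrier M)"
  have "Y - F - E \<union> (E - F) = Y - F" using E by auto
  moreover have "span (K \<union> F \<union> (Y - F)) = carrier M"
  proof -
    have "K \<union> Y \<subseteq> K \<union> F \<union> (Y - F)" by auto
    thus ?thesis using Yc span_mono[of "K \<union> Y" "K \<union> F \<union> (Y - F)"] span_carrier[of "K \<union> F \<union> (Y - F)"] Kc F
      by auto
  qed
  ultimately have "P (E - F)" unfolding P_def by metis
  then obtain D where D: "D \<subseteq> E - F" "P D" and Dm: "\<And>D'. D' \<subset> D \<Longrightarrow> \<not> P D'"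
  proof -
    let ?S = "{D. D \<subseteq> E - F \<and> P D}"
    have "finite ?S" using E(1) by (intro finite_subset[of ?S "Pow (E - F)"]) auto
    moreover have "?S \<noteq> {}" using \<open>P (E - F)\<close> by auto
    ultimately obtain D where "D \<in> ?S" "\<And>D'. D' \<in> ?S \<Longrightarrow> D' \<subseteq> D \<Longrightarrow> D = D'"
      using finite_has_minimal[of ?S] by auto
    thus ?thesis using that[of D] by blast
  qed
  let ?Z = "(Y - F - E) \<union> D"
  have "D \<subseteq> Y - F" using D E by auto
  hence Zc: "?Z \<subseteq> carrier M" "?Z \<subseteq> X" using Yc Y(1) by auto
  have "z \<notin> span (span (K \<union> F) \<union> (?Z - {z}))" if z: "z \<in> ?Z" for z
  proof
    have Zz: "?Z - {z} \<subseteq> carrier M" using Zc by auto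
    assume "z \<in> span (span (K \<union> F) \<union> (?Z - {z}))"
    hence zs: "z \<in> span (K \<union> F \<union> (?Z - {z}))" using sp[OF Zz] by simp
    show False
    proof (cases "z \<in> D")
      case True
      have zD: "Y - F - E \<union> (D - {z}) = ?Z - {z}" using True D by auto
      have "K \<union> F \<union> ?Z \<subseteq> span (K \<union> F \<union> (?Z - {z}))"
        using zs span_base[of _ "K \<union> F \<union> (?Z - {z})"] by blast
      hence "span (K \<union> F \<union> ?Z) \<subseteq> span (K \<union> F \<union> (?Z - {z}))"
        using Kc F Zc by (intro span_least_span) auto
      hence "P (D - {z})"
        using D(2) span_carrier[of "K \<union> F \<union> (?Z - {z})"] Kc F Zz unfolding P_def zD by auto
      moreover have "D - {z} \<subset> D" using True by auto
      ultimately show False using Dm by blast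
    next
      case False
      hence zY: "z \<in> Y" "z \<notin> E" using z by auto
      have Yz: "K \<union> (Y - {z}) \<subseteq> carrier M" using Kc Yc by auto
      have "F \<subseteq> span (K \<union> (Y - {z}))"
        using E zY span_mono[of "K \<union> E" "K \<union> (Y - {z})"] by auto
      moreover have "K \<union> (?Z - {z}) \<subseteq> K \<union> (Y - {z})" using D E by auto
      ultimately have "K \<union> F \<union> (?Z - {z}) \<subseteq> span (K \<union> (Y - {z}))"
        using span_superset[of "K \<union> (Y - {z})"] by auto
      thus False using zs span_least_span[OF _ Yz] Yi zY by blast
    qed
  qed
  moreover have "span (span (K \<union> F) \<union> ?Z) = carrier M"
    using D(2) sp[OF Zc(1)] unfolding P_def by simp
  ultimately have "weak_basis_mod (span (K \<union> F)) ?Z"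
    using Zc by (simp add: weak_basis_mod_def)
  thus "\<exists>Y \<subseteq> X. weak_basis_mod (span (K \<union> F)) Y" using Zc by blast
qed

text \<open>
  Lift the given generators of the quotient to \<open>L\<close>. A weak basis chosen from \<open>B\<close> and these lifts contains
  all of \<open>B\<close>, because \<open>L\<close> does not help to generate an element of \<open>B\<close>; the remaining elements are then
  irredundant modulo \<open>B\<close>.
\<close>
lemma rwb_mod_irredundant:
  assumes rwb: "rwb_mod K" and K: "submod K" and L: "submod L" "K \<subseteq> L"
    and B: "B \<subseteq> carrier M" "span (L \<union> B) = carrier M"
    and irr: "\<And>b. b \<in> B \<Longrightarrow> b \<notin> span (L \<union> (B - {b}))"
  shows "rwb_mod (span (K \<union> B))"
proof (rule rwb_mod_lifts[OF _ L(1)])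
  have Kc: "K \<subseteq> carrier M" and Lc: "L \<subseteq> carrier M" using K L submoduleE(1) by auto
  show "submod (span (K \<union> B))" using Kc B by (intro submod_span) auto
  fix x assume x: "x \<in> carrier M"
  obtain l b where lb: "l \<in> span L" "b \<in> span B" "x = l \<boxplus> b"
    using span_Un_decompose[OF Lc B(1)] x B(2) by metis
  have c: "l \<in> carrier M" "b \<in> carrier M" using lb span_carrier Lc B by auto
  have "x \<boxminus> l = b" using lb c add_diff[of b l] by (simp add: M.a_comm)
  thus "\<exists>l \<in> L. x \<boxminus> l \<in> span (K \<union> B)"
    using lb span_submod[OF L(1)] span_mono[of B "K \<union> B"] by (intro bexI[of _ l]) auto
next
  fix X assume X: "X \<subseteq> L" "span (span (K \<union> B) \<union> X) = carrier M"
  have Kc: "K \<subseteq> carrier M" and Lc: "L \<subseteq> carrier M" using K L submoduleE(1) by auto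
  have sp: "span (span (K \<union> B) \<union> A) = span (K \<union> (B \<union> A))" if "A \<subseteq> carrier M" for A
    using that Kc B span_Un_span[of "K \<union> B" A] by (simp add: Un_assoc)
  have Xc: "X \<subseteq> carrier M" using X Lc by auto
  have "span (K \<union> (B \<union> X)) = carrier M" using sp[OF Xc] X(2) by simp
  then obtain Y where Y: "Y \<subseteq> B \<union> X" "weak_basis_mod K Y"
    using rwb Xc B unfolding rwb_mod_def by (metis Un_least)
  hence Yc: "Y \<subseteq> carrier M" "span (K \<union> Y) = carrier M"
    and Yi: "\<And>y. y \<in> Y \<Longrightarrow> y \<notin> span (K \<union> (Y - {y}))" by (auto simp: weak_basis_mod_def)
  have BY: "B \<subseteq> Y"
  proof
    fix b assume b: "b \<in> B"
    show "b \<in> Y"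
    proof (rule ccontr)
      assume "b \<notin> Y"
      hence "K \<union> Y \<subseteq> L \<union> (B - {b})" using Y(1) X L by auto
      thus False using span_mono Yc(2) irr[OF b] b B by blast
    qed
  qed
  have ZX: "Y - B \<subseteq> X" using Y by auto
  have Zc: "Y - B \<subseteq> carrier M" using Yc by auto
  have "weak_basis_mod (span (K \<union> B)) (Y - B)"
    unfolding weak_basis_mod_def
  proof (intro conjI ballI Zc)
    have "B \<union> (Y - B) = Y" using BY by auto
    thus "span (span (K \<union> B) \<union> (Y - B)) = carrier M" using sp[OF Zc] Yc by simp
    fix y assume y: "y \<in> Y - B"
    have "B \<union> (Y - B - {y}) = Y - {y}" using BY y by auto
    moreover have "Y - B - {y} \<subseteq> carrier M" using Yc by auto
    ultimately show "y \<notin> span (span (K \<union> B) \<union> (Y - B - {y}))" using sp Yi[of y] y by auto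
  qed
  thus "\<exists>Z \<subseteq> X. weak_basis_mod (span (K \<union> B)) Z" using ZX by blast
qed

text \<open>
  \<open>M / Q\<close> is a direct summand of \<open>M / K\<close>. Lift its generators to the complement \<open>P\<close> and add all of \<open>Q\<close>; in a
  weak basis chosen from these, the elements outside \<open>Q\<close> are irredundant modulo \<open>Q\<close>, since a relation
  modulo \<open>Q\<close> between elements of \<open>P\<close> is a relation modulo \<open>K\<close>.
\<close>
lemma rwb_mod_complement:
  assumes rwb: "rwb_mod K" and K: "submod K" and P: "submod P" "K \<subseteq> P" and Q: "submod Q" "K \<subseteq> Q"
    and PQ: "P \<inter> Q \<subseteq> K" and sum: "\<And>x. x \<in> carrier M \<Longrightarrow> \<exists>y \<in> P. x \<boxminus> y \<in> Q"
  shows "rwb_mod Q"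
proof (rule rwb_mod_lifts[OF Q(1) P(1) sum])
  have Kc: "K \<subseteq> carrier M" and Pc: "P \<subseteq> carrier M" and Qc: "Q \<subseteq> carrier M"
    using K P Q submoduleE(1) by auto
  fix X assume X: "X \<subseteq> P" "span (Q \<union> X) = carrier M"
  have KQ: "K \<union> (Q \<union> X) = Q \<union> X" using Q by auto
  hence "span (K \<union> (Q \<union> X)) = carrier M" "Q \<union> X \<subseteq> carrier M" using X Qc Pc by auto
  then obtain Y where Y: "Y \<subseteq> Q \<union> X" "weak_basis_mod K Y"
    using rwb unfolding rwb_mod_def by metis
  hence Yc: "Y \<subseteq> carrier M" "span (K \<union> Y) = carrier M"
    and Yi: "\<And>y. y \<in> Y \<Longrightarrow> y \<notin> span (K \<union> (Y - {y}))" by (auto simp: weak_basis_mod_def)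
  have "weak_basis_mod Q (Y - Q)"
    unfolding weak_basis_mod_def
  proof (intro conjI ballI)
    show "Y - Q \<subseteq> carrier M" using Yc by auto
    have "K \<union> Y \<subseteq> Q \<union> (Y - Q)" using Q by auto
    thus "span (Q \<union> (Y - Q)) = carrier M"
      using span_mono[of "K \<union> Y" "Q \<union> (Y - Q)"] Yc span_carrier[of "Q \<union> (Y - Q)"] Qc by auto
    fix y assume y: "y \<in> Y - Q"
    have A: "Y - Q - {y} \<subseteq> P" "Y - Q - {y} \<subseteq> carrier M" using Y(1) X Pc by auto
    show "y \<notin> span (Q \<union> (Y - Q - {y}))"
    proof
      assume "y \<in> span (Q \<union> (Y - Q - {y}))"
      then obtain q v where qv: "q \<in> span Q" "v \<in> span (Y - Q - {y})" "y = q \<boxplus> v"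
        by (rule span_Un_decompose[OF Qc A(2)])
      have q: "q \<in> Q" using qv span_submod[OF Q(1)] by simp
      have v: "v \<in> P" using qv(2) span_least[OF P(1) A(1)] by auto
      have yP: "y \<in> P" using y Y X by auto
      have "q \<in> carrier M" "v \<in> carrier M" using q v Qc Pc by auto
      hence "q = y \<boxminus> v" using qv(3) add_diff by simp
      hence "q \<in> P" using submod_diff[OF P(1) yP v] by simp
      hence qK: "q \<in> K" using q PQ by auto
      have "submod (span (K \<union> (Y - {y})))" using Kc Yc by (intro submod_span) auto
      moreover have "q \<in> span (K \<union> (Y - {y}))" using qK by (simp add: span_base)
      moreover have "v \<in> span (K \<union> (Y - {y}))"
        using qv(2) span_mono[of "Y - Q - {y}" "K \<union> (Y - {y})"] by auto
      ultimately have "y \<in> span (K \<union> (Y - {y}))" using qv(3) submoduleE(5) by simp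
      thus False using Yi y by simp
    qed
  qed
  moreover have "Y - Q \<subseteq> X" using Y by auto
  ultimately show "\<exists>Z \<subseteq> X. weak_basis_mod Q Z" by blast
qed

lemma submod_diff_trans:
  assumes "submod N" "a \<in> carrier M" "b \<in> carrier M" "c \<in> carrier M" "a \<boxminus> b \<in> N" "b \<boxminus> c \<in> N"
  shows "a \<boxminus> c \<in> N"
proof -
  have "a \<boxminus> c = (a \<boxminus> b) \<boxplus> (b \<boxminus> c)"
    using assms(2-4) by (simp add: M.minus_eq M.a_assoc[symmetric]) (simp add: M.a_assoc M.l_neg)
  thus ?thesis using assms submoduleE(5) by metis
qed

lemma diff_diff:
  "x \<in> carrier M \<Longrightarrow> a \<in> carrier M \<Longrightarrow> b \<in> carrier M \<Longrightarrow> (x \<boxminus> a) \<boxminus> b = x \<boxminus> (a \<boxplus> b)"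
  by (simp add: M.minus_eq M.minus_add M.a_assoc)

lemma submod_diff_swap:
  assumes "submod N" "x \<in> carrier M" "y \<in> carrier M" "x \<boxminus> y \<in> N"
  shows "y \<boxminus> x \<in> N"
proof -
  have "\<ominus>\<^bsub>M\<^esub> (x \<boxminus> y) = y \<boxminus> x"
    using assms by (simp add: M.minus_eq M.minus_add M.a_comm)
  thus ?thesis using submoduleE(3) assms(1,4) by metis
qed

lemma submod_smult_image:
  assumes a: "a \<in> carrier R"
  shows "submod {a \<cdot> y | y. y \<in> carrier M}"
proof (rule submodI)
  show "{a \<cdot> y | y. y \<in> carrier M} \<subseteq> carrier M" using a by auto
  show "\<zero>\<^bsub>M\<^esub> \<in> {a \<cdot> y | y. y \<in> carrier M}" using a by (intro CollectI exI[of _ "\<zero>\<^bsub>M\<^esub>"]) auto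
next
  fix x x' assume "x \<in> {a \<cdot> y | y. y \<in> carrier M}" "x' \<in> {a \<cdot> y | y. y \<in> carrier M}"
  then obtain y y' where "y \<in> carrier M" "x = a \<cdot> y" "y' \<in> carrier M" "x' = a \<cdot> y'" by auto
  thus "x \<boxplus> x' \<in> {a \<cdot> y | y. y \<in> carrier M}"
    using a by (intro CollectI exI[of _ "y \<boxplus> y'"]) (simp add: smult_r_distr)
next
  fix r x assume "r \<in> carrier R" "x \<in> {a \<cdot> y | y. y \<in> carrier M}"
  then obtain y where "r \<in> carrier R" "y \<in> carrier M" "x = a \<cdot> y" by auto
  thus "r \<cdot> x \<in> {a \<cdot> y | y. y \<in> carrier M}"
    using a smult_commute[of r a y] by (intro CollectI exI[of _ "r \<cdot> y"]) simp
qed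

lemma rwb_modE:
  assumes "rwb_mod K" "X \<subseteq> carrier M" "span (K \<union> X) = carrier M"
  obtains Y where "Y \<subseteq> X" "Y \<subseteq> carrier M" "span (K \<union> Y) = carrier M" "\<forall>y \<in> Y. y \<notin> span (K \<union> (Y - {y}))"
proof -
  obtain Y where "Y \<subseteq> X" "weak_basis_mod K Y"
    using assms(1)[unfolded rwb_mod_def, THEN spec, THEN mp, OF assms(2), THEN mp, OF assms(3)] by (elim exE conjE)
  thus ?thesis by (intro that[of Y]) (simp_all add: weak_basis_mod_def)
qed

lemma rwb_mod_carrierE:
  assumes "rwb_mod K" "submod K"
  obtains Y where "Y \<subseteq> carrier M" "span (K \<union> Y) = carrier M" "\<forall>y \<in> Y. y \<notin> span (K \<union> (Y - {y}))"
proof -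
  have "K \<union> carrier M = carrier M" using submoduleE(1)[OF assms(2)] by auto
  hence "span (K \<union> carrier M) = carrier M" using span_submod[OF carrier_is_submodule] by simp
  thus ?thesis using rwb_modE[OF assms(1) subset_refl] that by metis
qed

lemma span_Un_finitary:
  assumes "A \<subseteq> carrier M" "B \<subseteq> carrier M" "x \<in> span (A \<union> B)"
  shows "\<exists>F. finite F \<and> F \<subseteq> B \<and> x \<in> span (A \<union> F)"
proof -
  have "A \<union> B \<subseteq> carrier M" using assms by auto
  then obtain D where D: "finite D" "D \<subseteq> A \<union> B" "x \<in> span D" using assms(3) by (rule span_finitary)
  have "D \<subseteq> A \<union> D \<inter> B" using D by auto
  hence "x \<in> span (A \<union> D \<inter> B)" using D(3) span_mono by blast
  thus ?thesis using D by (intro exI[of _ "D \<inter> B"]) auto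
qed

end


section \<open>Localising a Dedekind domain at a maximal ideal\<close>

lemma (in cring) idealI_comm:
  assumes "I \<subseteq> carrier R" "\<zero> \<in> I" "\<And>a b. a \<in> I \<Longrightarrow> b \<in> I \<Longrightarrow> a \<oplus> b \<in> I"
    and mult: "\<And>r a. r \<in> carrier R \<Longrightarrow> a \<in> I \<Longrightarrow> r \<otimes> a \<in> I"
  shows "ideal I R"
proof (rule idealI)
  show "ring R" by (rule ring_axioms)
  show "subgroup I (add_monoid R)"
  proof (rule subgroup.intro)
    fix x assume x: "x \<in> I"
    hence "(\<ominus> \<one>) \<otimes> x \<in> I" using mult by simp
    moreover have "(\<ominus> \<one>) \<otimes> x = \<ominus> x" using x assms(1) by (auto simp: l_minus)
    ultimately show "inv\<^bsub>add_monoid R\<^esub> x \<in> I" by (simp add: a_inv_def)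
  qed (use assms in auto)
  fix a x assume "a \<in> I" "x \<in> carrier R"
  thus "x \<otimes> a \<in> I" "a \<otimes> x \<in> I" using mult assms(1) m_comm[of a x] by auto
qed

lemma (in cring) ideal_colon:
  assumes "ideal J R" "a \<in> carrier R"
  shows "ideal {r \<in> carrier R. r \<otimes> a \<in> J} R"
proof -
  interpret J: ideal J R by fact
  show ?thesis
    using assms J.zero_closed J.a_closed J.I_l_closed
    by (intro idealI_comm) (auto simp: l_distr m_assoc)
qed

lemma (in noetherian_ring) ideal_family_has_maximal:
  assumes "P i0" and id: "\<And>i. P i \<Longrightarrow> ideal (I i) R"
  obtains i where "P i" "\<forall>k. P k \<longrightarrow> I i \<subseteq> I k \<longrightarrow> I k = I i"
proof -
  have "\<exists>J \<in> I ` Collect P. \<forall>K \<in> I ` Collect P. J \<subseteq> K \<longrightarrow> K = J"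
  proof (rule subset_Zorn_nonempty)
    show "I ` Collect P \<noteq> {}" using assms(1) by auto
    fix C assume C: "C \<noteq> {}" "subset.chain (I ` Collect P) C"
    hence "subset.chain {I. ideal I R} C" using id by (auto simp: pred_on.chain_def)
    hence "\<Union>C \<in> C" by (rule ideal_chain_is_trivial[OF C(1)])
    thus "\<Union>C \<in> I ` Collect P" using C by (auto simp: pred_on.chain_def)
  qed
  then obtain i where "P i" "\<forall>K \<in> I ` Collect P. I i \<subseteq> K \<longrightarrow> K = I i" by auto
  thus ?thesis using that[of i] by simp
qed

lemma (in noetherian_ring) ascending_ideals_stabilize:
  assumes "\<And>n::nat. ideal (J n) R" "\<And>n. J n \<subseteq> J (Suc n)"
  obtains N where "\<And>n. J n \<subseteq> J N"
proof -
  have "J n \<subseteq> J m \<or> J m \<subseteq> J n" for n m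
    using lift_Suc_mono_le[of J, OF assms(2)] by (meson linear)
  hence "subset.chain {I. ideal I R} (range J)"
    using assms(1) by (auto simp: pred_on.chain_def)
  hence "\<Union>(range J) \<in> range J" by (intro ideal_chain_is_trivial) auto
  thus ?thesis using that by blast
qed

text \<open>
  Here \<open>x n = (j / c)\<^sup>n x 0\<close>. The ideals generated by \<open>x 0, \<dots>, x (n - 1)\<close> become stationary, and an
  expression of some \<open>x N\<close> by its predecessors is, after division by \<open>x 0\<close>, a monic equation for \<open>j / c\<close>.
\<close>
lemma (in noetherian_domain) integral_fraction_if_bounded_powers:
  assumes j: "j \<in> carrier R" and c: "c \<in> carrier R" "c \<noteq> \<zero>"
    and x: "\<And>n::nat. x n \<in> carrier R" "x 0 \<noteq> \<zero>" "\<And>n. c \<otimes> x (Suc n) = j \<otimes> x n"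
  shows "integral_fraction R j c"
proof -
  let ?J = "\<lambda>n. {\<Oplus>i\<in>{..<n}. r i \<otimes> x i | r. r \<in> {..<n} \<rightarrow> carrier R}"
  have cl: "(\<lambda>i. r i \<otimes> x i) \<in> {..<n} \<rightarrow> carrier R" if "r \<in> {..<n} \<rightarrow> carrier R" for r n
    using that x(1) by auto
  have id: "ideal (?J n) R" for n
  proof (rule idealI_comm)
    show "?J n \<subseteq> carrier R" using cl by (auto intro!: finsum_closed)
    have "(\<Oplus>i\<in>{..<n}. \<zero> \<otimes> x i) = \<zero>" using x(1) by simp
    thus "\<zero> \<in> ?J n" by (intro CollectI exI[of _ "\<lambda>i. \<zero>"]) auto
  next
    fix a b assume "a \<in> ?J n" "b \<in> ?J n"
    then obtain r s where r: "r \<in> {..<n} \<rightarrow> carrier R" "a = (\<Oplus>i\<in>{..<n}. r i \<otimes> x i)"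
      and s: "s \<in> {..<n} \<rightarrow> carrier R" "b = (\<Oplus>i\<in>{..<n}. s i \<otimes> x i)" by blast
    have "(\<Oplus>i\<in>{..<n}. (r i \<oplus> s i) \<otimes> x i) = (\<Oplus>i\<in>{..<n}. r i \<otimes> x i \<oplus> s i \<otimes> x i)"
      using r s x(1) by (intro finsum_cong') (auto intro!: l_distr simp: Pi_iff)
    also have "\<dots> = a \<oplus> b" using cl[OF r(1)] cl[OF s(1)] r s by (simp add: finsum_addf)
    finally show "a \<oplus> b \<in> ?J n" using r s by (intro CollectI exI[of _ "\<lambda>i. r i \<oplus> s i"]) auto
  next
    fix t a assume t: "t \<in> carrier R" and "a \<in> ?J n"
    then obtain r where r: "r \<in> {..<n} \<rightarrow> carrier R" "a = (\<Oplus>i\<in>{..<n}. r i \<otimes> x i)" by blast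
    have "t \<otimes> a = (\<Oplus>i\<in>{..<n}. t \<otimes> (r i \<otimes> x i))"
      using t r cl[OF r(1)] by (simp add: finsum_rdistr)
    also have "\<dots> = (\<Oplus>i\<in>{..<n}. (t \<otimes> r i) \<otimes> x i)"
      using t r x(1) by (intro finsum_cong') (auto simp: m_assoc Pi_iff)
    finally show "t \<otimes> a \<in> ?J n" using r t by (intro CollectI exI[of _ "\<lambda>i. t \<otimes> r i"]) auto
  qed
  have "?J n \<subseteq> ?J (Suc n)" for n
  proof
    fix a assume "a \<in> ?J n"
    then obtain r where r: "r \<in> {..<n} \<rightarrow> carrier R" "a = (\<Oplus>i\<in>{..<n}. r i \<otimes> x i)" by blast
    let ?r = "r(n := \<zero>)"
    have "(\<Oplus>i\<in>{..<Suc n}. ?r i \<otimes> x i) = ?r n \<otimes> x n \<oplus> (\<Oplus>i\<in>{..<n}. ?r i \<otimes> x i)"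
      unfolding lessThan_Suc using r x(1) by (subst finsum_insert) (auto simp: Pi_iff)
    also have "(\<Oplus>i\<in>{..<n}. ?r i \<otimes> x i) = a"
      unfolding r(2) using cl[OF r(1)] by (intro finsum_cong') auto
    finally have "a = (\<Oplus>i\<in>{..<Suc n}. ?r i \<otimes> x i)"
      using x(1) r cl[OF r(1)] by (simp add: finsum_closed)
    moreover have "?r \<in> {..<Suc n} \<rightarrow> carrier R" using r by (auto simp: less_Suc_eq)
    ultimately show "a \<in> ?J (Suc n)" by blast
  qed
  then obtain N where N: "\<And>n. ?J n \<subseteq> ?J N"
    using ascending_ideals_stabilize[of ?J] id by blast
  let ?d = "\<lambda>i. if i = N then \<one> else \<zero>"
  have "(\<Oplus>i\<in>{..<Suc N}. ?d i \<otimes> x i) = ?d N \<otimes> x N \<oplus> (\<Oplus>i\<in>{..<N}. ?d i \<otimes> x i)"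
    unfolding lessThan_Suc using x(1) by (subst finsum_insert) auto
  also have "(\<Oplus>i\<in>{..<N}. ?d i \<otimes> x i) = (\<Oplus>i\<in>{..<N}. \<zero>)"
    using x(1) by (intro finsum_cong') auto
  finally have "x N = (\<Oplus>i\<in>{..<Suc N}. ?d i \<otimes> x i)" using x(1) by simp
  moreover have "?d \<in> {..<Suc N} \<rightarrow> carrier R" by auto
  ultimately have "x N \<in> ?J (Suc N)" by (intro CollectI exI[of _ ?d] conjI)
  then obtain r where r: "r \<in> {..<N} \<rightarrow> carrier R" "x N = (\<Oplus>i\<in>{..<N}. r i \<otimes> x i)"
    using N[of "Suc N"] by auto
  have pow: "c [^] n \<otimes> x n = j [^] n \<otimes> x 0" for n :: nat
  proof (induction n)
    case (Suc n)
    have "c [^] Suc n \<otimes> x (Suc n) = c [^] n \<otimes> (c \<otimes> x (Suc n))" using c x(1) by (simp add: m_assoc)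
    also have "\<dots> = j \<otimes> (c [^] n \<otimes> x n)" using x c j by (simp add: m_ac)
    finally show ?case using Suc j x(1) by (simp add: m_ac)
  qed (use x in simp)
  let ?t = "\<lambda>i. j [^] i \<otimes> c [^] (N - i)"
  have tc: "?t i \<in> carrier R" for i using j c by simp
  have rt: "(\<lambda>i. r i \<otimes> ?t i) \<in> {..<N} \<rightarrow> carrier R" using r tc by auto
  have "j [^] N \<otimes> x 0 = c [^] N \<otimes> (\<Oplus>i\<in>{..<N}. r i \<otimes> x i)" using pow[of N] r by simp
  also have "\<dots> = (\<Oplus>i\<in>{..<N}. c [^] N \<otimes> (r i \<otimes> x i))"
    using c cl[OF r(1)] by (simp add: finsum_rdistr)
  also have "\<dots> = (\<Oplus>i\<in>{..<N}. (r i \<otimes> ?t i) \<otimes> x 0)"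
  proof (rule finsum_cong')
    show "(\<lambda>i. (r i \<otimes> ?t i) \<otimes> x 0) \<in> {..<N} \<rightarrow> carrier R" using rt x(1) by auto
    fix i assume i: "i \<in> {..<N}"
    hence ri: "r i \<in> carrier R" using r by auto
    have "c [^] N = c [^] (N - i) \<otimes> c [^] i" using i c by (simp add: nat_pow_mult)
    hence "c [^] N \<otimes> (r i \<otimes> x i) = r i \<otimes> (c [^] (N - i) \<otimes> (c [^] i \<otimes> x i))"
      using ri c x(1) by (simp add: m_ac)
    also have "\<dots> = r i \<otimes> (c [^] (N - i) \<otimes> (j [^] i \<otimes> x 0))" using pow by simp
    also have "\<dots> = (r i \<otimes> ?t i) \<otimes> x 0" using ri c j x(1) by (simp add: m_ac)
    finally show "c [^] N \<otimes> (r i \<otimes> x i) = (r i \<otimes> ?t i) \<otimes> x 0" .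
  qed simp
  also have "\<dots> = (\<Oplus>i\<in>{..<N}. r i \<otimes> ?t i) \<otimes> x 0"
    using rt x(1) by (simp add: finsum_ldistr)
  finally have jN: "j [^] N = (\<Oplus>i\<in>{..<N}. r i \<otimes> ?t i)"
    using m_rcancel[OF x(2) x(1)] j finsum_closed[OF rt] by simp
  have mt: "(\<lambda>i. \<ominus> r i \<otimes> ?t i) \<in> {..<N} \<rightarrow> carrier R" using r tc by auto
  have "(\<Oplus>i\<in>{..<N}. r i \<otimes> ?t i) \<oplus> (\<Oplus>i\<in>{..<N}. \<ominus> r i \<otimes> ?t i)
      = (\<Oplus>i\<in>{..<N}. r i \<otimes> ?t i \<oplus> \<ominus> r i \<otimes> ?t i)"
    by (rule finsum_addf[OF rt mt, symmetric])
  also have "\<dots> = (\<Oplus>i\<in>{..<N}. \<zero>)"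
  proof (rule finsum_cong')
    fix i assume "i \<in> {..<N}"
    hence "r i \<in> carrier R" using r by auto
    thus "r i \<otimes> ?t i \<oplus> \<ominus> r i \<otimes> ?t i = \<zero>" using tc[of i] l_minus r_neg by (metis m_closed)
  qed auto
  finally have "j [^] N \<oplus> (\<Oplus>i\<in>{..<N}. \<ominus> r i \<otimes> ?t i) = \<zero>" using jN by simp
  moreover have "(\<lambda>i. \<ominus> r i) \<in> {..<N} \<rightarrow> carrier R" using r by auto
  ultimately show ?thesis unfolding integral_fraction_def by (intro exI[of _ N] exI[of _ "\<lambda>i. \<ominus> r i"]) simp
qed

locale dedekind_ring = noetherian_domain R for R (structure) +
  assumes integrally_closed: "integrally_closed R"
    and prime_maximal: "primeideal I R \<Longrightarrow> I \<noteq> {\<zero>} \<Longrightarrow> maximalideal I R"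
    and not_field: "\<not> field R"
begin

lemma maximal_ideal: "maximalideal p R \<Longrightarrow> ideal p R"
  by (rule maximalideal.axioms(1))

lemma maximal_carrier: "maximalideal p R \<Longrightarrow> a \<in> p \<Longrightarrow> a \<in> carrier R"
  using maximal_ideal ideal.Icarr by metis

lemma maximal_mult_notin:
  assumes "maximalideal p R" "s \<in> carrier R - p" "t \<in> carrier R - p"
  shows "s \<otimes> t \<in> carrier R - p"
  using assms primeideal.I_prime[OF maximalideal_prime[OF assms(1)]] by auto

lemma maximal_mult_in:
  assumes "maximalideal p R" "a \<in> p" "r \<in> carrier R"
  shows "r \<otimes> a \<in> p" "a \<otimes> r \<in> p"
  using assms ideal.I_l_closed ideal.I_r_closed maximal_ideal by metis+

lemma maximal_one_notin: "maximalideal p R \<Longrightarrow> \<one> \<notin> p"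
  using maximalideal.I_notcarr maximal_ideal ideal.one_imp_carrier by metis

lemma maximal_inverse:
  assumes p: "maximalideal p R" and s: "s \<in> carrier R - p"
  obtains r where "r \<in> carrier R" "\<one> \<ominus> r \<otimes> s \<in> p"
proof -
  interpret p: maximalideal p R by fact
  let ?J = "{a \<oplus> r \<otimes> s | a r. a \<in> p \<and> r \<in> carrier R}"
  have sc: "s \<in> carrier R" using s by simp
  have idJ: "ideal ?J R"
  proof (rule idealI_comm)
    show "?J \<subseteq> carrier R" using sc p.Icarr by auto
    show "\<zero> \<in> ?J" using sc p.zero_closed by (intro CollectI exI[of _ \<zero>]) auto
  next
    fix a b assume "a \<in> ?J" "b \<in> ?J"
    then obtain x y r t where "x \<in> p" "r \<in> carrier R" "a = x \<oplus> r \<otimes> s" "y \<in> p" "t \<in> carrier R" "b = y \<oplus> t \<otimes> s"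
      by blast
    moreover from this have "a \<oplus> b = (x \<oplus> y) \<oplus> (r \<oplus> t) \<otimes> s"
      using sc p.Icarr[of x] p.Icarr[of y] by (simp add: l_distr a_ac)
    ultimately show "a \<oplus> b \<in> ?J" using p.a_closed[of x y] by blast
  next
    fix t a assume "t \<in> carrier R" "a \<in> ?J"
    then obtain x r where "t \<in> carrier R" "x \<in> p" "r \<in> carrier R" "a = x \<oplus> r \<otimes> s" by blast
    moreover from this have "t \<otimes> a = t \<otimes> x \<oplus> (t \<otimes> r) \<otimes> s"
      using sc p.Icarr[of x] by (simp add: r_distr m_assoc)
    ultimately show "t \<otimes> a \<in> ?J" using p.I_l_closed[of x t] by blast
  qed
  have pJ: "p \<subseteq> ?J"
  proof
    fix a assume "a \<in> p"
    thus "a \<in> ?J" using sc p.Icarr by (intro CollectI exI[of _ a] exI[of _ \<zero>]) auto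
  qed
  have sJ: "s \<in> ?J" using sc p.zero_closed by (intro CollectI exI[of _ \<zero>] exI[of _ \<one>]) auto
  have "?J \<subseteq> carrier R" using sc p.Icarr by auto
  hence J: "?J = p \<or> ?J = carrier R" by (rule p.I_maximal[OF idJ pJ])
  have "K = p \<or> K = carrier R \<Longrightarrow> s \<in> K \<Longrightarrow> \<one> \<in> K" for K using s by auto
  from this[OF J sJ] have "\<one> \<in> ?J" .
  then obtain a r where ar: "a \<in> p" "r \<in> carrier R" "\<one> = a \<oplus> r \<otimes> s"
    by (elim CollectE exE conjE) (rule that)
  have "a \<oplus> r \<otimes> s \<ominus> r \<otimes> s = a"
    using ar(1,2) sc p.Icarr[of a] by (simp add: minus_eq a_assoc r_neg)
  hence "\<one> \<ominus> r \<otimes> s = a" using ar(3) by metis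
  thus ?thesis using that ar by simp
qed

lemma maximal_nonzero:
  assumes "maximalideal p R"
  obtains c where "c \<in> p" "c \<noteq> \<zero>"
  using assms zeromaximalideal_fieldI not_field maximal_ideal additive_subgroup.zero_closed ideal.axioms(1)
  by (metis empty_iff subsetI subset_singletonD singletonI insert_iff)

lemma proper_ideal_below_maximal:
  assumes "ideal I R" "\<one> \<notin> I"
  obtains p where "maximalideal p R" "I \<subseteq> p"
proof -
  let ?P = "\<lambda>J. ideal J R \<and> I \<subseteq> J \<and> \<one> \<notin> J"
  have "?P I" using assms by simp
  then obtain p where p: "?P p" "\<forall>J. ?P J \<longrightarrow> p \<subseteq> J \<longrightarrow> J = p"
    by (rule ideal_family_has_maximal[of ?P _ "\<lambda>J. J"]) auto
  have "maximalideal p R"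
  proof (rule maximalidealI)
    show "ideal p R" "carrier R \<noteq> p" using p by auto
    fix J assume J: "ideal J R" "p \<subseteq> J" "J \<subseteq> carrier R"
    show "J = p \<or> J = carrier R"
      using p J ideal.one_imp_carrier[OF J(1)] by (cases "\<one> \<in> J") auto
  qed
  thus ?thesis using that p by auto
qed

text \<open>\<open>I\<close> is finitely generated, so the product of the denominators of its generators works for all
  elements.\<close>
lemma uniform_denominator:
  assumes p: "maximalideal p R" and I: "ideal I R" and J: "ideal J R"
    and loc: "\<And>a. a \<in> I \<Longrightarrow> \<exists>s \<in> carrier R - p. s \<otimes> a \<in> J"
  obtains s where "s \<in> carrier R - p" "\<forall>a \<in> I. s \<otimes> a \<in> J"
proof -
  interpret J: ideal J R by fact
  obtain A where A: "A \<subseteq> carrier R" "finite A" "I = Idl A" using finetely_gen[OF I] by auto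
  have AI: "A \<subseteq> I" using genideal_self[OF A(1)] A(3) by simp
  have "\<exists>s \<in> carrier R - p. \<forall>a \<in> A. s \<otimes> a \<in> J"
    using A(2) AI A(1)
  proof (induction A rule: finite_induct)
    case empty
    thus ?case using maximal_one_notin[OF p] by auto
  next
    case (insert a A)
    then obtain s where s: "s \<in> carrier R - p" "\<forall>a \<in> A. s \<otimes> a \<in> J" by auto
    obtain t where t: "t \<in> carrier R - p" "t \<otimes> a \<in> J" using loc insert.prems by blast
    have "s \<otimes> t \<in> carrier R - p" using maximal_mult_notin[OF p] s t by simp
    moreover have "(s \<otimes> t) \<otimes> a \<in> J"
      using J.I_l_closed[OF t(2), of s] s t insert.prems by (simp add: m_assoc)
    moreover have "(s \<otimes> t) \<otimes> b \<in> J" if "b \<in> A" for b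
    proof -
      have "b \<in> carrier R" using that insert.prems by auto
      hence "(s \<otimes> t) \<otimes> b = t \<otimes> (s \<otimes> b)" using s t by (simp add: m_ac)
      thus ?thesis using J.I_l_closed[of "s \<otimes> b" t] s t that by simp
    qed
    ultimately show ?case by auto
  qed
  then obtain s where s: "s \<in> carrier R - p" "\<forall>a \<in> A. s \<otimes> a \<in> J" by blast
  have "ideal {r \<in> carrier R. r \<otimes> s \<in> J} R" using ideal_colon[OF J] s by simp
  moreover have "A \<subseteq> {r \<in> carrier R. r \<otimes> s \<in> J}" using A(1) s m_comm by fastforce
  ultimately have "I \<subseteq> {r \<in> carrier R. r \<otimes> s \<in> J}" using genideal_minimal A(3) by simp
  thus ?thesis using that[OF s(1)] s m_comm by fastforce
qed

text \<open>The contraction to \<open>R\<close> of the ideal that \<open>c\<close> generates in the localisation at \<open>p\<close>.\<close>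
definition local_multiples :: "'a set \<Rightarrow> 'a \<Rightarrow> 'a set" where
  "local_multiples p c = {r \<in> carrier R. \<exists>t \<in> carrier R - p. \<exists>v \<in> carrier R. t \<otimes> r = v \<otimes> c}"

lemma local_multiplesE:
  assumes "r \<in> local_multiples p c"
  obtains t v where "r \<in> carrier R" "t \<in> carrier R" "t \<notin> p" "v \<in> carrier R" "t \<otimes> r = v \<otimes> c"
  using assms by (auto simp: local_multiples_def)

lemma local_multiplesI:
  "r \<in> carrier R \<Longrightarrow> t \<in> carrier R - p \<Longrightarrow> v \<in> carrier R \<Longrightarrow> t \<otimes> r = v \<otimes> c \<Longrightarrow> r \<in> local_multiples p c"
  by (auto simp: local_multiples_def)

lemma local_multiples_ideal:
  assumes p: "maximalideal p R" and c: "c \<in> carrier R"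
  shows "ideal (local_multiples p c) R"
proof (rule idealI_comm)
  show "local_multiples p c \<subseteq> carrier R" by (auto simp: local_multiples_def)
  show "\<zero> \<in> local_multiples p c"
    using maximal_one_notin[OF p] c by (intro local_multiplesI[of _ \<one> _ \<zero>]) auto
next
  fix a b assume "a \<in> local_multiples p c"
  then obtain s u where s: "a \<in> carrier R" "s \<in> carrier R" "s \<notin> p" "u \<in> carrier R" "s \<otimes> a = u \<otimes> c"
    by (rule local_multiplesE)
  assume "b \<in> local_multiples p c"
  then obtain t v where t: "b \<in> carrier R" "t \<in> carrier R" "t \<notin> p" "v \<in> carrier R" "t \<otimes> b = v \<otimes> c"
    by (rule local_multiplesE)
  have "(s \<otimes> t) \<otimes> (a \<oplus> b) = t \<otimes> (s \<otimes> a) \<oplus> s \<otimes> (t \<otimes> b)"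
    using s(1-4) t(1-4) by (simp add: r_distr m_ac)
  also have "\<dots> = (t \<otimes> u \<oplus> s \<otimes> v) \<otimes> c"
    using s t c by (simp add: l_distr m_assoc)
  finally show "a \<oplus> b \<in> local_multiples p c"
    using s t maximal_mult_notin[OF p, of s t]
    by (intro local_multiplesI[of _ "s \<otimes> t" _ "t \<otimes> u \<oplus> s \<otimes> v"]) auto
next
  fix r a assume r: "r \<in> carrier R" and "a \<in> local_multiples p c"
  then obtain s u where s: "a \<in> carrier R" "s \<in> carrier R" "s \<notin> p" "u \<in> carrier R" "s \<otimes> a = u \<otimes> c"
    by (auto elim: local_multiplesE)
  have "s \<otimes> (r \<otimes> a) = r \<otimes> (s \<otimes> a)" using s(1-4) r by (simp add: m_ac)
  also have "\<dots> = (r \<otimes> u) \<otimes> c" using s r c by (simp add: m_assoc)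
  finally show "r \<otimes> a \<in> local_multiples p c"
    using s r by (intro local_multiplesI[of _ s _ "r \<otimes> u"]) auto
qed

lemma local_multiples_saturated:
  assumes p: "maximalideal p R" and c: "c \<in> carrier R"
    and s: "s \<in> carrier R - p" and r: "r \<in> carrier R" and "s \<otimes> r \<in> local_multiples p c"
  shows "r \<in> local_multiples p c"
proof -
  obtain t v where t: "t \<in> carrier R" "t \<notin> p" "v \<in> carrier R" "t \<otimes> (s \<otimes> r) = v \<otimes> c"
    using assms(5) by (rule local_multiplesE)
  have "(t \<otimes> s) \<otimes> r = v \<otimes> c" using t s r by (simp add: m_assoc)
  thus ?thesis using maximal_mult_notin[OF p, of t s] t s r by (intro local_multiplesI[of _ "t \<otimes> s" _ v]) auto
qed

text \<open>
  The maximal ideal \<open>p\<close> is an associated prime of \<open>R / c R\<close> for every nonzero \<open>c \<in> p\<close>, so there is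
  \<open>j\<close> with \<open>(j / c) p \<subseteq> R\<close> and \<open>j / c \<notin> R\<close>; since
  \<open>R\<close> is integrally closed, \<open>(j / c) p\<close> is not contained in \<open>p\<close>, and any \<open>\<pi> \<in> p\<close> with
  \<open>(j / c) \<pi> \<notin> p\<close> is a local generator.
\<close>
lemma uniformizer:
  assumes p: "maximalideal p R"
  obtains \<pi> s where "\<pi> \<in> p" "s \<in> carrier R - p" "\<forall>a \<in> p. \<exists>u \<in> carrier R. s \<otimes> a = u \<otimes> \<pi>"
proof -
  obtain c where c: "c \<in> p" "c \<noteq> \<zero>" using maximal_nonzero[OF p] by auto
  hence cR: "c \<in> carrier R" using maximal_carrier[OF p] by simp
  let ?L = "local_multiples p c"
  interpret L: ideal ?L R by (rule local_multiples_ideal[OF p cR])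
  let ?Q = "\<lambda>j. {r \<in> carrier R. r \<otimes> j \<in> ?L}"
  let ?P = "\<lambda>j. j \<in> carrier R \<and> j \<notin> ?L"
  have "\<one> \<notin> ?L"
  proof
    assume "\<one> \<in> ?L"
    then obtain t v where "t \<in> carrier R" "t \<notin> p" "v \<in> carrier R" "t \<otimes> \<one> = v \<otimes> c"
      by (rule local_multiplesE)
    thus False using maximal_mult_in(1)[OF p c(1), of v] by simp
  qed
  hence one: "?P \<one>" by simp
  have idQ: "ideal (?Q j) R" if "?P j" for j
    using that by (intro ideal_colon[OF L.is_ideal]) simp
  obtain j where Pj: "?P j" and max: "\<forall>k. ?P k \<longrightarrow> ?Q j \<subseteq> ?Q k \<longrightarrow> ?Q k = ?Q j"
    by (rule ideal_family_has_maximal[of ?P, OF one idQ])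
  define Q where "Q = ?Q j"
  have j: "j \<in> carrier R" "j \<notin> ?L" "Q = ?Q j" using Pj Q_def by auto
  have "primeideal Q R"
  proof (rule primeidealI)
    show "ideal Q R" unfolding Q_def by (rule idQ[OF Pj])
    show "cring R" by (rule is_cring)
    have "\<one> \<notin> Q" using j by simp
    thus "carrier R \<noteq> Q" using one_closed by auto
    fix a b assume ab: "a \<in> carrier R" "b \<in> carrier R" "a \<otimes> b \<in> Q"
    show "a \<in> Q \<or> b \<in> Q"
    proof (cases "a \<otimes> j \<in> ?L")
      case True
      thus ?thesis using ab j by simp
    next
      case False
      have "Q \<subseteq> ?Q (a \<otimes> j)"
      proof
        fix r assume "r \<in> Q"
        hence r: "r \<in> carrier R" "r \<otimes> j \<in> ?L" using j by auto
        hence "a \<otimes> (r \<otimes> j) \<in> ?L" using L.I_l_closed ab by simp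
        thus "r \<in> ?Q (a \<otimes> j)" using r ab j by (simp add: m_ac)
      qed
      moreover have "?P (a \<otimes> j)" using False ab j by simp
      ultimately have "?Q (a \<otimes> j) = Q" using max j(3) by simp
      moreover have "b \<in> ?Q (a \<otimes> j)" using ab j by (simp add: m_ac)
      ultimately show ?thesis by simp
    qed
  qed
  moreover have "c \<in> Q"
  proof -
    have "c \<otimes> j \<in> ?L" using cR j maximal_one_notin[OF p] m_comm[of c j]
      by (intro local_multiplesI[of _ \<one> _ j]) auto
    thus ?thesis using cR j by simp
  qed
  ultimately have Qm: "maximalideal Q R" using prime_maximal c by blast
  have Qp: "Q \<subseteq> p"
  proof
    fix s assume "s \<in> Q"
    hence s: "s \<in> carrier R" "s \<otimes> j \<in> ?L" using j by auto
    thus "s \<in> p" using local_multiples_saturated[OF p cR _ j(1), of s] j(2) by auto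
  qed
  have "p = Q \<or> p = carrier R"
    using maximalideal.I_maximal[OF Qm maximal_ideal[OF p] Qp] maximal_carrier[OF p] by blast
  hence pQ: "p = Q" using maximalideal.I_notcarr[OF p] by simp
  have "\<exists>s \<in> carrier R - p. s \<otimes> a \<in> {r \<in> carrier R. r \<otimes> j \<in> PIdl c}" if "a \<in> p" for a
  proof -
    have "a \<in> Q" using that pQ by simp
    hence a: "a \<in> carrier R" "a \<otimes> j \<in> ?L" unfolding j(3) by simp_all
    from a(2) obtain t v where t: "t \<in> carrier R" "t \<notin> p" "v \<in> carrier R" "t \<otimes> (a \<otimes> j) = v \<otimes> c"
      by (rule local_multiplesE)
    hence "(t \<otimes> a) \<otimes> j \<in> PIdl c" using a j by (auto simp: cgenideal_def m_assoc)
    thus ?thesis using t a by auto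
  qed
  then obtain t where t: "t \<in> carrier R - p" "\<forall>a \<in> p. t \<otimes> a \<in> {r \<in> carrier R. r \<otimes> j \<in> PIdl c}"
    by (rule uniform_denominator[OF p maximal_ideal[OF p] ideal_colon[OF cgenideal_ideal[OF cR] j(1)]])
  define k where "k = t \<otimes> j"
  have k: "k \<in> carrier R" using t j by (simp add: k_def)
  have kp: "\<exists>v \<in> carrier R. a \<otimes> k = v \<otimes> c" if "a \<in> p" for a
  proof -
    have "(t \<otimes> a) \<otimes> j \<in> PIdl c" using t(2) that by simp
    moreover have "(t \<otimes> a) \<otimes> j = a \<otimes> k" using t j maximal_carrier[OF p that] by (simp add: k_def m_ac)
    ultimately show ?thesis by (auto simp: cgenideal_def)
  qed
  have kL: "\<not> c divides k"
  proof
    assume "c divides k"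
    then obtain d where "d \<in> carrier R" "k = c \<otimes> d" by (auto simp: factor_def)
    hence "j \<in> ?L" using t j cR unfolding k_def
      by (intro local_multiplesI[of _ t _ d]) (auto simp: m_comm)
    thus False using j by simp
  qed
  have "\<exists>\<pi> \<in> p. \<exists>s \<in> carrier R - p. \<pi> \<otimes> k = s \<otimes> c"
  proof (rule ccontr)
    assume n: "\<not> ?thesis"
    have step: "\<exists>b. b \<in> p \<and> c \<otimes> b = k \<otimes> a" if "a \<in> p" for a
    proof -
      obtain v where "v \<in> carrier R" "a \<otimes> k = v \<otimes> c" using kp \<open>a \<in> p\<close> by blast
      thus ?thesis using n that cR k maximal_carrier[OF p that] m_comm by (metis DiffI)
    qed
    have "\<exists>x. \<forall>n. x n \<in> p \<and> (n = 0 \<longrightarrow> x n = c) \<and> c \<otimes> x (Suc n) = k \<otimes> x n"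
      using dependent_nat_choice[of "\<lambda>n x. x \<in> p \<and> (n = 0 \<longrightarrow> x = c)" "\<lambda>n x y. c \<otimes> y = k \<otimes> x"]
        c(1) step by (metis nat.simps(3))
    then obtain x where x: "\<And>n. x n \<in> p" "x (0::nat) = c" "\<And>n. c \<otimes> x (Suc n) = k \<otimes> x n" by blast
    have "integral_fraction R k c"
      using integral_fraction_if_bounded_powers[OF k cR c(2), of x] x c maximal_carrier[OF p] by auto
    thus False using kL integrally_closed k cR c by (auto simp: integrally_closed_def)
  qed
  then obtain \<pi> s where \<pi>: "\<pi> \<in> p" "s \<in> carrier R - p" "\<pi> \<otimes> k = s \<otimes> c" by auto
  have "\<exists>u \<in> carrier R. s \<otimes> a = u \<otimes> \<pi>" if a: "a \<in> p" for a
  proof -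
    obtain u where u: "u \<in> carrier R" "a \<otimes> k = u \<otimes> c" using kp[OF a] by auto
    have aR: "a \<in> carrier R" and \<pi>R: "\<pi> \<in> carrier R" using a \<pi> maximal_carrier[OF p] by auto
    have "(s \<otimes> a) \<otimes> c = a \<otimes> (\<pi> \<otimes> k)" using \<pi> aR cR by (simp add: m_ac)
    also have "\<dots> = \<pi> \<otimes> (a \<otimes> k)" using aR \<pi>R k by (simp add: m_ac)
    also have "\<dots> = (u \<otimes> \<pi>) \<otimes> c" using u \<pi>R cR by (simp add: m_ac)
    finally have "s \<otimes> a = u \<otimes> \<pi>" using m_rcancel[OF c(2) cR] \<pi> aR u \<pi>R by simp
    thus ?thesis using u by auto
  qed
  hence "\<forall>a \<in> p. \<exists>u \<in> carrier R. s \<otimes> a = u \<otimes> \<pi>" by (rule ballI)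
  thus ?thesis by (rule that[OF \<pi>(1,2)])
qed

text \<open>
  Divide \<open>c\<close> by the uniformizer as long as the quotient lies in \<open>p\<close>. Each division strictly enlarges
  the ideal generated in the localisation, so the process stops. This is phrased as a choice of a
  counterexample for which that ideal is maximal.
\<close>
lemma local_valuation:
  assumes p: "maximalideal p R" and \<pi>: "\<pi> \<in> p" and s: "s \<in> carrier R - p"
    and gen: "\<forall>a \<in> p. \<exists>u \<in> carrier R. s \<otimes> a = u \<otimes> \<pi>"
    and c: "c \<in> carrier R" "c \<noteq> \<zero>"
  obtains k t u where "t \<in> carrier R - p" "u \<in> carrier R - p" "t \<otimes> c = u \<otimes> \<pi> [^] (k::nat)"
proof -
  let ?good = "\<lambda>c. \<exists>k::nat. \<exists>t \<in> carrier R - p. \<exists>u \<in> carrier R - p. t \<otimes> c = u \<otimes> \<pi> [^] k"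
  have \<pi>R: "\<pi> \<in> carrier R" using maximal_carrier[OF p \<pi>] .
  have "?good c"
  proof (rule ccontr)
    assume "\<not> ?good c"
    hence Pc: "c \<in> carrier R \<and> c \<noteq> \<zero> \<and> \<not> ?good c" using c by (intro conjI)
    obtain d where Pd: "d \<in> carrier R \<and> d \<noteq> \<zero> \<and> \<not> ?good d"
      and max: "\<forall>e. e \<in> carrier R \<and> e \<noteq> \<zero> \<and> \<not> ?good e \<longrightarrow>
        local_multiples p d \<subseteq> local_multiples p e \<longrightarrow> local_multiples p e = local_multiples p d"
      by (rule ideal_family_has_maximal[of "\<lambda>d. d \<in> carrier R \<and> d \<noteq> \<zero> \<and> \<not> ?good d", OF Pc])
        (auto intro: local_multiples_ideal[OF p])
    note d = conjunct1[OF Pd] conjunct1[OF conjunct2[OF Pd]] conjunct2[OF conjunct2[OF Pd]]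
    have "d \<in> p"
    proof (rule ccontr)
      assume "d \<notin> p"
      hence "\<one> \<otimes> d = d \<otimes> \<pi> [^] (0::nat)" "d \<in> carrier R - p" "\<one> \<in> carrier R - p"
        using d maximal_one_notin[OF p] by auto
      thus False using d(3) by metis
    qed
    then obtain e where e: "e \<in> carrier R" "s \<otimes> d = e \<otimes> \<pi>" using gen by blast
    have "e \<noteq> \<zero>" using e s d integral[of s d] \<pi>R additive_subgroup.zero_closed[OF ideal.axioms(1)[OF maximal_ideal[OF p]]] by auto
    have eb: "\<not> ?good e"
    proof
      assume "?good e"
      then obtain k :: nat and t u where t: "t \<in> carrier R - p" "u \<in> carrier R - p" "t \<otimes> e = u \<otimes> \<pi> [^] k" by blast
      have "(t \<otimes> s) \<otimes> d = t \<otimes> (s \<otimes> d)" using t s d by (simp add: m_assoc)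
      also have "\<dots> = (t \<otimes> e) \<otimes> \<pi>" using e t(1) \<pi>R by (simp add: m_assoc)
      also have "\<dots> = u \<otimes> \<pi> [^] Suc k" using t \<pi>R by (simp add: m_assoc)
      finally have "(t \<otimes> s) \<otimes> d = u \<otimes> \<pi> [^] Suc k" .
      thus False using d(3) t(2) maximal_mult_notin[OF p t(1) s] by blast
    qed
    have "local_multiples p d \<subseteq> local_multiples p e"
    proof
      fix r assume "r \<in> local_multiples p d"
      then obtain t v where t: "r \<in> carrier R" "t \<in> carrier R" "t \<notin> p" "v \<in> carrier R" "t \<otimes> r = v \<otimes> d"
        by (rule local_multiplesE)
      have "(s \<otimes> t) \<otimes> r = s \<otimes> (t \<otimes> r)" using t(1,2) s by (simp add: m_assoc)
      also have "\<dots> = v \<otimes> (s \<otimes> d)" using t(4,5) s d(1) by (simp add: m_ac)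
      also have "\<dots> = (v \<otimes> \<pi>) \<otimes> e" using e t \<pi>R by (simp add: m_ac)
      finally show "r \<in> local_multiples p e"
        using t s \<pi>R maximal_mult_notin[OF p s, of t] by (intro local_multiplesI[of _ "s \<otimes> t" _ "v \<otimes> \<pi>"]) auto
    qed
    hence "local_multiples p e = local_multiples p d"
      by (rule max[THEN spec, THEN mp, THEN mp, OF conjI[OF e(1) conjI[OF \<open>e \<noteq> \<zero>\<close> eb]]])
    moreover have "e \<in> local_multiples p e"
      using e maximal_one_notin[OF p] by (intro local_multiplesI[of _ \<one> _ \<one>]) auto
    ultimately have "e \<in> local_multiples p d" using d by simp
    then obtain t v where t: "t \<in> carrier R" "t \<notin> p" "v \<in> carrier R" "t \<otimes> e = v \<otimes> d"
      by (rule local_multiplesE)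
    have "(s \<otimes> t) \<otimes> e = s \<otimes> (t \<otimes> e)" using t(1) e(1) s by (simp add: m_assoc)
    also have "\<dots> = v \<otimes> (s \<otimes> d)" using t(3,4) s d(1) by (simp add: m_ac)
    also have "\<dots> = (v \<otimes> \<pi>) \<otimes> e" using e t \<pi>R by (simp add: m_ac)
    finally have "s \<otimes> t = v \<otimes> \<pi>" using m_rcancel[OF \<open>e \<noteq> \<zero>\<close> e(1)] s t \<pi>R by simp
    moreover have "v \<otimes> \<pi> \<in> p" using maximal_mult_in(1)[OF p \<pi> t(3)] .
    ultimately show False using maximal_mult_notin[OF p s, of t] t by auto
  qed
  thus ?thesis using that by blast
qed

text \<open>An element of \<open>I\<close> with the least exponent in \<open>local_valuation\<close> generates \<open>I\<close> locally.\<close>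
lemma locally_principal:
  assumes p: "maximalideal p R" and I: "ideal I R" and b0: "b0 \<in> I" "b0 \<noteq> \<zero>"
  obtains b s where "b \<in> I" "b \<noteq> \<zero>" "s \<in> carrier R - p" "\<forall>a \<in> I. \<exists>v \<in> carrier R. s \<otimes> a = v \<otimes> b"
proof -
  interpret I: ideal I R by fact
  obtain \<pi> q where \<pi>: "\<pi> \<in> p" "q \<in> carrier R - p" "\<forall>a \<in> p. \<exists>u \<in> carrier R. q \<otimes> a = u \<otimes> \<pi>"
    by (rule uniformizer[OF p])
  have \<pi>R: "\<pi> \<in> carrier R" using maximal_carrier[OF p \<pi>(1)] .
  let ?v = "\<lambda>c k. \<exists>t \<in> carrier R - p. \<exists>u \<in> carrier R - p. t \<otimes> c = u \<otimes> \<pi> [^] (k::nat)"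
  have val: "\<exists>k. ?v c k" if "c \<in> carrier R" "c \<noteq> \<zero>" for c
    using local_valuation[OF p \<pi> that] by metis
  let ?K = "\<lambda>k. \<exists>b \<in> I. b \<noteq> \<zero> \<and> ?v b k"
  have ex: "\<exists>k. ?K k" using val[of b0] b0 I.Icarr by blast
  define k where "k = (LEAST k. ?K k)"
  have k1: "?K k" unfolding k_def by (rule LeastI_ex[OF ex])
  have k2: "k \<le> l" if "?K l" for l unfolding k_def by (rule Least_le[of ?K, OF that])
  from k1 obtain b t u where b: "b \<in> I" "b \<noteq> \<zero>" "t \<in> carrier R - p" "u \<in> carrier R - p" "t \<otimes> b = u \<otimes> \<pi> [^] k"
    by blast
  have bR: "b \<in> carrier R" using b I.Icarr by simp
  have "\<exists>s \<in> carrier R - p. s \<otimes> a \<in> PIdl b" if a: "a \<in> I" for a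
  proof (cases "a = \<zero>")
    case True
    thus ?thesis using maximal_one_notin[OF p] bR by (intro bexI[of _ \<one>]) (auto simp: cgenideal_def intro!: exI[of _ \<zero>])
  next
    case False
    have aR: "a \<in> carrier R" using a I.Icarr by simp
    from val[OF aR False] obtain l t' u' where
      l: "t' \<in> carrier R - p" "u' \<in> carrier R - p" "t' \<otimes> a = u' \<otimes> \<pi> [^] (l::nat)"
      by (elim exE bexE) (rule that)
    hence "?v a l" by blast
    hence "k \<le> l" using a False by (intro k2 bexI[of _ a]) simp_all
    hence pw: "\<pi> [^] l = \<pi> [^] (l - k) \<otimes> \<pi> [^] k" using \<pi>R by (simp add: nat_pow_mult)
    have "(u \<otimes> t') \<otimes> a = u \<otimes> (u' \<otimes> (\<pi> [^] (l - k) \<otimes> \<pi> [^] k))" using l b aR pw by (simp add: m_assoc)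
    also have "\<dots> = (u' \<otimes> \<pi> [^] (l - k)) \<otimes> (u \<otimes> \<pi> [^] k)" using l b \<pi>R by (simp add: m_ac)
    also have "\<dots> = ((u' \<otimes> \<pi> [^] (l - k)) \<otimes> t) \<otimes> b" using b(5)[symmetric] l b(3) \<pi>R bR by (simp add: m_assoc)
    finally have "(u \<otimes> t') \<otimes> a \<in> PIdl b" using l b \<pi>R by (auto simp: cgenideal_def)
    thus ?thesis using maximal_mult_notin[OF p b(4) l(1)] by blast
  qed
  then obtain s where s: "s \<in> carrier R - p" "\<forall>a \<in> I. s \<otimes> a \<in> PIdl b"
    by (rule uniform_denominator[OF p I cgenideal_ideal[OF bR]])
  hence "\<forall>a \<in> I. \<exists>v \<in> carrier R. s \<otimes> a = v \<otimes> b" by (auto simp: cgenideal_def)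
  thus ?thesis by (rule that[OF b(1,2) s(1)])
qed

end


section \<open>Primary torsion modules\<close>

locale dedekind_module = R?: dedekind_ring R + module R M for R (structure) and M (structure)
begin

text \<open>Since \<open>p\<close> is finitely generated, powers of its elements may stand for powers of \<open>p\<close>.\<close>
definition primary_mod :: "'a set \<Rightarrow> 'c set \<Rightarrow> bool" where
  "primary_mod p N \<longleftrightarrow> submod N \<and> (\<forall>x \<in> carrier M. \<forall>a \<in> p. \<exists>k::nat. (a [^] k) \<cdot> x \<in> N)"

lemma primary_mod_mono: "primary_mod p N \<Longrightarrow> submod N' \<Longrightarrow> N \<subseteq> N' \<Longrightarrow> primary_mod p N'"
  unfolding primary_mod_def by (meson subsetD)

lemma power_one_minus_multiple:
  assumes "r \<in> carrier R" "s \<in> carrier R"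
  shows "\<exists>t \<in> carrier R. (\<one> \<ominus> r \<otimes> s) [^] (k::nat) = \<one> \<ominus> t \<otimes> s"
proof (induction k)
  case 0
  show ?case using assms by (intro bexI[of _ \<zero>]) (auto simp: R.minus_eq)
next
  case (Suc k)
  then obtain t where t: "t \<in> carrier R" "(\<one> \<ominus> r \<otimes> s) [^] k = \<one> \<ominus> t \<otimes> s" by auto
  have "(\<one> \<ominus> r \<otimes> s) [^] Suc k = (\<one> \<ominus> t \<otimes> s) \<otimes> (\<one> \<ominus> r \<otimes> s)" using t by simp
  also have "\<dots> = \<one> \<ominus> (t \<oplus> r \<ominus> t \<otimes> s \<otimes> r) \<otimes> s"
    using assms t(1) by algebra
  finally show ?case using assms t by blast
qed

text \<open>Modulo \<open>p\<close> there is an inverse \<open>r\<close> of \<open>s\<close>, and a power of \<open>1 - r s \<in> p\<close> kills \<open>x\<close>.\<close>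
lemma primary_inverse:
  assumes p: "maximalideal p R" and N: "primary_mod p N" and x: "x \<in> carrier M" and s: "s \<in> carrier R - p"
  obtains r where "r \<in> carrier R" "(\<one> \<ominus> r \<otimes> s) \<cdot> x \<in> N"
proof -
  obtain r where r: "r \<in> carrier R" "\<one> \<ominus> r \<otimes> s \<in> p" by (rule maximal_inverse[OF p s])
  then obtain k :: nat where "((\<one> \<ominus> r \<otimes> s) [^] k) \<cdot> x \<in> N"
    using N x by (auto simp: primary_mod_def)
  thus ?thesis using power_one_minus_multiple[of r s k] r s that by auto
qed

lemma primary_saturated:
  assumes p: "maximalideal p R" and N: "primary_mod p N" and x: "x \<in> carrier M" and s: "s \<in> carrier R - p"
    and "s \<cdot> x \<in> N"
  shows "x \<in> N"
proof -
  obtain r where "r \<in> carrier R" "(\<one> \<ominus> r \<otimes> s) \<cdot> x \<in> N" by (rule primary_inverse[OF p N x s])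
  thus ?thesis using submod_comaximal[of N x r s] N x s assms(5) by (simp add: primary_mod_def)
qed

lemma one_minus_notin:
  assumes p: "maximalideal p R" and a: "a \<in> p"
  shows "\<one> \<ominus> a \<in> carrier R - p"
proof -
  have aR: "a \<in> carrier R" using maximal_carrier[OF p a] .
  interpret p: maximalideal p R by fact
  have "\<one> \<ominus> a \<notin> p"
  proof
    assume "\<one> \<ominus> a \<in> p"
    hence "(\<one> \<ominus> a) \<oplus> a \<in> p" using a by (rule p.a_closed)
    moreover have "(\<one> \<ominus> a) \<oplus> a = \<one>" using aR by (simp add: R.minus_eq R.a_assoc R.l_neg)
    ultimately show False using maximal_one_notin[OF p] by simp
  qed
  thus ?thesis using aR by simp
qed

end

locale dedekind_module_at = dedekind_module +
  fixes p :: "'a set" and \<pi> s\<^sub>0 :: 'a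
  assumes p: "maximalideal p R" and \<pi>: "\<pi> \<in> p" and s0: "s\<^sub>0 \<in> carrier R - p"
    and gen: "\<forall>a \<in> p. \<exists>u \<in> carrier R. s\<^sub>0 \<otimes> a = u \<otimes> \<pi>"
begin

lemma \<pi>R [simp]: "\<pi> \<in> carrier R"
  by (rule maximal_carrier[OF p \<pi>])

lemma uniformizer_kills:
  assumes N: "primary_mod p N" and x: "x \<in> carrier M" and "\<pi> \<cdot> x \<in> N" and a: "a \<in> p"
  shows "a \<cdot> x \<in> N"
proof -
  obtain u where u: "u \<in> carrier R" "s\<^sub>0 \<otimes> a = u \<otimes> \<pi>" using gen a by blast
  have aR: "a \<in> carrier R" using maximal_carrier[OF p a] .
  have "s\<^sub>0 \<cdot> (a \<cdot> x) = u \<cdot> (\<pi> \<cdot> x)"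
    using u aR x s0 smult_assoc1[of s\<^sub>0 a x] smult_assoc1[of u \<pi> x] by simp
  moreover have "u \<cdot> (\<pi> \<cdot> x) \<in> N"
    using N assms(3) u submoduleE(4) by (simp add: primary_mod_def)
  ultimately have "s\<^sub>0 \<cdot> (a \<cdot> x) \<in> N" by simp
  thus ?thesis using primary_saturated[OF p N _ s0] aR x by simp
qed

text \<open>
  If \<open>M / N\<close> is \<open>p\<close>-primary and every generating set of it contains a weak basis, then
  \<open>p M\<close> is superfluous modulo \<open>N\<close>: a submodule \<open>K\<close> with \<open>K + p M = M\<close> contains lifts \<open>B\<close> of a basis
  of the vector space \<open>M / (N + p M)\<close>. The quotient by the span of \<open>B\<close> still has a weak basis, but it
  equals \<open>p\<close> times itself, so that weak basis is empty.
\<close>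
lemma primary_supplement_trivial:
  assumes rwb: "rwb_mod N" and N: "primary_mod p N" and K: "submod K" "N \<subseteq> K"
    and sup: "\<And>x. x \<in> carrier M \<Longrightarrow> \<exists>y \<in> carrier M. x \<boxminus> \<pi> \<cdot> y \<in> K"
  shows "K = carrier M"
proof -
  let ?P = "{\<pi> \<cdot> y | y. y \<in> carrier M}"
  have sN: "submod N" using N by (simp add: primary_mod_def)
  have sP: "submod ?P" by (rule submod_smult_image) simp
  define L where "L = {n \<boxplus> q | n q. n \<in> N \<and> q \<in> ?P}"
  have sL: "submod L" unfolding L_def by (rule submod_sum[OF sN sP])
  have NL: "N \<subseteq> L"
  proof
    fix n assume "n \<in> N"
    thus "n \<in> L" unfolding L_def using submod_carrier[OF sN] submod_zero[OF sP]
      by (intro CollectI exI[of _ n] exI[of _ "\<zero>\<^bsub>M\<^esub>"]) auto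
  qed
  have PL: "\<pi> \<cdot> y \<in> L" if "y \<in> carrier M" for y
    unfolding L_def using that submod_zero[OF sN]
    by (intro CollectI exI[of _ "\<zero>\<^bsub>M\<^esub>"] exI[of _ "\<pi> \<cdot> y"]) auto
  have Lel: "\<exists>n \<in> N. \<exists>y \<in> carrier M. l = n \<boxplus> \<pi> \<cdot> y" if "l \<in> L" for l
    using that unfolding L_def by blast
  have Lc: "L \<subseteq> carrier M" and Kc: "K \<subseteq> carrier M" and Nc: "N \<subseteq> carrier M"
    using submoduleE(1) sL K sN by auto
  have pL: "primary_mod p L" by (rule primary_mod_mono[OF N sL NL])
  have aL: "a \<cdot> x \<in> L" if a: "a \<in> p" and x: "x \<in> carrier M" for a x
    using uniformizer_kills[OF pL x PL[OF x] a] .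
  obtain B where B: "B \<subseteq> K" "\<forall>b \<in> B. b \<notin> span (L \<union> (B - {b}))" "K \<subseteq> span (L \<union> B)"
  proof (rule exists_independent_spanning_subset[of K "\<lambda>A. span (L \<union> A)"])
    show "span (L \<union> A) \<subseteq> span (L \<union> A')" if "A \<subseteq> A'" "A' \<subseteq> K" for A A'
      using that by (intro span_mono) auto
    show "A \<subseteq> span (L \<union> A)" for A using span_superset[of "L \<union> A"] by auto
    show "\<exists>F. finite F \<and> F \<subseteq> A \<and> x \<in> span (L \<union> F)" if "A \<subseteq> K" "x \<in> span (L \<union> A)" for A x
      using span_Un_finitary[OF Lc _ that(2)] that(1) Kc by auto
  next
    fix A x y assume A: "A \<subseteq> K" and x: "x \<in> K" and y: "y \<in> K"
      and in_: "y \<in> span (L \<union> insert x A)" and nin: "y \<notin> span (L \<union> A)"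
    have c: "L \<union> A \<subseteq> carrier M" "x \<in> carrier M" "y \<in> carrier M" using A Lc Kc x y by auto
    have "y \<in> span (insert x (L \<union> A))" using in_ by simp
    then obtain v r where vr: "v \<in> span (L \<union> A)" "r \<in> carrier R" "y = v \<boxplus> r \<cdot> x"
      by (rule span_insert_decompose[OF c(1,2)])
    have sA: "submod (span (L \<union> A))" using c by (intro submod_span) auto
    have "r \<notin> p"
    proof
      assume "r \<in> p"
      hence "r \<cdot> x \<in> span (L \<union> A)" using aL[OF _ c(2)] span_base by blast
      hence "y \<in> span (L \<union> A)" using vr sA submoduleE(5) by simp
      thus False using nin by simp
    qed
    hence r: "r \<in> carrier R - p" using vr by simp
    obtain t where t: "t \<in> carrier R" "(\<one> \<ominus> t \<otimes> r) \<cdot> x \<in> L" by (rule primary_inverse[OF p pL c(2) r])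
    let ?S = "span (L \<union> insert y A)"
    have sS: "submod ?S" using c by (intro submod_span) auto
    have "L \<subseteq> ?S" "v \<in> ?S" "y \<in> ?S"
      using span_superset[of "L \<union> insert y A"] vr(1) span_mono[of "L \<union> A" "L \<union> insert y A"] by auto
    moreover have "r \<cdot> x = y \<boxminus> v"
      using vr c submod_carrier[OF sA vr(1)] add_diff[of "r \<cdot> x" v] by (simp add: M.a_comm)
    ultimately have "r \<cdot> x \<in> ?S" using submod_diff[OF sS] by simp
    thus "x \<in> ?S" using submod_comaximal[OF sS c(2) t(1) vr(2)] t(2) \<open>L \<subseteq> ?S\<close> by auto
  qed
  have Bc: "B \<subseteq> carrier M" using B Kc by auto
  have LB: "span (L \<union> B) = carrier M"
  proof (rule equalityI)
    show "span (L \<union> B) \<subseteq> carrier M" using Lc Bc by (intro span_carrier) auto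
    show "carrier M \<subseteq> span (L \<union> B)"
    proof
      fix x assume x: "x \<in> carrier M"
      obtain y where y: "y \<in> carrier M" "x \<boxminus> \<pi> \<cdot> y \<in> K" using sup[OF x] by auto
      have "submod (span (L \<union> B))" using Lc Bc by (intro submod_span) auto
      moreover have "\<pi> \<cdot> y \<in> span (L \<union> B)" using PL[OF y(1)] span_base by blast
      moreover have "x \<boxminus> \<pi> \<cdot> y \<in> span (L \<union> B)" using y B by auto
      ultimately show "x \<in> span (L \<union> B)" using submod_diff_cancel x by blast
    qed
  qed
  let ?K2 = "span (N \<union> B)"
  have rwb2: "rwb_mod ?K2" using rwb_mod_irredundant[OF rwb sN sL NL Bc LB] B(2) by blast
  have K2c: "?K2 \<subseteq> carrier M" using Nc Bc by (intro span_carrier) auto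
  have sK2: "submod ?K2" using Nc Bc by (intro submod_span) auto
  obtain Z where Z: "Z \<subseteq> carrier M" "span (?K2 \<union> Z) = carrier M"
    and Zi: "\<forall>z \<in> Z. z \<notin> span (?K2 \<union> (Z - {z}))"
    by (rule rwb_mod_carrierE[OF rwb2 sK2])
  have K2K: "?K2 \<subseteq> K" using K B by (intro span_least) auto
  show ?thesis
  proof (cases "Z = {}")
    case True
    thus ?thesis using Z span_submod[OF sK2] K2K Kc by auto
  next
    case False
    then obtain z where z: "z \<in> Z" by auto
    hence zc: "z \<in> carrier M" using Z by auto
    let ?V = "span (?K2 \<union> (Z - {z}))"
    have KZc: "?K2 \<union> (Z - {z}) \<subseteq> carrier M" using K2c Z by auto
    have sV: "submod ?V" by (rule submod_span[OF KZc])
    have K2V: "?K2 \<subseteq> ?V" using span_superset[of "?K2 \<union> (Z - {z})"] by auto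
    have pV: "primary_mod p ?V"
      using primary_mod_mono[OF N sV] K2V span_superset[of "N \<union> B"] by auto
    have "z \<in> span (L \<union> B)" using LB zc by simp
    then obtain l b where lb: "l \<in> span L" "b \<in> span B" "z = l \<boxplus> b"
      by (rule span_Un_decompose[OF Lc Bc])
    have "l \<in> L" using lb(1) span_submod[OF sL] by simp
    then obtain n y where ny: "n \<in> N" "y \<in> carrier M" "l = n \<boxplus> \<pi> \<cdot> y" using Lel by blast
    have nV: "n \<in> ?V" using ny(1) K2V span_superset[of "N \<union> B"] by auto
    have bV: "b \<in> ?V" using lb(2) K2V span_mono[of B "N \<union> B"] by auto
    have ins: "insert z (?K2 \<union> (Z - {z})) = ?K2 \<union> Z" using z by auto
    have "y \<in> span (insert z (?K2 \<union> (Z - {z})))" unfolding ins using ny Z by simp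
    then obtain w r where wr: "w \<in> ?V" "r \<in> carrier R" "y = w \<boxplus> r \<cdot> z"
      by (rule span_insert_decompose[OF KZc zc])
    have c: "n \<in> carrier M" "b \<in> carrier M" "w \<in> carrier M" using submod_carrier[OF sV] nV bV wr by auto
    let ?v = "n \<boxplus> b \<boxplus> \<pi> \<cdot> w"
    have vV: "?v \<in> ?V" using nV bV wr sV submoduleE(4,5) by simp
    have vc: "?v \<in> carrier M" using c by simp
    have "z = ?v \<boxplus> (\<pi> \<otimes> r) \<cdot> z"
    proof -
      have "z = n \<boxplus> \<pi> \<cdot> y \<boxplus> b" using lb(3) ny(3) by simp
      also have "\<pi> \<cdot> y = \<pi> \<cdot> w \<boxplus> (\<pi> \<otimes> r) \<cdot> z"
        using wr(2,3) c zc by (simp add: smult_r_distr smult_assoc1)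
      finally show ?thesis using c zc wr(2) by (simp add: M.a_ac)
    qed
    hence "z \<boxminus> (\<pi> \<otimes> r) \<cdot> z = ?v" using add_diff[OF vc, of "(\<pi> \<otimes> r) \<cdot> z"] zc wr(2) by simp
    hence "(\<one> \<ominus> \<pi> \<otimes> r) \<cdot> z \<in> ?V" using vV zc wr(2) by (simp add: smult_diff_l)
    moreover have "\<one> \<ominus> \<pi> \<otimes> r \<in> carrier R - p" using one_minus_notin[OF p] maximal_mult_in(2)[OF p \<pi> wr(2)] by simp
    ultimately have "z \<in> ?V" using primary_saturated[OF p pV zc] by blast
    thus ?thesis using Zi z by blast
  qed
qed

lemma smult_power_Suc: "x \<in> carrier M \<Longrightarrow> \<pi> \<cdot> ((\<pi> [^] (k::nat)) \<cdot> x) = (\<pi> [^] Suc k) \<cdot> x"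
  using smult_assoc1[of \<pi> "\<pi> [^] k" x] R.m_comm[of \<pi> "\<pi> [^] k"] by simp

lemma smult_power_add:
  "x \<in> carrier M \<Longrightarrow> (\<pi> [^] (k::nat)) \<cdot> ((\<pi> [^] (l::nat)) \<cdot> x) = (\<pi> [^] (k + l)) \<cdot> x"
  using smult_assoc1[of "\<pi> [^] k" "\<pi> [^] l" x] by (simp add: R.nat_pow_mult)

lemma last_power_notin:
  assumes N: "primary_mod p N" and x: "x \<in> carrier M" and "(\<pi> [^] (n::nat)) \<cdot> x \<notin> N"
  obtains m where "n \<le> m" "(\<pi> [^] m) \<cdot> x \<notin> N" "(\<pi> [^] Suc m) \<cdot> x \<in> N"
proof -
  have sN: "submod N" using N by (simp add: primary_mod_def)
  obtain k :: nat where k: "(\<pi> [^] k) \<cdot> x \<in> N" using N x \<pi> unfolding primary_mod_def by blast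
  have up: "(\<pi> [^] (k + j)) \<cdot> x \<in> N" for j
    using smult_power_add[OF x, of j k] submoduleE(4)[OF sN _ k, of "\<pi> [^] j"] by (simp add: add.commute)
  have "(\<pi> [^] (n + k)) \<cdot> x \<in> N" using up[of n] by (simp add: add.commute)
  hence "\<exists>j. (\<pi> [^] (n + j)) \<cdot> x \<notin> N \<and> (\<pi> [^] (n + Suc j)) \<cdot> x \<in> N"
  proof (rule contrapos_pp)
    assume *: "\<not> (\<exists>j. (\<pi> [^] (n + j)) \<cdot> x \<notin> N \<and> (\<pi> [^] (n + Suc j)) \<cdot> x \<in> N)"
    have "(\<pi> [^] (n + j)) \<cdot> x \<notin> N" for j
      by (induction j) (use assms(3) * in auto)
    thus "(\<pi> [^] (n + k)) \<cdot> x \<notin> N" .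
  qed
  then obtain j where "(\<pi> [^] (n + j)) \<cdot> x \<notin> N" "(\<pi> [^] (n + Suc j)) \<cdot> x \<in> N" by blast
  thus ?thesis using that[of "n + j"] by simp
qed

text \<open>
  If \<open>M / N\<close> is unbounded and \<open>K / N\<close> is bounded, then \<open>M / K\<close> has elements \<open>f \<noteq> 0\<close> of arbitrary height that
  are killed by \<open>\<pi>\<close>. If \<open>e\<close> is a multiple of such an \<open>f\<close>, nothing has to be done. Otherwise dividing by
  \<open>e - f\<close> makes \<open>e\<close> as high as \<open>f\<close> without killing it. The new submodule is again bounded over \<open>N\<close>, so
  that the step can be repeated.
\<close>
lemma raise_height:
  assumes N: "primary_mod p N" and unb: "\<And>k::nat. \<exists>x \<in> carrier M. (\<pi> [^] k) \<cdot> x \<notin> N"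
    and e: "e \<in> carrier M" "\<pi> \<cdot> e \<in> N"
    and K: "submod K" "N \<subseteq> K" "e \<notin> K" and bd: "\<And>x. x \<in> K \<Longrightarrow> (\<pi> [^] (b::nat)) \<cdot> x \<in> N"
  shows "\<exists>K'. submod K' \<and> K \<subseteq> K' \<and> e \<notin> K' \<and> (\<exists>b::nat. \<forall>x \<in> K'. (\<pi> [^] b) \<cdot> x \<in> N) \<and>
    (\<exists>y \<in> carrier M. e \<boxminus> (\<pi> [^] (n::nat)) \<cdot> y \<in> K')"
proof -
  have pK: "primary_mod p K" by (rule primary_mod_mono[OF N K(1,2)])
  obtain x where x: "x \<in> carrier M" "(\<pi> [^] (b + n)) \<cdot> x \<notin> N" using unb by blast
  have "(\<pi> [^] n) \<cdot> x \<notin> K" using bd[of "(\<pi> [^] n) \<cdot> x"] x smult_power_add[OF x(1), of b n] by auto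
  then obtain m where m: "n \<le> m" "(\<pi> [^] m) \<cdot> x \<notin> K" "(\<pi> [^] Suc m) \<cdot> x \<in> K"
    by (rule last_power_notin[OF pK x(1)])
  define f where "f = (\<pi> [^] m) \<cdot> x"
  define y where "y = (\<pi> [^] (m - n)) \<cdot> x"
  have f: "f \<in> carrier M" "f \<notin> K" "\<pi> \<cdot> f \<in> K"
    using m x smult_power_Suc[OF x(1), of m] by (auto simp: f_def)
  have y: "y \<in> carrier M" "f = (\<pi> [^] n) \<cdot> y"
    using x m smult_power_add[OF x(1), of n "m - n"] by (auto simp: y_def f_def)
  have eK: "\<pi> \<cdot> e \<in> K" using e K by auto
  have Kc: "K \<subseteq> carrier M" using K submoduleE(1) by auto
  show ?thesis
  proof (cases "\<exists>k \<in> K. \<exists>r \<in> carrier R. e = k \<boxplus> r \<cdot> f")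
    case True
    then obtain k r where kr: "k \<in> K" "r \<in> carrier R" "e = k \<boxplus> r \<cdot> f" by auto
    have "r \<cdot> f = (\<pi> [^] n) \<cdot> (r \<cdot> y)" using y kr smult_commute[of r "\<pi> [^] n" y] by simp
    moreover have "k \<in> carrier M" using kr Kc by auto
    ultimately have "e \<boxminus> (\<pi> [^] n) \<cdot> (r \<cdot> y) = k"
      using kr(2,3) y(1) add_diff[of k "r \<cdot> f"] by simp
    hence "\<exists>y \<in> carrier M. e \<boxminus> (\<pi> [^] n) \<cdot> y \<in> K" using kr y by (intro bexI[of _ "r \<cdot> y"]) auto
    thus ?thesis using K bd by (intro exI[of _ K]) auto
  next
    case False
    let ?d = "e \<boxminus> f"
    have d: "?d \<in> carrier M" using e f by simp
    have "\<pi> \<cdot> ?d = \<pi> \<cdot> e \<boxminus> \<pi> \<cdot> f" using e f by (simp add: smult_diff_r)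
    hence dK: "\<pi> \<cdot> ?d \<in> K" using submod_diff[OF K(1) eK f(3)] by simp
    let ?K' = "span (insert ?d K)"
    have sK': "submod ?K'" using Kc d by (intro submod_span) auto
    have el: "\<exists>k \<in> K. \<exists>r \<in> carrier R. z = k \<boxplus> r \<cdot> ?d" if "z \<in> ?K'" for z
      using span_insert_decompose[OF Kc d that] span_submod[OF K(1)] by metis
    have "(\<pi> [^] Suc b) \<cdot> z \<in> N" if z: "z \<in> ?K'" for z
    proof -
      obtain k r where kr: "k \<in> K" "r \<in> carrier R" "z = k \<boxplus> r \<cdot> ?d" using el[OF z] by auto
      have kc: "k \<in> carrier M" using kr Kc by auto
      have "\<pi> \<cdot> z = \<pi> \<cdot> k \<boxplus> r \<cdot> (\<pi> \<cdot> ?d)"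
        using kr(2,3) kc d smult_commute[of r \<pi> ?d] by (simp add: smult_r_distr)
      hence "\<pi> \<cdot> z \<in> K" using kr dK K(1) submoduleE(4,5) by simp
      hence "(\<pi> [^] b) \<cdot> (\<pi> \<cdot> z) \<in> N" by (rule bd)
      moreover have "z \<in> carrier M" using submod_carrier[OF sK' z] .
      ultimately show ?thesis using smult_assoc1[of "\<pi> [^] b" \<pi> z] by simp
    qed
    moreover have "e \<notin> ?K'"
    proof
      assume "e \<in> ?K'"
      then obtain k r where kr: "k \<in> K" "r \<in> carrier R" "e = k \<boxplus> r \<cdot> ?d" using el by blast
      have kc: "k \<in> carrier M" using kr Kc by auto
      have "r \<notin> p"
      proof
        assume "r \<in> p"
        hence "r \<cdot> ?d \<in> K" using uniformizer_kills[OF pK d dK] by simp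
        hence "e \<in> K" using kr K(1) submoduleE(5) by metis
        thus False using K by simp
      qed
      have "(\<one> \<ominus> r) \<cdot> e \<boxplus> r \<cdot> f = k"
      proof -
        have "e \<boxminus> r \<cdot> ?d = k" using kr kc d add_diff[of k "r \<cdot> ?d"] by simp
        moreover have "e \<boxminus> r \<cdot> ?d = (e \<boxminus> r \<cdot> e) \<boxplus> r \<cdot> f"
          using e(1) f(1) kr(2) by (simp add: M.minus_eq smult_r_distr smult_r_minus M.minus_add M.a_assoc)
        ultimately show ?thesis using e kr(2) by (simp add: smult_diff_l)
      qed
      note eq = this
      have rc: "\<one> \<ominus> r \<in> carrier R" using kr by simp
      show False
      proof (cases "\<one> \<ominus> r \<in> p")
        case True
        have "(\<one> \<ominus> r) \<cdot> e \<in> K" using uniformizer_kills[OF pK e(1) eK True] .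
        moreover have "r \<cdot> f \<boxplus> (\<one> \<ominus> r) \<cdot> e \<in> K"
          using eq kr e f rc by (simp add: M.a_comm)
        ultimately have "r \<cdot> f \<in> K" using submod_add_cancel[OF K(1)] f kr by blast
        hence "f \<in> K" using primary_saturated[OF p pK f(1)] kr \<open>r \<notin> p\<close> by simp
        thus False using f by simp
      next
        case F: False
        have "\<one> \<ominus> r \<in> carrier R - p" using F rc by simp
        then obtain t where t: "t \<in> carrier R" "(\<one> \<ominus> t \<otimes> (\<one> \<ominus> r)) \<cdot> e \<in> K"
          by (rule primary_inverse[OF p pK e(1)])
        let ?w = "(\<one> \<ominus> t \<otimes> (\<one> \<ominus> r)) \<cdot> e"
        have wc: "?w \<in> carrier M" using t e rc by simp
        have e1: "e = ?w \<boxplus> t \<cdot> ((\<one> \<ominus> r) \<cdot> e)"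
          using diff_add[of e "t \<cdot> ((\<one> \<ominus> r) \<cdot> e)"] t e rc by (simp add: smult_diff_l smult_assoc1)
        have e2: "(\<one> \<ominus> r) \<cdot> e = k \<boxminus> r \<cdot> f"
          using eq add_diff[of "(\<one> \<ominus> r) \<cdot> e" "r \<cdot> f"] rc e f kr by simp
        have "t \<cdot> (k \<boxminus> r \<cdot> f) = t \<cdot> k \<boxplus> (\<ominus> (t \<otimes> r)) \<cdot> f"
          using t(1) kc f(1) kr(2) by (simp add: M.minus_eq smult_r_distr smult_r_minus smult_l_minus smult_assoc1)
        hence "e = (?w \<boxplus> t \<cdot> k) \<boxplus> (\<ominus> (t \<otimes> r)) \<cdot> f"
          using e1 e2 wc t(1) kc f(1) kr(2) by (simp add: M.a_assoc)
        moreover have "?w \<boxplus> t \<cdot> k \<in> K" using t kr K(1) submoduleE(4,5) by simp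
        moreover have "\<ominus> (t \<otimes> r) \<in> carrier R" using t kr by simp
        ultimately show False using False by blast
      qed
    qed
    moreover have "e \<boxminus> (\<pi> [^] n) \<cdot> y \<in> ?K'" using y span_base[of ?d "insert ?d K"] by simp
    moreover have "K \<subseteq> ?K'" using span_superset[of "insert ?d K"] by auto
    ultimately show ?thesis using sK' y by (intro exI[of _ ?K']) blast
  qed
qed

text \<open>
  Every nonzero submodule of \<open>M / L\<close> contains \<open>e\<close>. So if \<open>\<pi>\<^sup>m\<close> is the first power to kill \<open>x\<close>, then
  \<open>\<pi>\<^sup>m\<^sup>-\<^sup>1 x\<close> is a multiple of \<open>e = \<pi>\<^sup>i y\<close>, and subtracting a multiple of \<open>\<pi> y\<close> from \<open>x\<close>
  lowers \<open>m\<close>.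
\<close>
lemma divisible_of_infinite_height:
  assumes L: "primary_mod p L" and e: "e \<in> carrier M" "e \<notin> L"
    and max: "\<And>x. x \<in> carrier M \<Longrightarrow> x \<notin> L \<Longrightarrow> \<exists>l \<in> L. \<exists>r \<in> carrier R. e = l \<boxplus> r \<cdot> x"
    and y: "y \<in> carrier M" "e \<boxminus> (\<pi> [^] (i::nat)) \<cdot> y \<in> L"
    and x: "x \<in> carrier M" "(\<pi> [^] (m::nat)) \<cdot> x \<in> L" "m \<le> i"
  shows "\<exists>z \<in> carrier M. x \<boxminus> \<pi> \<cdot> z \<in> L"
  using x
proof (induction m arbitrary: x)
  case 0
  have "x \<boxminus> \<pi> \<cdot> \<zero>\<^bsub>M\<^esub> = x" using 0(1) add_diff[of x "\<zero>\<^bsub>M\<^esub>"] by simp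
  thus ?case using 0 by (intro bexI[of _ "\<zero>\<^bsub>M\<^esub>"]) simp_all
next
  case (Suc m)
  have sL: "submod L" using L by (simp add: primary_mod_def)
  have xc: "x \<in> carrier M" using Suc.prems by simp
  let ?q = "(\<pi> [^] m) \<cdot> x"
  have qc: "?q \<in> carrier M" using xc by simp
  show ?case
  proof (cases "?q \<in> L")
    case True
    thus ?thesis using Suc by simp
  next
    case False
    obtain l r where lr: "l \<in> L" "r \<in> carrier R" "e = l \<boxplus> r \<cdot> ?q" using max[OF qc False] by auto
    have lc: "l \<in> carrier M" using lr submod_carrier[OF sL] by simp
    have "\<pi> \<cdot> ?q \<in> L" using smult_power_Suc[OF xc, of m] Suc.prems by simp
    hence "r \<notin> p" using uniformizer_kills[OF L qc, of r] lr e sL submoduleE(5) by metis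
    then obtain t where t: "t \<in> carrier R" "(\<one> \<ominus> t \<otimes> r) \<cdot> ?q \<in> L"
      using primary_inverse[OF p L qc, of r] lr by auto
    have tr: "?q \<boxminus> t \<cdot> (r \<cdot> ?q) \<in> L"
      using t(2) t(1) lr(2) qc by (simp add: smult_diff_l smult_assoc1)
    have "r \<cdot> ?q \<boxminus> e \<in> L"
    proof -
      have "e \<boxminus> r \<cdot> ?q = l" using lr lc qc add_diff[of l "r \<cdot> ?q"] by simp
      thus ?thesis using submod_diff_swap[OF sL e(1), of "r \<cdot> ?q"] lr qc by simp
    qed
    hence "r \<cdot> ?q \<boxminus> (\<pi> [^] i) \<cdot> y \<in> L"
      using submod_diff_trans[OF sL _ e(1) _ _ y(2)] lr qc y by simp
    hence "t \<cdot> (r \<cdot> ?q \<boxminus> (\<pi> [^] i) \<cdot> y) \<in> L" using submoduleE(4)[OF sL t(1)] by simp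
    hence "t \<cdot> (r \<cdot> ?q) \<boxminus> t \<cdot> ((\<pi> [^] i) \<cdot> y) \<in> L"
      using t lr qc y by (simp add: smult_diff_r)
    hence q1: "?q \<boxminus> t \<cdot> ((\<pi> [^] i) \<cdot> y) \<in> L"
      using submod_diff_trans[OF sL qc _ _ tr] t lr qc y by simp
    define j where "j = i - Suc m"
    have ij: "i = m + Suc j" using Suc.prems by (simp add: j_def)
    let ?w = "(\<pi> [^] j) \<cdot> (t \<cdot> y)"
    have wc: "?w \<in> carrier M" using t y by simp
    have "t \<cdot> ((\<pi> [^] i) \<cdot> y) = (\<pi> [^] m) \<cdot> (\<pi> \<cdot> ?w)"
      using smult_commute[of t "\<pi> [^] i" y] t y smult_power_add[of "t \<cdot> y" m "Suc j"]
        smult_power_Suc[of "t \<cdot> y" j] ij by simp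
    hence "(\<pi> [^] m) \<cdot> (x \<boxminus> \<pi> \<cdot> ?w) \<in> L" using q1 xc wc by (simp add: smult_diff_r)
    then obtain z where z: "z \<in> carrier M" "(x \<boxminus> \<pi> \<cdot> ?w) \<boxminus> \<pi> \<cdot> z \<in> L"
      using Suc.IH[of "x \<boxminus> \<pi> \<cdot> ?w"] Suc.prems xc wc by auto
    hence "x \<boxminus> \<pi> \<cdot> (?w \<boxplus> z) \<in> L" using xc wc by (simp add: diff_diff smult_r_distr)
    thus ?thesis using z wc by (intro bexI[of _ "?w \<boxplus> z"]) auto
  qed
qed

text \<open>
  For unbounded \<open>M / N\<close>, raise the height of an element \<open>e\<close> that is killed by \<open>\<pi>\<close> again and again, and
  let \<open>L\<close> be maximal among the submodules which contain everything divided out and avoid \<open>e\<close>. Then \<open>e\<close>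
  has infinite height in \<open>M / L\<close>, so \<open>M / L\<close> is divisible and nonzero. This contradicts
  \<open>primary_supplement_trivial\<close>.
\<close>
lemma primary_bounded:
  assumes rwb: "rwb_mod N" and N: "primary_mod p N"
  shows "\<exists>k::nat. \<forall>x \<in> carrier M. (\<pi> [^] k) \<cdot> x \<in> N"
proof (rule ccontr)
  assume "\<not> ?thesis"
  hence unb: "\<exists>x \<in> carrier M. (\<pi> [^] k) \<cdot> x \<notin> N" for k :: nat by blast
  have sN: "submod N" using N by (simp add: primary_mod_def)
  obtain w where w: "w \<in> carrier M" "(\<pi> [^] (0::nat)) \<cdot> w \<notin> N" using unb by blast
  then obtain m where m: "0 \<le> m" "(\<pi> [^] m) \<cdot> w \<notin> N" "(\<pi> [^] Suc m) \<cdot> w \<in> N"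
    by (rule last_power_notin[OF N])
  define e where "e = (\<pi> [^] m) \<cdot> w"
  have e: "e \<in> carrier M" "\<pi> \<cdot> e \<in> N" "e \<notin> N"
    using m w smult_power_Suc[OF w(1), of m] by (auto simp: e_def)
  let ?P = "\<lambda>n K. submod K \<and> N \<subseteq> K \<and> e \<notin> K \<and> (\<exists>b::nat. \<forall>x \<in> K. (\<pi> [^] b) \<cdot> x \<in> N) \<and>
    (\<exists>y \<in> carrier M. e \<boxminus> (\<pi> [^] (n::nat)) \<cdot> y \<in> K)"
  have "\<exists>f. \<forall>n. ?P n (f n) \<and> f n \<subseteq> f (Suc n)"
  proof (rule dependent_nat_choice)
    have "\<forall>x \<in> N. (\<pi> [^] (0::nat)) \<cdot> x \<in> N" using submod_carrier[OF sN] by simp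
    moreover have "e \<boxminus> (\<pi> [^] (0::nat)) \<cdot> e \<in> N"
      using e submod_zero[OF sN] by (simp add: M.minus_eq M.r_neg)
    ultimately show "\<exists>K. ?P 0 K" using sN e by (intro exI[of _ N]) blast
  next
    fix K n assume P: "?P n K"
    then obtain b :: nat where b: "\<And>x. x \<in> K \<Longrightarrow> (\<pi> [^] b) \<cdot> x \<in> N" by blast
    have K: "submod K" "N \<subseteq> K" "e \<notin> K" using P by simp_all
    obtain K' where "submod K'" "K \<subseteq> K'" "e \<notin> K'" "\<exists>b::nat. \<forall>x \<in> K'. (\<pi> [^] b) \<cdot> x \<in> N"
      "\<exists>y \<in> carrier M. e \<boxminus> (\<pi> [^] Suc n) \<cdot> y \<in> K'"
      using raise_height[OF N unb e(1,2) K b, of "Suc n"] by blast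
    moreover from this K have "N \<subseteq> K'" by simp
    ultimately show "\<exists>K'. ?P (Suc n) K' \<and> K \<subseteq> K'" by (intro exI[of _ K'] conjI)
  qed
  then obtain f where f: "\<And>n. ?P n (f n)" "\<And>n. f n \<subseteq> f (Suc n)" by blast
  have "f i \<subseteq> f j \<or> f j \<subseteq> f i" for i j
    using lift_Suc_mono_le[of f, OF f(2)] by (meson linear)
  hence "subset.chain (Collect submod) (range f)" using f(1) by (auto simp: pred_on.chain_def)
  hence sU: "submod (\<Union>(range f))" by (intro submod_chain_Union) auto
  have eU: "e \<notin> \<Union>(range f)" using f(1) by auto
  obtain L where L: "submod L" "\<Union>(range f) \<subseteq> L" "e \<notin> L"
    and max: "\<And>x. x \<in> carrier M \<Longrightarrow> x \<notin> L \<Longrightarrow> \<exists>l \<in> L. \<exists>r \<in> carrier R. e = l \<boxplus> r \<cdot> x"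
    using maximal_submod_avoiding[OF sU e(1) eU] by blast
  have NL: "N \<subseteq> L" using L f(1)[of 0] by auto
  have pL: "primary_mod p L" by (rule primary_mod_mono[OF N L(1) NL])
  have "\<exists>z \<in> carrier M. x \<boxminus> \<pi> \<cdot> z \<in> L" if x: "x \<in> carrier M" for x
  proof -
    obtain i :: nat where i: "(\<pi> [^] i) \<cdot> x \<in> L" using pL x \<pi> unfolding primary_mod_def by blast
    obtain y where "y \<in> carrier M" "e \<boxminus> (\<pi> [^] i) \<cdot> y \<in> f i" using f(1)[of i] by auto
    moreover have "f i \<subseteq> L" using L(2) by auto
    ultimately show ?thesis
      using divisible_of_infinite_height[OF pL e(1) L(3) max _ _ x i, of y i] by auto
  qed
  hence "L = carrier M" by (rule primary_supplement_trivial[OF rwb N L(1) NL])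
  thus False using L e by simp
qed

end


section \<open>Torsion modules\<close>

context dedekind_module
begin

text \<open>
  For a torsion module \<open>M / K\<close>, these are the preimages in \<open>M\<close> of the kernel of \<open>M / K \<rightarrow> (M / K)\<^sub>p\<close> and of
  the \<open>p\<close>-primary part. The second condition says that \<open>x\<close> can be recovered modulo \<open>K\<close> from \<open>s x\<close>, for every
  \<open>s\<close> outside \<open>p\<close>; it avoids powers of \<open>p\<close>.
\<close>
definition local_kernel :: "'c set \<Rightarrow> 'a set \<Rightarrow> 'c set" where
  "local_kernel K p = {x \<in> carrier M. \<exists>s \<in> carrier R - p. s \<cdot> x \<in> K}"

definition primary_part :: "'c set \<Rightarrow> 'a set \<Rightarrow> 'c set" where
  "primary_part K p = {x \<in> carrier M. \<forall>s \<in> carrier R - p. \<exists>r \<in> carrier R. (\<one> \<ominus> r \<otimes> s) \<cdot> x \<in> K}"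

definition torsion_mod :: "'c set \<Rightarrow> bool" where
  "torsion_mod K \<longleftrightarrow> (\<forall>x \<in> carrier M. \<exists>c \<in> carrier R. c \<noteq> \<zero> \<and> c \<cdot> x \<in> K)"

lemma ideal_annihilator:
  assumes N: "submod N" and x: "x \<in> carrier M"
  shows "ideal {r \<in> carrier R. r \<cdot> x \<in> N} R"
proof (rule idealI_comm)
  show "{r \<in> carrier R. r \<cdot> x \<in> N} \<subseteq> carrier R" by auto
  show "\<zero> \<in> {r \<in> carrier R. r \<cdot> x \<in> N}" using x submod_zero[OF N] by simp
  fix a b assume "a \<in> {r \<in> carrier R. r \<cdot> x \<in> N}" "b \<in> {r \<in> carrier R. r \<cdot> x \<in> N}"
  thus "a \<oplus> b \<in> {r \<in> carrier R. r \<cdot> x \<in> N}" using x submoduleE(5)[OF N] by (simp add: smult_l_distr)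
next
  fix r a assume "r \<in> carrier R" "a \<in> {r \<in> carrier R. r \<cdot> x \<in> N}"
  thus "r \<otimes> a \<in> {r \<in> carrier R. r \<cdot> x \<in> N}" using x submoduleE(4)[OF N] by (simp add: smult_assoc1)
qed

lemma local_kernelI: "x \<in> carrier M \<Longrightarrow> s \<in> carrier R - p \<Longrightarrow> s \<cdot> x \<in> K \<Longrightarrow> x \<in> local_kernel K p"
  by (auto simp: local_kernel_def)

lemma local_kernelE:
  assumes "x \<in> local_kernel K p"
  obtains s where "x \<in> carrier M" "s \<in> carrier R - p" "s \<cdot> x \<in> K"
  using assms by (auto simp: local_kernel_def)

lemma primary_partE:
  assumes "x \<in> primary_part K p" "s \<in> carrier R - p"
  obtains r where "r \<in> carrier R" "(\<one> \<ominus> r \<otimes> s) \<cdot> x \<in> K"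
  using assms by (auto simp: primary_part_def)

lemma primary_part_carrier: "x \<in> primary_part K p \<Longrightarrow> x \<in> carrier M"
  by (auto simp: primary_part_def)

lemma submod_local_kernel:
  assumes p: "maximalideal p R" and K: "submod K"
  shows "submod (local_kernel K p)"
proof (rule submodI)
  show "local_kernel K p \<subseteq> carrier M" by (auto simp: local_kernel_def)
  show "\<zero>\<^bsub>M\<^esub> \<in> local_kernel K p"
    using maximal_one_notin[OF p] submod_zero[OF K] by (intro local_kernelI[of _ \<one>]) auto
next
  fix x y assume "x \<in> local_kernel K p"
  then obtain s where s: "x \<in> carrier M" "s \<in> carrier R - p" "s \<cdot> x \<in> K" by (rule local_kernelE)
  assume "y \<in> local_kernel K p"
  then obtain t where t: "y \<in> carrier M" "t \<in> carrier R - p" "t \<cdot> y \<in> K" by (rule local_kernelE)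
  have "(s \<otimes> t) \<cdot> (x \<boxplus> y) = t \<cdot> (s \<cdot> x) \<boxplus> s \<cdot> (t \<cdot> y)"
    using s t smult_commute[of t s x] by (simp add: smult_r_distr smult_assoc1)
  also have "\<dots> \<in> K" using s t submoduleE(4,5)[OF K] by simp
  finally show "x \<boxplus> y \<in> local_kernel K p"
    using s t maximal_mult_notin[OF p s(2) t(2)] by (intro local_kernelI[of _ "s \<otimes> t"]) simp_all
next
  fix r x assume r: "r \<in> carrier R" and "x \<in> local_kernel K p"
  then obtain s where s: "x \<in> carrier M" "s \<in> carrier R - p" "s \<cdot> x \<in> K" by (auto elim: local_kernelE)
  have "s \<cdot> (r \<cdot> x) = r \<cdot> (s \<cdot> x)" using s r smult_commute[of s r x] by simp
  thus "r \<cdot> x \<in> local_kernel K p" using s r submoduleE(4)[OF K r s(3)] by (intro local_kernelI[of _ s]) simp_all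
qed

lemma submod_primary_part:
  assumes p: "maximalideal p R" and K: "submod K"
  shows "submod (primary_part K p)"
proof (rule submodI)
  show "primary_part K p \<subseteq> carrier M" by (auto simp: primary_part_def)
  show "\<zero>\<^bsub>M\<^esub> \<in> primary_part K p"
    using submod_zero[OF K] unfolding primary_part_def by (auto intro!: bexI[of _ \<zero>])
next
  fix x y assume x: "x \<in> primary_part K p" and y: "y \<in> primary_part K p"
  have xc: "x \<in> carrier M" and yc: "y \<in> carrier M" using primary_part_carrier x y by auto
  have "\<exists>r \<in> carrier R. (\<one> \<ominus> r \<otimes> s) \<cdot> (x \<boxplus> y) \<in> K" if s: "s \<in> carrier R - p" for s
  proof -
    obtain r where r: "r \<in> carrier R" "(\<one> \<ominus> r \<otimes> s) \<cdot> x \<in> K" by (rule primary_partE[OF x s])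
    obtain t where t: "t \<in> carrier R" "(\<one> \<ominus> t \<otimes> s) \<cdot> y \<in> K" by (rule primary_partE[OF y s])
    let ?u = "\<one> \<ominus> r \<otimes> s" and ?v = "\<one> \<ominus> t \<otimes> s" and ?q = "r \<oplus> t \<ominus> r \<otimes> s \<otimes> t"
    have sR: "s \<in> carrier R" using s by simp
    have uv: "?u \<in> carrier R" "?v \<in> carrier R" "?q \<in> carrier R" using r t sR by simp_all
    have "\<one> \<ominus> ?q \<otimes> s = ?v \<otimes> ?u" using r(1) t(1) sR by algebra
    moreover have "(?v \<otimes> ?u) \<cdot> (x \<boxplus> y) = ?v \<cdot> (?u \<cdot> x) \<boxplus> ?u \<cdot> (?v \<cdot> y)"
      using uv xc yc smult_commute[OF uv(1,2) yc] by (simp only: smult_r_distr smult_assoc1 R.m_closed M.add.m_closed smult_closed)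
    moreover have "\<dots> \<in> K" using r t uv submoduleE(4,5)[OF K] by (simp only:)
    ultimately show ?thesis using uv(3) by (intro bexI[of _ ?q]) simp_all
  qed
  thus "x \<boxplus> y \<in> primary_part K p" using xc yc by (simp add: primary_part_def)
next
  fix a x assume a: "a \<in> carrier R" and x: "x \<in> primary_part K p"
  have xc: "x \<in> carrier M" using primary_part_carrier[OF x] .
  have "\<exists>r \<in> carrier R. (\<one> \<ominus> r \<otimes> s) \<cdot> (a \<cdot> x) \<in> K" if s: "s \<in> carrier R - p" for s
  proof -
    obtain r where r: "r \<in> carrier R" "(\<one> \<ominus> r \<otimes> s) \<cdot> x \<in> K" by (rule primary_partE[OF x s])
    have "(\<one> \<ominus> r \<otimes> s) \<cdot> (a \<cdot> x) = a \<cdot> ((\<one> \<ominus> r \<otimes> s) \<cdot> x)"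
      using r(1) s a xc smult_commute[of "\<one> \<ominus> r \<otimes> s" a x] by simp
    thus ?thesis using r submoduleE(4)[OF K a r(2)] by (intro bexI[of _ r]) simp_all
  qed
  thus "a \<cdot> x \<in> primary_part K p" using xc a by (simp add: primary_part_def)
qed

lemma power_notin:
  assumes p: "maximalideal p R" and s: "s \<in> carrier R - p"
  shows "s [^] (k::nat) \<in> carrier R - p"
  by (induction k) (use maximal_one_notin[OF p] maximal_mult_notin[OF p _ s] in auto)

text \<open>If \<open>c x \<in> K\<close> and \<open>c\<close> is locally associated to \<open>\<pi>\<^sup>k\<close>, then \<open>\<pi>\<^sup>k\<close>, and with it the \<open>k\<close>-th power of every
  element of \<open>p\<close>, kills \<open>x\<close> in the localisation.\<close>
lemma primary_local_kernel:
  assumes p: "maximalideal p R" and K: "submod K" and tor: "torsion_mod K"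
  shows "primary_mod p (local_kernel K p)"
  unfolding primary_mod_def
proof (intro conjI ballI)
  show "submod (local_kernel K p)" by (rule submod_local_kernel[OF p K])
  fix x a assume x: "x \<in> carrier M" and a: "a \<in> p"
  obtain c where c: "c \<in> carrier R" "c \<noteq> \<zero>" "c \<cdot> x \<in> K" using tor x by (auto simp: torsion_mod_def)
  obtain \<pi> s where \<pi>: "\<pi> \<in> p" "s \<in> carrier R - p" "\<forall>a \<in> p. \<exists>u \<in> carrier R. s \<otimes> a = u \<otimes> \<pi>"
    by (rule uniformizer[OF p])
  obtain k t u where t: "t \<in> carrier R - p" "u \<in> carrier R - p" "t \<otimes> c = u \<otimes> \<pi> [^] (k::nat)"
    by (rule local_valuation[OF p \<pi> c(1,2)])
  obtain v where v: "v \<in> carrier R" "s \<otimes> a = v \<otimes> \<pi>" using \<pi>(3) a by blast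
  have aR: "a \<in> carrier R" and \<pi>R: "\<pi> \<in> carrier R" and sR: "s \<in> carrier R" and tR: "t \<in> carrier R" and uR: "u \<in> carrier R"
    using a \<pi> t maximal_carrier[OF p] by auto
  have "s [^] k \<otimes> a [^] k = v [^] k \<otimes> \<pi> [^] k" using v aR sR \<pi>R by (simp add: R.nat_pow_distrib[symmetric])
  hence "(u \<otimes> s [^] k) \<otimes> a [^] k = v [^] k \<otimes> (u \<otimes> \<pi> [^] k)"
    using v(1) aR sR \<pi>R uR by (simp add: R.m_assoc R.m_lcomm)
  also have "\<dots> = (v [^] k \<otimes> t) \<otimes> c" using t(3)[symmetric] v(1) tR c(1) by (simp add: R.m_assoc)
  finally have "(u \<otimes> s [^] k) \<cdot> (a [^] k \<cdot> x) = (v [^] k \<otimes> t) \<cdot> (c \<cdot> x)"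
    using x v(1) aR sR uR tR c(1) smult_assoc1[of "u \<otimes> s [^] k" "a [^] k" x] smult_assoc1[of "v [^] k \<otimes> t" c x] by simp
  also have "\<dots> \<in> K" using c v(1) tR submoduleE(4)[OF K] by simp
  finally have "a [^] k \<cdot> x \<in> local_kernel K p"
    using maximal_mult_notin[OF p t(2) power_notin[OF p \<pi>(2), of k]] aR x
    by (intro local_kernelI[of _ "u \<otimes> s [^] k"]) auto
  thus "\<exists>k::nat. a [^] k \<cdot> x \<in> local_kernel K p" by blast
qed

lemma subset_local_kernel:
  assumes p: "maximalideal p R" and K: "submod K"
  shows "K \<subseteq> local_kernel K p"
  using submod_carrier[OF K] maximal_one_notin[OF p] by (auto intro!: local_kernelI[of _ \<one>])

lemma subset_primary_part:
  assumes K: "submod K"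
  shows "K \<subseteq> primary_part K p"
proof
  fix x assume x: "x \<in> K"
  hence "(\<one> \<ominus> \<zero> \<otimes> s) \<cdot> x \<in> K" if "s \<in> carrier R - p" for s
    using that by (intro submoduleE(4)[OF K]) auto
  hence "\<exists>r \<in> carrier R. (\<one> \<ominus> r \<otimes> s) \<cdot> x \<in> K" if "s \<in> carrier R - p" for s
    using that R.zero_closed by blast
  thus "x \<in> primary_part K p" using submod_carrier[OF K x] by (simp add: primary_part_def)
qed

lemma primary_decomposition:
  assumes p: "maximalideal p R" and K: "submod K" and tor: "torsion_mod K" and x: "x \<in> carrier M"
  shows "\<exists>y \<in> primary_part K p. x \<boxminus> y \<in> local_kernel K p"
proof -
  let ?N = "local_kernel K p"
  have N: "primary_mod p ?N" by (rule primary_local_kernel[OF p K tor])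
  have sN: "submod ?N" using N by (simp add: primary_mod_def)
  \<comment> \<open>The annihilator of \<open>x\<close> modulo the local kernel is finitely generated, so one \<open>s\<close> outside \<open>p\<close> carries
    it into the annihilator modulo \<open>K\<close>. Then \<open>s x\<close> lies in the primary part, and \<open>s\<close> has an inverse \<open>r\<close>
    on \<open>x\<close> modulo the local kernel.\<close>
  have "\<exists>s \<in> carrier R - p. s \<otimes> a \<in> {r \<in> carrier R. r \<cdot> x \<in> K}"
    if "a \<in> {r \<in> carrier R. r \<cdot> x \<in> ?N}" for a
  proof -
    have a: "a \<in> carrier R" "a \<cdot> x \<in> ?N" using that by auto
    from a(2) obtain s where s: "s \<in> carrier R - p" "s \<cdot> (a \<cdot> x) \<in> K" by (rule local_kernelE)
    thus ?thesis using a x by (intro bexI[of _ s]) (simp_all add: smult_assoc1)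
  qed
  then obtain s where s: "s \<in> carrier R - p"
    "\<forall>a \<in> {r \<in> carrier R. r \<cdot> x \<in> ?N}. s \<otimes> a \<in> {r \<in> carrier R. r \<cdot> x \<in> K}"
    by (rule uniform_denominator[OF p ideal_annihilator[OF sN x] ideal_annihilator[OF K x]])
  obtain r where r: "r \<in> carrier R" "(\<one> \<ominus> r \<otimes> s) \<cdot> x \<in> ?N" by (rule primary_inverse[OF p N x s(1)])
  have sR: "s \<in> carrier R" using s by simp
  let ?y = "(r \<otimes> s) \<cdot> x"
  have "\<exists>t \<in> carrier R. (\<one> \<ominus> t \<otimes> q) \<cdot> ?y \<in> K" if q: "q \<in> carrier R - p" for q
  proof -
    obtain t where t: "t \<in> carrier R" "(\<one> \<ominus> t \<otimes> q) \<cdot> x \<in> ?N" by (rule primary_inverse[OF p N x q])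
    let ?a = "\<one> \<ominus> t \<otimes> q"
    have aR: "?a \<in> carrier R" using t q by simp
    have "(s \<otimes> ?a) \<cdot> x \<in> K" using s(2) t aR by simp
    hence "r \<cdot> ((s \<otimes> ?a) \<cdot> x) \<in> K" using submoduleE(4)[OF K r(1)] by simp
    moreover have "?a \<cdot> ?y = r \<cdot> ((s \<otimes> ?a) \<cdot> x)"
    proof -
      have "?a \<cdot> ?y = (?a \<otimes> (r \<otimes> s)) \<cdot> x" using aR r(1) sR x smult_assoc1[of ?a "r \<otimes> s" x] by simp
      also have "?a \<otimes> (r \<otimes> s) = r \<otimes> (s \<otimes> ?a)" using aR r(1) sR by (simp only: R.m_ac R.m_closed)
      also have "\<dots> \<cdot> x = r \<cdot> ((s \<otimes> ?a) \<cdot> x)" using aR r(1) sR x smult_assoc1[of r "s \<otimes> ?a" x] by simp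
      finally show ?thesis .
    qed
    ultimately show ?thesis using t(1) by (intro bexI[of _ t]) simp_all
  qed
  hence "?y \<in> primary_part K p" using r sR x by (simp add: primary_part_def)
  moreover have "x \<boxminus> ?y \<in> ?N" using r sR x by (simp add: smult_diff_l)
  ultimately show ?thesis by blast
qed

lemma rwb_mod_local_kernel:
  assumes rwb: "rwb_mod K" and p: "maximalideal p R" and K: "submod K" and tor: "torsion_mod K"
  shows "rwb_mod (local_kernel K p)"
proof (rule rwb_mod_complement[OF rwb K submod_primary_part[OF p K] subset_primary_part[OF K]
      submod_local_kernel[OF p K] subset_local_kernel[OF p K]])
  show "primary_part K p \<inter> local_kernel K p \<subseteq> K"
  proof
    fix x assume x: "x \<in> primary_part K p \<inter> local_kernel K p"
    then obtain s where s: "x \<in> carrier M" "s \<in> carrier R - p" "s \<cdot> x \<in> K" by (auto elim: local_kernelE)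
    obtain r where "r \<in> carrier R" "(\<one> \<ominus> r \<otimes> s) \<cdot> x \<in> K" using x s(2) by (auto elim: primary_partE)
    thus "x \<in> K" using submod_comaximal[OF K s(1), of r s] s by simp
  qed
qed (rule primary_decomposition[OF p K tor])

lemma distinct_maximal:
  assumes p: "maximalideal p R" and q: "maximalideal q R" and "p \<noteq> q"
  obtains s where "s \<in> q" "s \<in> carrier R - p"
proof -
  have "\<not> q \<subseteq> p"
    using maximalideal.I_maximal[OF q maximal_ideal[OF p]] maximal_carrier[OF p] maximalideal.I_notcarr[OF p] assms(3)
    by blast
  thus ?thesis using that maximal_carrier[OF q] by blast
qed

lemma primary_part_in_local_kernel:
  assumes p: "maximalideal p R" and q: "maximalideal q R" and "p \<noteq> q"
    and x: "x \<in> primary_part K p"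
  shows "x \<in> local_kernel K q"
proof -
  obtain s where s: "s \<in> q" "s \<in> carrier R - p" by (rule distinct_maximal[OF assms(1-3)])
  obtain r where r: "r \<in> carrier R" "(\<one> \<ominus> r \<otimes> s) \<cdot> x \<in> K" by (rule primary_partE[OF x s(2)])
  have "r \<otimes> s \<in> q" using maximal_mult_in(1)[OF q s(1) r(1)] .
  thus ?thesis using one_minus_notin[OF q] r primary_part_carrier[OF x] by (intro local_kernelI) auto
qed

text \<open>
  By \<open>primary_supplement_trivial\<close> the \<open>p\<close>-multiples together with the local kernel do not exhaust \<open>M\<close>. A
  submodule that contains them and is maximal with respect to avoiding some \<open>e\<close> in the primary part is
  even a maximal submodule, because \<open>R / p\<close> is a field.
\<close>
lemma primary_part_maximal_submod:
  assumes rwb: "rwb_mod K" and p: "maximalideal p R" and K: "submod K" and tor: "torsion_mod K"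
    and ne: "local_kernel K p \<noteq> carrier M"
  shows "\<exists>e L. e \<in> primary_part K p \<and> submod L \<and> local_kernel K p \<subseteq> L \<and> e \<notin> L \<and>
    (\<forall>z \<in> carrier M. \<exists>r \<in> carrier R. z \<boxminus> r \<cdot> e \<in> L)"
proof -
  let ?N = "local_kernel K p"
  have N: "primary_mod p ?N" by (rule primary_local_kernel[OF p K tor])
  have sN: "submod ?N" using N by (simp add: primary_mod_def)
  obtain \<pi> s where \<pi>: "\<pi> \<in> p" "s \<in> carrier R - p" "\<forall>a \<in> p. \<exists>u \<in> carrier R. s \<otimes> a = u \<otimes> \<pi>"
    by (rule uniformizer[OF p])
  interpret at: dedekind_module_at R M p \<pi> s
    by (intro dedekind_module_at.intro dedekind_module_axioms dedekind_module_at_axioms.intro p \<pi>)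
  have "\<exists>x \<in> carrier M. \<forall>y \<in> carrier M. x \<boxminus> \<pi> \<cdot> y \<notin> ?N"
  proof (rule ccontr)
    assume "\<not> ?thesis"
    hence "\<exists>y \<in> carrier M. x \<boxminus> \<pi> \<cdot> y \<in> ?N" if "x \<in> carrier M" for x using that by blast
    hence "?N = carrier M"
      by (rule at.primary_supplement_trivial[OF rwb_mod_local_kernel[OF rwb p K tor] N sN subset_refl])
    thus False using ne by simp
  qed
  then obtain x where x: "x \<in> carrier M" "\<And>y. y \<in> carrier M \<Longrightarrow> x \<boxminus> \<pi> \<cdot> y \<notin> ?N" by blast
  let ?P = "{\<pi> \<cdot> y | y. y \<in> carrier M}"
  have sP: "submod ?P" by (rule submod_smult_image) simp
  have NPc: "?N \<union> ?P \<subseteq> carrier M" using submoduleE(1)[OF sN] submoduleE(1)[OF sP] by auto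
  define W where "W = span (?N \<union> ?P)"
  have sW: "submod W" unfolding W_def by (rule submod_span[OF NPc])
  have NW: "?N \<subseteq> W" and PW: "?P \<subseteq> W" unfolding W_def using span_superset[of "?N \<union> ?P"] by auto
  have xW: "x \<notin> W"
  proof
    assume "x \<in> W"
    then obtain n q where nq: "n \<in> ?N" "q \<in> ?P" "x = n \<boxplus> q" unfolding W_def by (rule span_Un_submods[OF sN sP])
    obtain y where y: "y \<in> carrier M" "q = \<pi> \<cdot> y" using nq(2) by auto
    have "x \<boxminus> \<pi> \<cdot> y = n" using nq y submod_carrier[OF sN nq(1)] add_diff[of n q] by simp
    thus False using x(2)[OF y(1)] nq by simp
  qed
  obtain e where e: "e \<in> primary_part K p" "x \<boxminus> e \<in> ?N" using primary_decomposition[OF p K tor x(1)] by auto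
  have ec: "e \<in> carrier M" using primary_part_carrier[OF e(1)] .
  have eW: "e \<notin> W" using submod_diff_cancel[OF sW x(1), of e] xW e(2) NW by auto
  obtain L where L: "submod L" "W \<subseteq> L" "e \<notin> L"
    and max: "\<And>x. x \<in> carrier M \<Longrightarrow> x \<notin> L \<Longrightarrow> \<exists>l \<in> L. \<exists>r \<in> carrier R. e = l \<boxplus> r \<cdot> x"
    using maximal_submod_avoiding[OF sW ec eW] by blast
  have pL: "primary_mod p L" using primary_mod_mono[OF N L(1)] NW L(2) by auto
  have "\<exists>r \<in> carrier R. z \<boxminus> r \<cdot> e \<in> L" if z: "z \<in> carrier M" for z
  proof (cases "z \<in> L")
    case True
    have "z \<boxminus> \<zero> \<cdot> e = z" using z ec add_diff[of z "\<zero>\<^bsub>M\<^esub>"] by simp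
    thus ?thesis using True by (intro bexI[of _ \<zero>]) simp_all
  next
    case False
    obtain l r where lr: "l \<in> L" "r \<in> carrier R" "e = l \<boxplus> r \<cdot> z" using max[OF z False] by auto
    have lc: "l \<in> carrier M" using submod_carrier[OF L(1) lr(1)] .
    have "\<pi> \<cdot> z \<in> L" using PW L(2) z by auto
    hence "r \<notin> p" using at.uniformizer_kills[OF pL z, of r] lr L submoduleE(5)[OF L(1)] by metis
    hence "r \<in> carrier R - p" using lr by simp
    then obtain t where t: "t \<in> carrier R" "(\<one> \<ominus> t \<otimes> r) \<cdot> z \<in> L" by (rule primary_inverse[OF p pL z])
    have "z \<boxminus> t \<cdot> e = (\<one> \<ominus> t \<otimes> r) \<cdot> z \<boxminus> t \<cdot> l"
      using t(1) lr(2) lc z unfolding lr(3)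
      by (simp add: smult_diff_l smult_r_distr smult_assoc1 M.minus_eq M.minus_add M.a_ac)
    also have "\<dots> \<in> L" using submod_diff[OF L(1) t(2)] submoduleE(4)[OF L(1) t(1) lr(1)] by simp
    finally show ?thesis using t by blast
  qed
  thus ?thesis using e L NW by (intro exI[of _ e] exI[of _ L]) auto
qed

text \<open>
  Given infinitely many nonzero components, pick \<open>e\<^sub>n\<close> in the component for the \<open>n\<close>-th maximal ideal and
  outside a maximal submodule \<open>L\<^sub>n\<close> that contains the other components, and
  replace the \<open>e\<^sub>n\<close> by the sums \<open>u\<^sub>n = e\<^sub>0 + \<dots> + e\<^sub>n\<close>. By the Chinese
  remainder theorem \<open>u\<^sub>n\<close> generates all \<open>u\<^sub>m\<close> with \<open>m \<le> n\<close>. The intersection of the \<open>L\<^sub>n\<close> and the \<open>u\<^sub>n\<close>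
  generate \<open>M\<close>; a weak basis among them contains at most one \<open>u\<^sub>n\<close>, but finitely many are not enough.
\<close>
lemma finitely_many_primary_parts:
  assumes rwb: "rwb_mod K" and K: "submod K" and tor: "torsion_mod K"
  shows "finite {p. maximalideal p R \<and> local_kernel K p \<noteq> carrier M}"
proof (rule ccontr)
  assume "infinite {p. maximalideal p R \<and> local_kernel K p \<noteq> carrier M}"
  then obtain q :: "nat \<Rightarrow> 'a set" where q: "inj q" "range q \<subseteq> {p. maximalideal p R \<and> local_kernel K p \<noteq> carrier M}"
    using infinite_countable_subset by meson
  have qm: "maximalideal (q n) R" and qn: "local_kernel K (q n) \<noteq> carrier M" for n using q(2) by auto
  have "\<forall>n. \<exists>e L. e \<in> primary_part K (q n) \<and> submod L \<and> local_kernel K (q n) \<subseteq> L \<and> e \<notin> L \<and>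
    (\<forall>z \<in> carrier M. \<exists>r \<in> carrier R. z \<boxminus> r \<cdot> e \<in> L)"
    using primary_part_maximal_submod[OF rwb qm K tor qn] by blast
  then obtain e L where eL: "\<And>n. e n \<in> primary_part K (q n) \<and> submod (L n) \<and> local_kernel K (q n) \<subseteq> L n \<and>
      e n \<notin> L n \<and> (\<forall>z \<in> carrier M. \<exists>r \<in> carrier R. z \<boxminus> r \<cdot> e n \<in> L n)"
    by metis
  have e: "e n \<in> primary_part K (q n)" and sL: "submod (L n)" and NL: "local_kernel K (q n) \<subseteq> L n"
    and enL: "e n \<notin> L n" for n using eL[of n] by simp_all
  have top: "\<exists>r \<in> carrier R. z \<boxminus> r \<cdot> e n \<in> L n" if "z \<in> carrier M" for z n
    using eL[of n] that by simp
  have ec: "e n \<in> carrier M" for n using primary_part_carrier[OF e] .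
  have eN: "e m \<in> local_kernel K (q n)" if "m \<noteq> n" for m n
    using primary_part_in_local_kernel[OF qm qm _ e] q(1) that by (metis injD)
  have eLm: "e m \<in> L n" if "m \<noteq> n" for m n using eN[OF that] NL by blast
  have KL: "K \<subseteq> L n" for n using subset_local_kernel[OF qm K] NL by blast
  have Kc: "K \<subseteq> carrier M" using submoduleE(1)[OF K] .
  define u where "u = rec_nat (e 0) (\<lambda>n x. x \<boxplus> e (Suc n))"
  have u0: "u 0 = e 0" and uS: "u (Suc n) = u n \<boxplus> e (Suc n)" for n by (simp_all add: u_def)
  have uc: "u n \<in> carrier M" for n by (induction n) (simp_all add: u0 uS ec)
  have ule: "u n \<in> N" if "submod N" "\<And>i. i \<le> n \<Longrightarrow> e i \<in> N" for N n
    using that(2)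
  proof (induction n)
    case (Suc n)
    thus ?case using submoduleE(5)[OF that(1)] by (simp add: uS)
  qed (simp add: u0)
  have eu: "e i \<in> span (insert (u n) K)" if "i \<le> n" for i n
    using that
  proof (induction n arbitrary: i)
    case 0
    thus ?case by (simp add: u0 span_base)
  next
    case (Suc n)
    let ?S = "span (insert (u (Suc n)) K)"
    have sS: "submod ?S" using Kc uc by (intro submod_span) auto
    have KS: "K \<subseteq> ?S" and wS: "u (Suc n) \<in> ?S" using span_superset[of "insert (u (Suc n)) K"] by auto
    have "u n \<in> local_kernel K (q (Suc n))"
      by (rule ule[OF submod_local_kernel[OF qm K]]) (use eN in auto)
    then obtain t where t: "t \<in> carrier R - q (Suc n)" "t \<cdot> u n \<in> K" by (rule local_kernelE)
    obtain r where r: "r \<in> carrier R" "(\<one> \<ominus> r \<otimes> t) \<cdot> e (Suc n) \<in> K" by (rule primary_partE[OF e t(1)])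
    have "t \<cdot> e (Suc n) \<boxplus> t \<cdot> u n \<in> ?S"
    proof -
      have "t \<cdot> u (Suc n) \<in> ?S" using t submoduleE(4)[OF sS _ wS] by simp
      moreover have "t \<cdot> u (Suc n) = t \<cdot> e (Suc n) \<boxplus> t \<cdot> u n"
        using t uc ec by (simp add: uS smult_r_distr M.a_comm)
      ultimately show ?thesis by simp
    qed
    hence "t \<cdot> e (Suc n) \<in> ?S" using submod_add_cancel[OF sS] t KS ec by blast
    hence eS: "e (Suc n) \<in> ?S" using submod_comaximal[OF sS ec r(1), of t] r(2) t(1) KS by blast
    have "u n \<in> ?S" using submod_add_cancel[OF sS uc eS, of n] wS by (simp add: uS)
    hence "span (insert (u n) K) \<subseteq> ?S" using KS by (intro span_least[OF sS]) auto
    thus ?case using Suc eS by (cases "i = Suc n") auto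
  qed
  let ?X = "(\<Inter>n. L n) \<union> range u"
  have sI: "submod (\<Inter>n. L n)" by (rule submod_Inter) (use sL in auto)
  have Xc: "?X \<subseteq> carrier M" using submoduleE(1)[OF sI] uc by auto
  have "span (K \<union> ?X) = carrier M"
  proof (rule equalityI)
    show "span (K \<union> ?X) \<subseteq> carrier M" using Kc Xc by (intro span_carrier) auto
    show "carrier M \<subseteq> span (K \<union> ?X)"
    proof
      fix x assume x: "x \<in> carrier M"
      \<comment> \<open>\<open>x\<close> lies in all but finitely many \<open>L m\<close>: the ideals \<open>I n\<close> of those \<open>r\<close> with \<open>r x \<in> L m\<close> for all
        \<open>m \<ge> n\<close> become stationary, and no maximal ideal contains all of them.\<close>
      define I where "I = (\<lambda>n. {r \<in> carrier R. r \<cdot> x \<in> (\<Inter>m \<in> {n..}. L m)})"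
      have "ideal (I n) R" for n
        unfolding I_def by (rule ideal_annihilator[OF submod_Inter x]) (use sL in auto)
      moreover have "I n \<subseteq> I (Suc n)" for n by (auto simp: I_def)
      ultimately obtain N where N: "\<And>n. I n \<subseteq> I N" using ascending_ideals_stabilize[of I] by blast
      have "\<one> \<in> I N"
      proof (rule ccontr)
        assume "\<one> \<notin> I N"
        then obtain p where p: "maximalideal p R" "I N \<subseteq> p"
          using proper_ideal_below_maximal \<open>\<And>n. ideal (I n) R\<close> by blast
        obtain n where n: "\<And>m. n \<le> m \<Longrightarrow> q m \<noteq> p"
        proof (cases "p \<in> range q")
          case True
          then obtain k where "p = q k" by auto
          hence "q m \<noteq> p" if "Suc k \<le> m" for m using injD[OF q(1), of m k] that by auto
          thus ?thesis using that by blast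
        next
          case False
          thus ?thesis using that by blast
        qed
        obtain y where y: "y \<in> primary_part K p" "x \<boxminus> y \<in> local_kernel K p"
          using primary_decomposition[OF p(1) K tor x] by auto
        have yc: "y \<in> carrier M" using primary_part_carrier[OF y(1)] .
        from y(2) obtain s where s: "s \<in> carrier R - p" "s \<cdot> (x \<boxminus> y) \<in> K" by (rule local_kernelE)
        have "s \<cdot> x \<in> L m" if m: "n \<le> m" for m
        proof -
          have "y \<in> local_kernel K (q m)"
            using primary_part_in_local_kernel[OF p(1) qm _ y(1)] n[OF m] by metis
          hence "s \<cdot> y \<in> L m" using NL submoduleE(4)[OF sL] s by blast
          moreover have "s \<cdot> x \<boxminus> s \<cdot> y \<in> L m" using s x yc KL smult_diff_r[of s x y] by auto
          ultimately show ?thesis using submod_diff_cancel[OF sL] s x by blast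
        qed
        hence "s \<in> I n" using s by (simp add: I_def)
        thus False using N[of n] p(2) s by blast
      qed
      hence xL: "x \<in> L m" if "N \<le> m" for m using that x by (simp add: I_def)
      have "\<exists>y \<in> span (e ` {..<k}). \<forall>m < k. x \<boxminus> y \<in> L m" for k
      proof (induction k)
        case 0
        show ?case using submod_zero[OF submod_span[of "{}"]] by (intro bexI[of _ "\<zero>\<^bsub>M\<^esub>"]) auto
      next
        case (Suc k)
        then obtain y where y: "y \<in> span (e ` {..<k})" "\<And>m. m < k \<Longrightarrow> x \<boxminus> y \<in> L m" by blast
        have yc: "y \<in> carrier M" using y(1) span_carrier[of "e ` {..<k}"] ec by auto
        obtain r where r: "r \<in> carrier R" "(x \<boxminus> y) \<boxminus> r \<cdot> e k \<in> L k"
          using top[of "x \<boxminus> y" k] x yc by auto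
        let ?y = "y \<boxplus> r \<cdot> e k"
        have eq: "x \<boxminus> ?y = (x \<boxminus> y) \<boxminus> r \<cdot> e k" using x yc ec r by (simp add: diff_diff)
        have "x \<boxminus> ?y \<in> L m" if "m < Suc k" for m
        proof (cases "m = k")
          case True
          thus ?thesis using r eq by simp
        next
          case False
          hence "x \<boxminus> y \<in> L m" "r \<cdot> e k \<in> L m"
            using y(2)[of m] that submoduleE(4)[OF sL r(1) eLm[of k m]] by auto
          thus ?thesis unfolding eq by (rule submod_diff[OF sL])
        qed
        moreover have "?y \<in> span (e ` {..<Suc k})"
        proof -
          have sE: "submod (span (e ` {..<Suc k}))" using ec by (intro submod_span) auto
          have "e ` {..<k} \<subseteq> e ` {..<Suc k}" by (intro image_mono) auto
          hence "y \<in> span (e ` {..<Suc k})" using y(1) span_mono by blast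
          moreover have "e k \<in> span (e ` {..<Suc k})" by (rule span_base) auto
          ultimately show ?thesis using submoduleE(4,5)[OF sE] r(1) by simp
        qed
        ultimately show ?case by (intro bexI[of _ ?y]) simp_all
      qed
      from this[of N] obtain y where y: "y \<in> span (e ` {..<N})" "\<And>m. m < N \<Longrightarrow> x \<boxminus> y \<in> L m" by blast
      have "x \<boxminus> y \<in> L m" for m
      proof (cases "m < N")
        case True
        thus ?thesis using y by simp
      next
        case False
        hence "e ` {..<N} \<subseteq> L m" using eLm by auto
        hence "y \<in> L m" using y(1) span_least[OF sL] by blast
        thus ?thesis using xL[of m] False submod_diff[OF sL] by simp
      qed
      hence "x \<boxminus> y \<in> span (K \<union> ?X)" by (intro span_base) auto
      moreover have "y \<in> span (K \<union> ?X)"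
      proof -
        have "e i \<in> span (K \<union> ?X)" for i
          using eu[of i i] span_mono[of "insert (u i) K" "K \<union> ?X"] by auto
        hence "span (e ` {..<N}) \<subseteq> span (K \<union> ?X)" using Kc Xc by (intro span_least_span) auto
        thus ?thesis using y(1) by auto
      qed
      moreover have "submod (span (K \<union> ?X))" using Kc Xc by (intro submod_span) auto
      ultimately show "x \<in> span (K \<union> ?X)" using submod_diff_cancel[of "span (K \<union> ?X)" x y] x by simp
    qed
  qed
  then obtain Y where Y: "Y \<subseteq> ?X" "Y \<subseteq> carrier M" "span (K \<union> Y) = carrier M" "\<forall>y \<in> Y. y \<notin> span (K \<union> (Y - {y}))"
    by (rule rwb_modE[OF rwb Xc])
  show False
  proof (cases "finite (Y \<inter> range u)")
    case True
    then obtain F where F: "finite F" "Y \<inter> range u = u ` F"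
      using finite_subset_image[of "Y \<inter> range u" u UNIV] by auto
    then obtain N where N: "\<And>i. i \<in> F \<Longrightarrow> i < N" by (metis finite_nat_set_iff_bounded)
    have "u i \<in> L N" if "i < N" for i using that by (intro ule[OF sL] eLm) auto
    hence "Y \<inter> range u \<subseteq> L N" unfolding F(2) using N by auto
    moreover have "Y \<subseteq> L N \<union> Y \<inter> range u" using Y(1) by auto
    ultimately have "K \<union> Y \<subseteq> L N" using KL[of N] by auto
    hence "carrier M \<subseteq> L N" using span_least[OF sL] Y(3) by metis
    thus False using enL ec by blast
  next
    case False
    hence "Y \<inter> range u \<noteq> {}" by (metis finite.emptyI)
    then obtain m where m: "u m \<in> Y" by auto
    have "infinite (Y \<inter> range u - u ` {..m})" using False by (intro Diff_infinite_finite) auto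
    hence "Y \<inter> range u - u ` {..m} \<noteq> {}" by (metis finite.emptyI)
    then obtain n where n: "u n \<in> Y" "u n \<notin> u ` {..m}" by blast
    hence mn: "m \<le> n" "u n \<noteq> u m" using linorder_le_cases[of m n] by auto
    have "u m \<in> span (insert (u n) K)"
      using Kc uc mn(1) by (intro ule submod_span eu) auto
    moreover have "insert (u n) K \<subseteq> K \<union> (Y - {u m})" using n mn by auto
    ultimately have "u m \<in> span (K \<union> (Y - {u m}))" using span_mono by blast
    thus False using Y(4) m by blast
  qed
qed

text \<open>The product of the annihilators of the finitely many nonzero primary components works, since an
  element that vanishes in all localisations of \<open>M / K\<close> vanishes.\<close>
theorem torsion_bounded:
  assumes rwb: "rwb_mod K" and K: "submod K" and tor: "torsion_mod K"
  obtains c where "c \<in> carrier R" "c \<noteq> \<zero>" "\<forall>x \<in> carrier M. c \<cdot> x \<in> K"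
proof -
  let ?S = "{p. maximalideal p R \<and> local_kernel K p \<noteq> carrier M}"
  have each: "\<exists>c \<in> carrier R. c \<noteq> \<zero> \<and> (\<forall>x \<in> carrier M. c \<cdot> x \<in> local_kernel K p)"
    if p: "maximalideal p R" for p
  proof -
    obtain \<pi> s where \<pi>: "\<pi> \<in> p" "s \<in> carrier R - p" "\<forall>a \<in> p. \<exists>u \<in> carrier R. s \<otimes> a = u \<otimes> \<pi>"
      by (rule uniformizer[OF p])
    interpret at: dedekind_module_at R M p \<pi> s
    by (intro dedekind_module_at.intro dedekind_module_axioms dedekind_module_at_axioms.intro p \<pi>)
    obtain k :: nat where k: "\<forall>x \<in> carrier M. \<pi> [^] k \<cdot> x \<in> local_kernel K p"
      using at.primary_bounded[OF rwb_mod_local_kernel[OF rwb p K tor] primary_local_kernel[OF p K tor]] by blast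
    have "\<pi> \<noteq> \<zero>"
    proof
      assume z: "\<pi> = \<zero>"
      obtain a where a: "a \<in> p" "a \<noteq> \<zero>" by (rule maximal_nonzero[OF p])
      obtain v where "v \<in> carrier R" "s \<otimes> a = v \<otimes> \<pi>" using \<pi>(3) a(1) by blast
      hence "s \<otimes> a = \<zero>" using z by simp
      hence "s = \<zero>" using R.integral[of s a] a maximal_carrier[OF p a(1)] \<pi>(2) by auto
      thus False using \<pi> z by simp
    qed
    hence "\<pi> [^] k \<noteq> \<zero>" by (induction k) (simp_all add: R.integral_iff)
    thus ?thesis using k by (intro bexI[of _ "\<pi> [^] k"]) auto
  qed
  have "\<exists>c \<in> carrier R. c \<noteq> \<zero> \<and> (\<forall>p \<in> S. \<forall>x \<in> carrier M. c \<cdot> x \<in> local_kernel K p)"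
    if "finite S" "S \<subseteq> ?S" for S
    using that
  proof (induction S rule: finite_induct)
    case empty
    show ?case by (intro bexI[of _ \<one>]) auto
  next
    case (insert p S)
    then obtain c where c: "c \<in> carrier R" "c \<noteq> \<zero>" "\<forall>p \<in> S. \<forall>x \<in> carrier M. c \<cdot> x \<in> local_kernel K p" by auto
    have p: "maximalideal p R" using insert.prems by auto
    obtain d where d: "d \<in> carrier R" "d \<noteq> \<zero>" "\<forall>x \<in> carrier M. d \<cdot> x \<in> local_kernel K p" using each[OF p] by auto
    have "(c \<otimes> d) \<cdot> x \<in> local_kernel K r" if "x \<in> carrier M" "r \<in> insert p S" for x r
    proof -
      have "(c \<otimes> d) \<cdot> x = c \<cdot> (d \<cdot> x)" "d \<cdot> x \<in> carrier M" using c d that by (simp_all add: smult_assoc1)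
      thus ?thesis using c d that submoduleE(4)[OF submod_local_kernel[OF p K]] by auto
    qed
    moreover have "c \<otimes> d \<noteq> \<zero>" using c d by (simp add: R.integral_iff)
    ultimately show ?case using c d by (intro bexI[of _ "c \<otimes> d"]) auto
  qed
  then obtain c where c: "c \<in> carrier R" "c \<noteq> \<zero>" "\<forall>p \<in> ?S. \<forall>x \<in> carrier M. c \<cdot> x \<in> local_kernel K p"
    using finitely_many_primary_parts[OF rwb K tor] by blast
  have "c \<cdot> x \<in> K" if x: "x \<in> carrier M" for x
  proof (rule ccontr)
    assume n: "c \<cdot> x \<notin> K"
    let ?I = "{r \<in> carrier R. r \<cdot> (c \<cdot> x) \<in> K}"
    have cx: "c \<cdot> x \<in> carrier M" using c x by simp
    have "\<one> \<notin> ?I" using n cx by simp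
    then obtain p where p: "maximalideal p R" "?I \<subseteq> p"
      by (rule proper_ideal_below_maximal[OF ideal_annihilator[OF K cx]])
    have "c \<cdot> x \<in> local_kernel K p" using c(3) p(1) x cx by (cases "local_kernel K p = carrier M") auto
    then obtain s where "s \<in> carrier R - p" "s \<cdot> (c \<cdot> x) \<in> K" by (rule local_kernelE)
    thus False using p(2) by blast
  qed
  thus ?thesis using that c by blast
qed

end


section \<open>Finiteness of the rank\<close>

context dedekind_module
begin

definition independent :: "'c set \<Rightarrow> bool" where
  "independent G \<longleftrightarrow> G \<subseteq> carrier M \<and> (\<forall>g \<in> G. \<forall>r \<in> carrier R. r \<cdot> g \<in> span (G - {g}) \<longrightarrow> r = \<zero>)"

definition torsion_closure :: "'c set \<Rightarrow> 'c set" where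
  "torsion_closure N = {x \<in> carrier M. \<exists>c \<in> carrier R. c \<noteq> \<zero> \<and> c \<cdot> x \<in> N}"

lemma torsion_closureI:
  "x \<in> carrier M \<Longrightarrow> c \<in> carrier R \<Longrightarrow> c \<noteq> \<zero> \<Longrightarrow> c \<cdot> x \<in> N \<Longrightarrow> x \<in> torsion_closure N"
  by (auto simp: torsion_closure_def)

lemma torsion_closureE:
  assumes "x \<in> torsion_closure N"
  obtains c where "x \<in> carrier M" "c \<in> carrier R" "c \<noteq> \<zero>" "c \<cdot> x \<in> N"
  using assms by (auto simp: torsion_closure_def)

lemma torsion_closure_mono: "N \<subseteq> N' \<Longrightarrow> torsion_closure N \<subseteq> torsion_closure N'"
  by (auto simp: torsion_closure_def)

lemma subset_torsion_closure: "N \<subseteq> carrier M \<Longrightarrow> N \<subseteq> torsion_closure N"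
  by (auto intro!: torsion_closureI[of _ \<one>])

lemma torsion_closure_idem:
  assumes "x \<in> torsion_closure (torsion_closure N)"
  shows "x \<in> torsion_closure N"
proof -
  obtain c where c: "x \<in> carrier M" "c \<in> carrier R" "c \<noteq> \<zero>" "c \<cdot> x \<in> torsion_closure N"
    using assms by (rule torsion_closureE)
  from c(4) obtain d where d: "d \<in> carrier R" "d \<noteq> \<zero>" "d \<cdot> (c \<cdot> x) \<in> N" by (rule torsion_closureE)
  thus ?thesis using c by (intro torsion_closureI[of _ "d \<otimes> c"]) (simp_all add: smult_assoc1 R.integral_iff)
qed

lemma submod_torsion_closure:
  assumes N: "submod N"
  shows "submod (torsion_closure N)"
proof (rule submodI)
  show "torsion_closure N \<subseteq> carrier M" by (auto simp: torsion_closure_def)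
  show "\<zero>\<^bsub>M\<^esub> \<in> torsion_closure N" using submod_zero[OF N] by (intro torsion_closureI[of _ \<one>]) auto
next
  fix x y assume "x \<in> torsion_closure N"
  then obtain c where c: "x \<in> carrier M" "c \<in> carrier R" "c \<noteq> \<zero>" "c \<cdot> x \<in> N" by (rule torsion_closureE)
  assume "y \<in> torsion_closure N"
  then obtain d where d: "y \<in> carrier M" "d \<in> carrier R" "d \<noteq> \<zero>" "d \<cdot> y \<in> N" by (rule torsion_closureE)
  have "(c \<otimes> d) \<cdot> (x \<boxplus> y) = d \<cdot> (c \<cdot> x) \<boxplus> c \<cdot> (d \<cdot> y)"
    using c d smult_commute[of d c x] by (simp add: smult_r_distr smult_assoc1)
  also have "\<dots> \<in> N" using c d submoduleE(4,5)[OF N] by simp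
  finally show "x \<boxplus> y \<in> torsion_closure N"
    using c d by (intro torsion_closureI[of _ "c \<otimes> d"]) (simp_all add: R.integral_iff)
next
  fix r x assume r: "r \<in> carrier R" and "x \<in> torsion_closure N"
  then obtain c where c: "x \<in> carrier M" "c \<in> carrier R" "c \<noteq> \<zero>" "c \<cdot> x \<in> N" by (auto elim: torsion_closureE)
  thus "r \<cdot> x \<in> torsion_closure N"
    using r submoduleE(4)[OF N r c(4)] smult_commute[of c r x] by (intro torsion_closureI[of _ c]) simp_all
qed

lemma exists_independent_subset:
  assumes Y: "Y \<subseteq> carrier M"
  obtains G where "G \<subseteq> Y" "independent G" "Y \<subseteq> torsion_closure (span G)"
proof -
  obtain G where G: "G \<subseteq> Y" "\<forall>g \<in> G. g \<notin> torsion_closure (span (G - {g}))" "Y \<subseteq> torsion_closure (span G)"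
  proof (rule exists_independent_spanning_subset[of Y "\<lambda>A. torsion_closure (span A)"])
    show "torsion_closure (span A) \<subseteq> torsion_closure (span B)" if "A \<subseteq> B" for A B
      using that by (intro torsion_closure_mono span_mono)
    show "A \<subseteq> torsion_closure (span A)" if "A \<subseteq> Y" for A
      using subset_torsion_closure[OF span_carrier[of A]] span_superset[of A] that Y by auto
  next
    fix A x assume A: "A \<subseteq> Y" and "x \<in> torsion_closure (span A)"
    then obtain c where c: "x \<in> carrier M" "c \<in> carrier R" "c \<noteq> \<zero>" "c \<cdot> x \<in> span A" by (auto elim: torsion_closureE)
    have "A \<subseteq> carrier M" using A Y by auto
    then obtain F where F: "finite F" "F \<subseteq> A" "c \<cdot> x \<in> span F" using c(4) by (rule span_finitary)
    thus "\<exists>F. finite F \<and> F \<subseteq> A \<and> x \<in> torsion_closure (span F)" using c by (intro exI[of _ F]) (auto intro: torsion_closureI)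
  next
    fix A x y assume A: "A \<subseteq> Y" and x: "x \<in> Y" and y: "y \<in> Y"
      and in_: "y \<in> torsion_closure (span (insert x A))" and nin: "y \<notin> torsion_closure (span A)"
    have c: "A \<subseteq> carrier M" "x \<in> carrier M" "y \<in> carrier M" using A x y Y by auto
    from in_ obtain r where r: "r \<in> carrier R" "r \<noteq> \<zero>" "r \<cdot> y \<in> span (insert x A)" by (rule torsion_closureE)
    from r(3) obtain v s where v: "v \<in> span A" "s \<in> carrier R" "r \<cdot> y = v \<boxplus> s \<cdot> x"
      by (rule span_insert_decompose[OF c(1,2)])
    have vc: "v \<in> carrier M" using v(1) span_carrier[OF c(1)] by auto
    have "s \<noteq> \<zero>"
    proof
      assume "s = \<zero>"
      hence "r \<cdot> y \<in> span A" using v vc c by simp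
      thus False using nin torsion_closureI[OF c(3) r(1,2)] by blast
    qed
    moreover have "s \<cdot> x \<in> span (insert y A)"
    proof -
      have sS: "submod (span (insert y A))" using c by (intro submod_span) auto
      have "s \<cdot> x = r \<cdot> y \<boxminus> v"
        using v vc c add_diff[of "s \<cdot> x" v] by (simp add: M.a_comm)
      moreover have "r \<cdot> y \<in> span (insert y A)" using submoduleE(4)[OF sS r(1)] span_base by blast
      moreover have "v \<in> span (insert y A)" using v(1) span_mono[of A "insert y A"] by auto
      ultimately show ?thesis using submod_diff[OF sS] by simp
    qed
    ultimately show "x \<in> torsion_closure (span (insert y A))" using torsion_closureI[OF c(2) v(2)] by blast
  qed
  have "independent G"
    unfolding independent_def
  proof (intro conjI ballI impI)
    show "G \<subseteq> carrier M" using G Y by auto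
    fix g r assume "g \<in> G" "r \<in> carrier R" "r \<cdot> g \<in> span (G - {g})"
    thus "r = \<zero>" using G Y torsion_closureI[of g r "span (G - {g})"] by auto
  qed
  thus ?thesis using that G by blast
qed

text \<open>The quotients of \<open>c\<close> by the growing products would generate a strictly ascending chain of ideals.\<close>
lemma no_infinitely_divisible_element:
  assumes c: "c \<in> carrier R" "c \<noteq> \<zero>" and a: "\<And>n::nat. a n \<in> carrier R" "\<And>n r. r \<in> carrier R \<Longrightarrow> r \<otimes> a n \<noteq> \<one>"
    and P: "P 0 = \<one>" "\<And>n. P (Suc n) = P n \<otimes> a n"
    and dvd: "\<And>n. \<exists>t \<in> carrier R. c = t \<otimes> P n"
  shows False
proof -
  have PR: "P n \<in> carrier R" for n by (induction n) (simp_all add: P a)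
  obtain t where t: "\<And>n. t n \<in> carrier R" "\<And>n. c = t n \<otimes> P n" using dvd by metis
  have P0: "P n \<noteq> \<zero>" and t0: "t n \<noteq> \<zero>" for n using t(1)[of n] t(2)[of n] c(2) PR[of n] by auto
  have ta: "t n = a n \<otimes> t (Suc n)" for n
  proof -
    have "t n \<otimes> P n = (a n \<otimes> t (Suc n)) \<otimes> P n"
      using t(2)[of n] t(2)[of "Suc n"] t(1) PR[of n] a by (simp add: P R.m_ac)
    thus ?thesis using R.m_rcancel[OF P0 PR] t(1) a by simp
  qed
  have "PIdl (t n) \<subseteq> PIdl (t (Suc n))" for n
  proof -
    have "t n \<in> PIdl (t (Suc n))" using ta[of n] a by (auto simp: cgenideal_def)
    thus ?thesis using R.cgenideal_minimal[OF R.cgenideal_ideal] t(1) by blast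
  qed
  then obtain N where N: "\<And>n. PIdl (t n) \<subseteq> PIdl (t N)"
    using ascending_ideals_stabilize[of "\<lambda>n. PIdl (t n)"] R.cgenideal_ideal t(1) by blast
  have "t (Suc N) \<in> PIdl (t N)" using N[of "Suc N"] R.cgenideal_self[OF t(1)] by blast
  then obtain r where r: "r \<in> carrier R" "t (Suc N) = r \<otimes> t N" by (auto simp: cgenideal_def)
  have "\<one> \<otimes> t (Suc N) = (r \<otimes> a N) \<otimes> t (Suc N)" using r ta[of N] t(1) a by (simp add: R.m_assoc)
  hence "\<one> = r \<otimes> a N" using R.m_rcancel[OF t0[of "Suc N"] t(1), of \<one> "r \<otimes> a N"] r(1) a(1) by blast
  thus False using a(2) r by metis
qed

text \<open>
  Dividing by the elements \<open>f n - a n \<cdot> f (n + 1)\<close> turns \<open>f n\<close> into \<open>f 0 / (a 0 \<cdots> a (n - 1))\<close>; after \<open>f 0\<close>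
  has been killed as well, every annihilator of \<open>f n\<close> is a multiple of this product. To see this, move
  the relation to an \<open>f N\<close> so far out that only \<open>k i\<close> with \<open>i < N\<close> occur in it, and read off the
  coefficients from the last one backwards.
\<close>
lemma telescope_annihilator:
  fixes f :: "nat \<Rightarrow> 'c"
  assumes G: "independent G" and f: "inj f" "range f \<subseteq> G"
    and a: "\<And>n. a n \<in> carrier R" "\<And>n. a n \<noteq> \<zero>"
    and P: "P 0 = \<one>" "\<And>n. P (Suc n) = P n \<otimes> a n"
    and k: "\<And>n. k n = f n \<boxminus> a n \<cdot> f (Suc n)"
    and c: "c \<in> carrier R" and W: "W = G - range f"
    and mem: "c \<cdot> f n \<in> span (insert (f 0) (range k \<union> W))"
  shows "\<exists>t \<in> carrier R. c = t \<otimes> P n"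
proof -
  have Gc: "G \<subseteq> carrier M" using G by (simp add: independent_def)
  have fc: "f n \<in> carrier M" and fG: "f n \<in> G" for n using f Gc by auto
  have kc: "k n \<in> carrier M" for n using fc a by (simp add: k)
  have Wc: "W \<subseteq> carrier M" using W Gc by auto
  have PR: "P n \<in> carrier R" for n by (induction n) (simp_all add: P a)
  have P0: "P n \<noteq> \<zero>" for n by (induction n) (simp_all add: P a PR R.integral_iff)
  define S where "S = (\<lambda>N. insert (f 0) (k ` {..<N} \<union> W))"
  have Sc: "S N \<subseteq> carrier M" for N using fc kc Wc by (auto simp: S_def)
  have sS: "submod (span (S N))" for N by (rule submod_span[OF Sc])
  have SSuc: "S (Suc N) = insert (k N) (S N)" for N by (auto simp: S_def lessThan_Suc)
  have Smono: "S i \<subseteq> S j" if "i \<le> j" for i j using that by (auto simp: S_def)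
  have fold: "f n = k n \<boxplus> a n \<cdot> f (Suc n)" for n using fc a by (simp add: k diff_add)
  have SG: "span (S N) \<subseteq> span (G - {f (Suc N)})" for N
  proof (rule span_least_span)
    have GN: "G - {f (Suc N)} \<subseteq> carrier M" using Gc by auto
    have sG: "submod (span (G - {f (Suc N)}))" by (rule submod_span[OF GN])
    have fi: "f i \<in> span (G - {f (Suc N)})" if "i \<le> N" for i
    proof (rule span_base)
      have "f i \<noteq> f (Suc N)" using injD[OF f(1), of i "Suc N"] that by auto
      thus "f i \<in> G - {f (Suc N)}" using fG by simp
    qed
    have "k i \<in> span (G - {f (Suc N)})" if "i < N" for i
      unfolding k using that by (intro submod_diff[OF sG] submoduleE(4)[OF sG] a fi) auto
    moreover have "w \<in> span (G - {f (Suc N)})" if "w \<in> W" for w using that W by (intro span_base) auto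
    ultimately show "S N \<subseteq> span (G - {f (Suc N)})" using fi[of 0] by (auto simp: S_def)
    show "G - {f (Suc N)} \<subseteq> carrier M" by (rule GN)
  qed
  have ann: "\<exists>t \<in> carrier R. r = t \<otimes> P N" if "r \<in> carrier R" "r \<cdot> f N \<in> span (S N)" for r N
    using that
  proof (induction N arbitrary: r)
    case 0
    thus ?case by (intro bexI[of _ r]) (simp_all add: P)
  next
    case (Suc N)
    have r: "r \<in> carrier R" using Suc.prems by simp
    have "r \<cdot> f (Suc N) \<in> span (insert (k N) (S N))" using Suc.prems by (simp add: SSuc)
    then obtain v s where v: "v \<in> span (S N)" "s \<in> carrier R" "r \<cdot> f (Suc N) = v \<boxplus> s \<cdot> k N"
      by (rule span_insert_decompose[OF Sc kc])
    have vc: "v \<in> carrier M" using submod_carrier[OF sS v(1)] .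
    have "s \<cdot> f N = s \<cdot> k N \<boxplus> (s \<otimes> a N) \<cdot> f (Suc N)"
      using fold[of N] kc[of N] fc[of "Suc N"] a v(2) smult_r_distr[of s "k N" "a N \<cdot> f (Suc N)"]
      by (simp add: smult_assoc1)
    hence "v \<boxplus> s \<cdot> f N = r \<cdot> f (Suc N) \<boxplus> (s \<otimes> a N) \<cdot> f (Suc N)"
      using v vc kc fc a by (simp add: M.a_assoc)
    hence eq: "v \<boxplus> s \<cdot> f N = (r \<oplus> s \<otimes> a N) \<cdot> f (Suc N)"
      using r v(2) a fc by (simp add: smult_l_distr)
    have "submod (span (G - {f (Suc N)}))" using Gc by (intro submod_span) auto
    moreover have "f N \<in> span (G - {f (Suc N)})"
    proof (rule span_base)
      have "f N \<noteq> f (Suc N)" using injD[OF f(1), of N "Suc N"] by auto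
      thus "f N \<in> G - {f (Suc N)}" using fG by simp
    qed
    ultimately have "v \<boxplus> s \<cdot> f N \<in> span (G - {f (Suc N)})"
      using v SG[of N] submoduleE(4,5) by blast
    hence z: "r \<oplus> s \<otimes> a N = \<zero>"
      using G fG[of "Suc N"] r v(2) a unfolding eq independent_def by simp
    hence "v \<boxplus> s \<cdot> f N = \<zero>\<^bsub>M\<^esub>" using eq fc by simp
    hence "s \<cdot> f N \<boxplus> v \<in> span (S N)" using vc fc v(2) submod_zero[OF sS] by (simp add: M.a_comm)
    hence "s \<cdot> f N \<in> span (S N)" using submod_add_cancel[OF sS _ v(1)] v(2) fc by simp
    then obtain t where t: "t \<in> carrier R" "s = t \<otimes> P N" using Suc.IH v(2) by blast
    have "r = \<ominus> (s \<otimes> a N)" using z r v(2) a by (simp add: R.minus_equality)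
    hence "r = (\<ominus> t) \<otimes> P (Suc N)" using t PR a by (simp add: P R.l_minus R.m_assoc)
    thus ?case using t by blast
  qed
  have quot: "\<exists>Q \<in> carrier R. P (n + j) = P n \<otimes> Q \<and> f n \<boxminus> Q \<cdot> f (n + j) \<in> span (S (n + j))" for j
  proof (induction j)
    case 0
    show ?case using PR fc submod_zero[OF sS] by (intro bexI[of _ \<one>]) (simp_all add: M.minus_eq M.r_neg)
  next
    case (Suc j)
    then obtain Q where Q: "Q \<in> carrier R" "P (n + j) = P n \<otimes> Q" "f n \<boxminus> Q \<cdot> f (n + j) \<in> span (S (n + j))" by auto
    let ?N = "n + j"
    have "f n \<boxminus> (Q \<otimes> a ?N) \<cdot> f (Suc ?N) = (f n \<boxminus> Q \<cdot> f ?N) \<boxplus> Q \<cdot> k ?N"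
    proof -
      have "Q \<cdot> k ?N = Q \<cdot> f ?N \<boxminus> (Q \<otimes> a ?N) \<cdot> f (Suc ?N)"
        using Q(1) fc a by (simp add: k smult_diff_r smult_assoc1)
      moreover have "(x \<boxminus> y) \<boxplus> (y \<boxminus> z) = x \<boxminus> z" if "x \<in> carrier M" "y \<in> carrier M" "z \<in> carrier M" for x y z
        using that diff_add[of x y] by (simp add: M.minus_eq M.a_assoc[symmetric])
      ultimately show ?thesis using Q(1) fc a by simp
    qed
    moreover have "f n \<boxminus> Q \<cdot> f ?N \<in> span (S (Suc ?N))" using Q(3) span_mono[OF Smono[of ?N "Suc ?N"]] by auto
    moreover have "Q \<cdot> k ?N \<in> span (S (Suc ?N))"
      by (intro submoduleE(4)[OF sS Q(1)] span_base) (simp add: SSuc)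
    ultimately have "f n \<boxminus> (Q \<otimes> a ?N) \<cdot> f (Suc ?N) \<in> span (S (Suc ?N))" using submoduleE(5)[OF sS] by simp
    thus ?case using Q PR a by (intro bexI[of _ "Q \<otimes> a ?N"]) (simp_all add: P R.m_assoc)
  qed
  have "insert (f 0) (range k \<union> W) = insert (f 0) W \<union> range k" by auto
  hence "c \<cdot> f n \<in> span (insert (f 0) W \<union> range k)" using mem by simp
  moreover have "insert (f 0) W \<subseteq> carrier M" "range k \<subseteq> carrier M" using fc kc Wc by auto
  ultimately obtain F where F: "finite F" "F \<subseteq> range k" "c \<cdot> f n \<in> span (insert (f 0) W \<union> F)"
    using span_Un_finitary[of "insert (f 0) W" "range k" "c \<cdot> f n"] by blast
  obtain D where D: "finite D" "F = k ` D" using finite_subset_image[OF F(1), of k UNIV] F(2) by auto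
  obtain j where j: "\<And>i. i \<in> D \<Longrightarrow> i < j" using D(1) by (metis finite_nat_set_iff_bounded)
  have "insert (f 0) W \<union> F \<subseteq> S (n + j)" using D j by (fastforce simp: S_def)
  hence cf: "c \<cdot> f n \<in> span (S (n + j))" using F(3) span_mono by blast
  obtain Q where Q: "Q \<in> carrier R" "P (n + j) = P n \<otimes> Q" "f n \<boxminus> Q \<cdot> f (n + j) \<in> span (S (n + j))"
    using quot[of j] by auto
  have "c \<cdot> (f n \<boxminus> Q \<cdot> f (n + j)) \<in> span (S (n + j))" using submoduleE(4)[OF sS c Q(3)] .
  hence "c \<cdot> f n \<boxminus> (c \<otimes> Q) \<cdot> f (n + j) \<in> span (S (n + j))"
    using c Q(1) fc by (simp add: smult_diff_r smult_assoc1)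
  hence "(c \<otimes> Q) \<cdot> f (n + j) \<boxminus> c \<cdot> f n \<in> span (S (n + j))"
    using submod_diff_swap[OF sS] c Q(1) fc by simp
  hence "(c \<otimes> Q) \<cdot> f (n + j) \<in> span (S (n + j))" using submod_diff_cancel[OF sS _ cf] c Q(1) fc by simp
  then obtain t where t: "t \<in> carrier R" "c \<otimes> Q = t \<otimes> P (n + j)" using ann c Q(1) by blast
  have "c \<otimes> Q = (t \<otimes> P n) \<otimes> Q" using t Q PR by (simp add: R.m_assoc)
  moreover have "Q \<noteq> \<zero>" using Q P0[of "n + j"] PR[of n] by auto
  ultimately have "c = t \<otimes> P n" using R.m_rcancel[of Q] c Q(1) t(1) PR by simp
  thus ?thesis using t by blast
qed

text \<open>
  Each element \<open>g\<close> of the weak basis \<open>Y\<close> is irredundant even modulo a nonzero multiple \<open>cf g \<cdot> g\<close>, since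
  \<open>M / span (Y - {g})\<close> has a simple quotient. So the elements \<open>f n\<close> of a sequence in \<open>G\<close> may be replaced by
  \<open>f n - cf (f (n + 1)) \<cdot> f (n + 1)\<close> without losing irredundancy, and the quotient by these elements, by
  \<open>f 0\<close> and by the rest of \<open>G\<close> is torsion but not bounded.
\<close>
lemma independent_subset_of_weak_basis_finite:
  assumes rwb: "rwb_mod {\<zero>\<^bsub>M\<^esub>}" and Y: "Y \<subseteq> carrier M" "span Y = carrier M"
    and Yi: "\<And>y. y \<in> Y \<Longrightarrow> y \<notin> span (Y - {y})"
    and G: "G \<subseteq> Y" "independent G" "Y \<subseteq> torsion_closure (span G)"
  shows "finite G"
proof (rule ccontr)
  assume "infinite G"
  then obtain f :: "nat \<Rightarrow> 'c" where f: "inj f" "range f \<subseteq> G"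
    using infinite_countable_subset by meson
  have Gc: "G \<subseteq> carrier M" using G Y by auto
  have fc: "f n \<in> carrier M" and fG: "f n \<in> G" for n using f Gc by auto
  have Yg: "submod (span (Y - {g}))" for g using Y by (intro submod_span) auto
  have "\<exists>c. c \<in> carrier R \<and> c \<noteq> \<zero> \<and> (\<forall>r \<in> carrier R. r \<otimes> c \<noteq> \<one>) \<and> g \<notin> span (insert (c \<cdot> g) (Y - {g}))"
    if g: "g \<in> Y" for g
  proof -
    have gc: "g \<in> carrier M" using g Y by auto
    let ?I = "{r \<in> carrier R. r \<cdot> g \<in> span (Y - {g})}"
    have "\<one> \<notin> ?I" using Yi[OF g] gc by simp
    then obtain p where p: "maximalideal p R" "?I \<subseteq> p"
      by (rule proper_ideal_below_maximal[OF ideal_annihilator[OF Yg gc]])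
    obtain c where c: "c \<in> p" "c \<noteq> \<zero>" by (rule maximal_nonzero[OF p(1)])
    have cR: "c \<in> carrier R" using maximal_carrier[OF p(1) c(1)] .
    have "g \<notin> span (insert (c \<cdot> g) (Y - {g}))"
    proof
      assume "g \<in> span (insert (c \<cdot> g) (Y - {g}))"
      moreover have "Y - {g} \<subseteq> carrier M" "c \<cdot> g \<in> carrier M" using Y gc cR by auto
      ultimately obtain v r where v: "v \<in> span (Y - {g})" "r \<in> carrier R" "g = v \<boxplus> r \<cdot> (c \<cdot> g)"
        using span_insert_decompose by blast
      have vc: "v \<in> carrier M" using submod_carrier[OF Yg v(1)] .
      have "(\<one> \<ominus> r \<otimes> c) \<cdot> g = g \<boxminus> r \<cdot> (c \<cdot> g)"
        using v(2) cR gc by (simp add: smult_diff_l smult_assoc1)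
      also have "\<dots> = v"
      proof -
        let ?q = "r \<cdot> (c \<cdot> g)"
        have "(v \<boxplus> ?q) \<boxminus> ?q = v" using vc v(2) cR gc by (intro add_diff) simp_all
        thus ?thesis using arg_cong[OF v(3), of "\<lambda>x. x \<boxminus> ?q"] by (simp only:)
      qed
      finally have "\<one> \<ominus> r \<otimes> c \<in> ?I" using v cR by simp
      hence "\<one> \<ominus> r \<otimes> c \<in> p" using p by blast
      thus False using one_minus_notin[OF p(1) maximal_mult_in(1)[OF p(1) c(1) v(2)]] by simp
    qed
    moreover have "r \<otimes> c \<noteq> \<one>" if "r \<in> carrier R" for r
      using maximal_mult_in(1)[OF p(1) c(1) that] maximal_one_notin[OF p(1)] by auto
    ultimately show ?thesis using c cR by blast
  qed
  then obtain cf where cf: "\<And>g. g \<in> Y \<Longrightarrow> cf g \<in> carrier R" "\<And>g. g \<in> Y \<Longrightarrow> cf g \<noteq> \<zero>"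
    "\<And>g r. g \<in> Y \<Longrightarrow> r \<in> carrier R \<Longrightarrow> r \<otimes> cf g \<noteq> \<one>"
    "\<And>g. g \<in> Y \<Longrightarrow> g \<notin> span (insert (cf g \<cdot> g) (Y - {g}))"
    by metis
  have cfR: "cf g \<in> carrier R" if "g \<in> G" for g using cf(1) G that by auto
  define a where "a = (\<lambda>n. cf (f (Suc n)))"
  have aR: "a n \<in> carrier R" and a0: "a n \<noteq> \<zero>" and a1: "\<And>r. r \<in> carrier R \<Longrightarrow> r \<otimes> a n \<noteq> \<one>" for n
    using cf(1,2,3) G(1) fG[of "Suc n"] by (auto simp: a_def)
  define k where "k = (\<lambda>n. f n \<boxminus> a n \<cdot> f (Suc n))"
  have kn: "k n = f n \<boxminus> a n \<cdot> f (Suc n)" for n by (simp add: k_def)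
  have kc: "k n \<in> carrier M" for n using fc aR by (simp add: kn)
  have fold: "f n = k n \<boxplus> a n \<cdot> f (Suc n)" for n using fc aR by (simp add: kn diff_add)
  define W where "W = G - range f"
  have Wc: "W \<subseteq> carrier M" using Gc by (auto simp: W_def)
  let ?B = "range k \<union> W"
  have Bc: "?B \<subseteq> carrier M" using kc Wc by auto
  let ?l = "(\<lambda>g. cf g \<cdot> g) ` G"
  have lc: "?l \<subseteq> carrier M" using cfR Gc by auto
  define L where "L = span (Y - G \<union> ?l)"
  have sL: "submod L" unfolding L_def using Y lc by (intro submod_span) auto
  have Lc: "L \<subseteq> carrier M" by (rule submoduleE(1)[OF sL])
  have lL: "cf g \<cdot> g \<in> L" if "g \<in> G" for g unfolding L_def using that by (intro span_base) auto
  have aL: "a n \<cdot> f (Suc n) \<in> L" for n unfolding a_def by (rule lL[OF fG])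
  have irrG: "g \<notin> span (L \<union> (G - {g}))" if g: "g \<in> G" for g
  proof -
    let ?S = "span (insert (cf g \<cdot> g) (Y - {g}))"
    have sc: "insert (cf g \<cdot> g) (Y - {g}) \<subseteq> carrier M" using Y Gc g cfR[OF g] by auto
    have sS: "submod ?S" by (rule submod_span[OF sc])
    have YS: "Y - {g} \<subseteq> ?S" and gS: "cf g \<cdot> g \<in> ?S"
      using span_superset[of "insert (cf g \<cdot> g) (Y - {g})"] by auto
    have "cf h \<cdot> h \<in> ?S" if h: "h \<in> G" for h
    proof (cases "h = g")
      case False
      hence "h \<in> ?S" using YS G h by auto
      thus ?thesis using submoduleE(4)[OF sS cfR[OF h]] by simp
    qed (use gS in simp)
    hence "Y - G \<union> ?l \<subseteq> ?S" using YS g by auto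
    hence "L \<subseteq> ?S" unfolding L_def by (rule span_least[OF sS])
    hence "L \<union> (G - {g}) \<subseteq> ?S" using YS G by auto
    hence "span (L \<union> (G - {g})) \<subseteq> ?S" by (rule span_least[OF sS])
    thus ?thesis using cf(4)[of g] g G by auto
  qed
  have kS: "k m \<in> span (L \<union> (G - {g}))" if "f m \<noteq> g" for m g
  proof -
    have sS: "submod (span (L \<union> (G - {g})))" using Lc Gc by (intro submod_span) auto
    have "f m \<in> span (L \<union> (G - {g}))" "a m \<cdot> f (Suc m) \<in> span (L \<union> (G - {g}))"
      using fG[of m] that aL[of m] by (auto intro: span_base)
    thus ?thesis unfolding kn by (rule submod_diff[OF sS])
  qed
  have irr: "b \<notin> span (L \<union> (?B - {b}))" if b: "b \<in> ?B" for b
  proof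
    assume *: "b \<in> span (L \<union> (?B - {b}))"
    show False
    proof (cases "b \<in> W")
      case True
      let ?S = "span (L \<union> (G - {b}))"
      have sS: "submod ?S" using Lc Gc by (intro submod_span) auto
      have "k m \<in> ?S" for m by (rule kS) (use True in \<open>auto simp: W_def\<close>)
      moreover have "L \<subseteq> ?S" "W - {b} \<subseteq> ?S" using span_superset[of "L \<union> (G - {b})"] by (auto simp: W_def)
      ultimately have "span (L \<union> (?B - {b})) \<subseteq> ?S" by (intro span_least[OF sS]) auto
      thus False using * irrG[of b] True by (auto simp: W_def)
    next
      case False
      then obtain n where n: "b = k n" using b by auto
      let ?S = "span (L \<union> (G - {f n}))"
      have sS: "submod ?S" using Lc Gc by (intro submod_span) auto
      have "k m \<in> ?S" if "k m \<noteq> k n" for m by (rule kS) (use that injD[OF f(1)] in auto)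
      moreover have LS: "L \<subseteq> ?S" and "W \<subseteq> ?S" using span_superset[of "L \<union> (G - {f n})"] by (auto simp: W_def)
      ultimately have "span (L \<union> (?B - {b})) \<subseteq> ?S" unfolding n by (intro span_least[OF sS]) auto
      hence "k n \<in> ?S" using * n by auto
      moreover have "a n \<cdot> f (Suc n) \<in> ?S" using aL LS by auto
      ultimately have "k n \<boxplus> a n \<cdot> f (Suc n) \<in> ?S" by (rule submoduleE(5)[OF sS])
      hence "f n \<in> ?S" by (simp only: fold[of n, symmetric])
      thus False using irrG[OF fG] by simp
    qed
  qed
  have gen: "span (L \<union> ?B) = carrier M"
  proof (rule equalityI)
    let ?S = "span (L \<union> ?B)"
    have LB: "L \<union> ?B \<subseteq> carrier M" using Lc Bc by auto
    show "?S \<subseteq> carrier M" by (rule span_carrier[OF LB])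
    have sS: "submod ?S" by (rule submod_span[OF LB])
    have up: "L \<subseteq> ?S" "range k \<subseteq> ?S" "W \<subseteq> ?S" using span_superset[of "L \<union> ?B"] by auto
    have "f n \<in> ?S" for n
      using fold[of n] submoduleE(5)[OF sS, of "k n" "a n \<cdot> f (Suc n)"] up aL[of n] by auto
    hence "G \<subseteq> ?S" using up(3) by (auto simp: W_def)
    moreover have "Y - G \<subseteq> L" unfolding L_def using span_superset[of "Y - G \<union> ?l"] by auto
    ultimately have "Y \<subseteq> ?S" using up(1) by auto
    thus "carrier M \<subseteq> ?S" using span_least[OF sS] Y by metis
  qed
  have z: "submod {\<zero>\<^bsub>M\<^esub>}" "{\<zero>\<^bsub>M\<^esub>} \<subseteq> L" using submod_singleton_zero submod_zero[OF sL] by auto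
  have "rwb_mod (span ({\<zero>\<^bsub>M\<^esub>} \<union> ?B))" by (rule rwb_mod_irredundant[OF rwb z(1) sL z(2) Bc gen irr])
  hence "rwb_mod (span ?B)" using span_zero_Un[OF Bc] by simp
  hence "rwb_mod (span (span ?B \<union> {f 0}))" using rwb_mod_finite[OF _ submod_span[OF Bc], of "{f 0}"] fc by simp
  moreover have "span (span ?B \<union> {f 0}) = span (insert (f 0) ?B)" using span_Un_span[OF Bc, of "{f 0}"] fc by simp
  ultimately have rwbK: "rwb_mod (span (insert (f 0) ?B))" by simp
  let ?K = "span (insert (f 0) ?B)"
  have Kc: "insert (f 0) ?B \<subseteq> carrier M" using fc Bc by auto
  have sK: "submod ?K" by (rule submod_span[OF Kc])
  have upK: "f 0 \<in> ?K" "range k \<subseteq> ?K" "W \<subseteq> ?K" using span_superset[of "insert (f 0) ?B"] by auto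
  have sT: "submod (torsion_closure ?K)" by (rule submod_torsion_closure[OF sK])
  define P where "P = rec_nat \<one> (\<lambda>n x. x \<otimes> a n)"
  have P: "P 0 = \<one>" "P (Suc n) = P n \<otimes> a n" for n by (simp_all add: P_def)
  have PR: "P n \<in> carrier R" for n by (induction n) (simp_all add: P aR)
  have P0: "P n \<noteq> \<zero>" for n by (induction n) (simp_all add: P aR a0 PR R.integral_iff)
  have Pf: "P n \<cdot> f n \<in> ?K" for n
  proof (induction n)
    case 0
    thus ?case using upK fc by (simp add: P)
  next
    case (Suc n)
    have "P n \<cdot> k n = P n \<cdot> f n \<boxminus> P (Suc n) \<cdot> f (Suc n)"
      using PR fc aR by (simp add: kn smult_diff_r smult_assoc1 P)
    moreover have "P n \<cdot> k n \<in> ?K" using upK by (intro submoduleE(4)[OF sK PR]) auto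
    ultimately have "P (Suc n) \<cdot> f (Suc n) \<boxminus> P n \<cdot> f n \<in> ?K" using submod_diff_swap[OF sK] PR fc by simp
    thus ?case using submod_diff_cancel[OF sK _ Suc] PR fc by simp
  qed
  have "f n \<in> torsion_closure ?K" for n using torsion_closureI[OF fc PR P0 Pf] .
  moreover have "W \<subseteq> torsion_closure ?K" using upK(3) subset_torsion_closure[OF submoduleE(1)[OF sK]] by auto
  ultimately have "G \<subseteq> torsion_closure ?K" by (auto simp: W_def)
  hence "torsion_closure (span G) \<subseteq> torsion_closure (torsion_closure ?K)"
    by (intro torsion_closure_mono span_least[OF sT])
  hence "Y \<subseteq> torsion_closure ?K" using G(3) torsion_closure_idem by blast
  hence "carrier M \<subseteq> torsion_closure ?K" using span_least[OF sT] Y(2) by metis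
  hence "torsion_mod ?K" unfolding torsion_mod_def torsion_closure_def by blast
  then obtain c where c: "c \<in> carrier R" "c \<noteq> \<zero>" "\<forall>x \<in> carrier M. c \<cdot> x \<in> ?K"
    by (rule torsion_bounded[OF rwbK sK])
  have "\<exists>t \<in> carrier R. c = t \<otimes> P n" for n
    using telescope_annihilator[OF G(2) f aR a0 P kn c(1) W_def, of n] c(3) fc by blast
  thus False using no_infinitely_divisible_element[OF c(1,2) aR a1 P] by blast
qed

text \<open>A maximal independent subset \<open>G\<close> of a weak basis is finite, so \<open>M / span G\<close> is again a quotient to which
  the torsion case applies.\<close>
theorem multiple_in_finite_free_submodule:
  assumes rwb: "rwb_mod {\<zero>\<^bsub>M\<^esub>}"
  obtains G c where "finite G" "independent G" "c \<in> carrier R" "c \<noteq> \<zero>" "\<forall>x \<in> carrier M. c \<cdot> x \<in> span G"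
proof -
  obtain Y where Y: "Y \<subseteq> carrier M" "span ({\<zero>\<^bsub>M\<^esub>} \<union> Y) = carrier M" "\<forall>y \<in> Y. y \<notin> span ({\<zero>\<^bsub>M\<^esub>} \<union> (Y - {y}))"
    by (rule rwb_mod_carrierE[OF rwb submod_singleton_zero])
  have Y2: "span Y = carrier M" using Y span_zero_Un by simp
  have Y3: "y \<notin> span (Y - {y})" if "y \<in> Y" for y using Y(1,3) that span_zero_Un[of "Y - {y}"] by auto
  obtain G where G: "G \<subseteq> Y" "independent G" "Y \<subseteq> torsion_closure (span G)" by (rule exists_independent_subset[OF Y(1)])
  have fin: "finite G" by (rule independent_subset_of_weak_basis_finite[OF rwb Y(1) Y2 Y3 G])
  have Gc: "G \<subseteq> carrier M" using G Y by auto
  have sG: "submod (span G)" by (rule submod_span[OF Gc])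
  have "rwb_mod (span G)" using rwb_mod_finite[OF rwb submod_singleton_zero fin Gc] span_zero_Un[OF Gc] by simp
  moreover have "torsion_mod (span G)"
  proof -
    have "carrier M \<subseteq> torsion_closure (span G)" using span_least[OF submod_torsion_closure[OF sG] G(3)] Y2 by simp
    thus ?thesis unfolding torsion_mod_def torsion_closure_def by blast
  qed
  ultimately obtain c where "c \<in> carrier R" "c \<noteq> \<zero>" "\<forall>x \<in> carrier M. c \<cdot> x \<in> span G"
    using torsion_bounded[OF _ sG] by blast
  thus ?thesis using that fin G by blast
qed

end


section \<open>Splitting off a finitely generated projective summand\<close>

text \<open>The map \<open>x \<mapsto> \<Sum>\<^sub>i \<phi>\<^sub>i(x) m\<^sub>i\<close> given by the pairs \<open>(\<phi>\<^sub>i, m\<^sub>i)\<close>.\<close>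
primrec dual_sum :: "('a, 'c, 'l) module_scheme \<Rightarrow> (('b \<Rightarrow> 'a) \<times> 'c) list \<Rightarrow> 'b \<Rightarrow> 'c" where
  "dual_sum A [] x = \<zero>\<^bsub>A\<^esub>"
| "dual_sum A (q # l) x = fst q x \<odot>\<^bsub>A\<^esub> snd q \<oplus>\<^bsub>A\<^esub> dual_sum A l x"

context module
begin

definition linear_form :: "('c \<Rightarrow> 'a) \<Rightarrow> bool" where
  "linear_form \<phi> \<longleftrightarrow> (\<forall>x \<in> carrier M. \<phi> x \<in> carrier R) \<and>
     (\<forall>x \<in> carrier M. \<forall>y \<in> carrier M. \<phi> (x \<boxplus> y) = \<phi> x \<oplus>\<^bsub>R\<^esub> \<phi> y) \<and>
     (\<forall>r \<in> carrier R. \<forall>x \<in> carrier M. \<phi> (r \<cdot> x) = r \<otimes>\<^bsub>R\<^esub> \<phi> x)"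

definition dual_system :: "(('c \<Rightarrow> 'a) \<times> 'c) list \<Rightarrow> bool" where
  "dual_system l \<longleftrightarrow> (\<forall>q \<in> set l. linear_form (fst q) \<and> snd q \<in> carrier M)"

text \<open>The relation \<open>P\<close> determines the values, so choosing them gives a linear map.\<close>
lemma linear_form_exists:
  assumes ex: "\<And>x. x \<in> carrier M \<Longrightarrow> \<exists>a \<in> carrier R. P x a"
    and uniq: "\<And>x a b. x \<in> carrier M \<Longrightarrow> a \<in> carrier R \<Longrightarrow> b \<in> carrier R \<Longrightarrow> P x a \<Longrightarrow> P x b \<Longrightarrow> a = b"
    and add: "\<And>x y a b. x \<in> carrier M \<Longrightarrow> y \<in> carrier M \<Longrightarrow> a \<in> carrier R \<Longrightarrow> b \<in> carrier R \<Longrightarrow>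
      P x a \<Longrightarrow> P y b \<Longrightarrow> P (x \<boxplus> y) (a \<oplus>\<^bsub>R\<^esub> b)"
    and smult: "\<And>r x a. r \<in> carrier R \<Longrightarrow> x \<in> carrier M \<Longrightarrow> a \<in> carrier R \<Longrightarrow> P x a \<Longrightarrow> P (r \<cdot> x) (r \<otimes>\<^bsub>R\<^esub> a)"
  obtains \<phi> where "linear_form \<phi>" "\<forall>x \<in> carrier M. P x (\<phi> x)"
proof -
  have "\<forall>x \<in> carrier M. \<exists>a. a \<in> carrier R \<and> P x a" using ex by blast
  then obtain \<phi> where "\<forall>x \<in> carrier M. \<phi> x \<in> carrier R \<and> P x (\<phi> x)" by (rule bchoice[THEN exE])
  hence \<phi>: "\<phi> x \<in> carrier R" "P x (\<phi> x)" if "x \<in> carrier M" for x using that by auto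
  have "linear_form \<phi>"
    unfolding linear_form_def
  proof (intro conjI ballI)
    fix x y assume x: "x \<in> carrier M" and y: "y \<in> carrier M"
    show "\<phi> (x \<boxplus> y) = \<phi> x \<oplus>\<^bsub>R\<^esub> \<phi> y"
      by (rule uniq[of "x \<boxplus> y"]) (use x y \<phi> add in auto)
  next
    fix r x assume r: "r \<in> carrier R" and x: "x \<in> carrier M"
    show "\<phi> (r \<cdot> x) = r \<otimes>\<^bsub>R\<^esub> \<phi> x"
      by (rule uniq[of "r \<cdot> x"]) (use r x \<phi> smult in auto)
  qed (use \<phi> in auto)
  thus ?thesis using that \<phi> by blast
qed

lemma dual_sum_closed: "dual_system l \<Longrightarrow> x \<in> carrier M \<Longrightarrow> dual_sum M l x \<in> carrier M"
  by (induction l) (auto simp: dual_system_def linear_form_def)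

lemma dual_sum_add:
  assumes "dual_system l" "x \<in> carrier M" "y \<in> carrier M"
  shows "dual_sum M l (x \<boxplus> y) = dual_sum M l x \<boxplus> dual_sum M l y"
  using assms(1)
proof (induction l)
  case (Cons q l)
  have q: "linear_form (fst q)" "snd q \<in> carrier M" and l: "dual_system l" using Cons.prems by (auto simp: dual_system_def)
  have "fst q x \<in> carrier R" "fst q y \<in> carrier R" "fst q (x \<boxplus> y) = fst q x \<oplus>\<^bsub>R\<^esub> fst q y"
    using q assms by (auto simp: linear_form_def)
  thus ?case using Cons.IH[OF l] q(2) dual_sum_closed[OF l] assms by (simp add: smult_l_distr M.a_ac)
qed simp

lemma dual_sum_smult:
  assumes "dual_system l" "r \<in> carrier R" "x \<in> carrier M"
  shows "dual_sum M l (r \<cdot> x) = r \<cdot> dual_sum M l x"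
  using assms(1)
proof (induction l)
  case (Cons q l)
  have q: "linear_form (fst q)" "snd q \<in> carrier M" and l: "dual_system l" using Cons.prems by (auto simp: dual_system_def)
  have "fst q x \<in> carrier R" "fst q (r \<cdot> x) = r \<otimes>\<^bsub>R\<^esub> fst q x"
    using q assms by (auto simp: linear_form_def)
  thus ?case using Cons.IH[OF l] q(2) dual_sum_closed[OF l] assms by (simp add: smult_r_distr smult_assoc1)
qed (use assms in simp)

lemma dual_sum_diff:
  assumes "dual_system l" "x \<in> carrier M" "y \<in> carrier M"
  shows "dual_sum M l (x \<boxminus> y) = dual_sum M l x \<boxminus> dual_sum M l y"
proof -
  have "x = (x \<boxminus> y) \<boxplus> y" using assms diff_add by simp
  hence "dual_sum M l x = dual_sum M l (x \<boxminus> y) \<boxplus> dual_sum M l y"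
    using dual_sum_add[OF assms(1), of "x \<boxminus> y" y] assms by simp
  thus ?thesis using add_diff dual_sum_closed[OF assms(1)] assms by simp
qed

lemma dual_sum_append:
  assumes "dual_system l" "dual_system l'" "x \<in> carrier M"
  shows "dual_sum M (l @ l') x = dual_sum M l x \<boxplus> dual_sum M l' x"
  using assms(1)
proof (induction l)
  case Nil
  thus ?case using dual_sum_closed[OF assms(2,3)] by simp
next
  case (Cons q l)
  have q: "fst q x \<in> carrier R" "snd q \<in> carrier M" and l: "dual_system l"
    using Cons.prems assms by (auto simp: dual_system_def linear_form_def)
  thus ?case using Cons.IH[OF l] dual_sum_closed[OF l assms(3)] dual_sum_closed[OF assms(2,3)] by (simp add: M.a_assoc)
qed

lemma dual_system_append: "dual_system l \<Longrightarrow> dual_system l' \<Longrightarrow> dual_system (l @ l')"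
  by (auto simp: dual_system_def)

lemma dual_sum_scale:
  assumes "dual_system l" "r \<in> carrier R" "x \<in> carrier M"
  shows "dual_sum M (map (apsnd (\<lambda>m. r \<cdot> m)) l) x = r \<cdot> dual_sum M l x"
  using assms(1)
proof (induction l)
  case (Cons q l)
  have q: "fst q x \<in> carrier R" "snd q \<in> carrier M" and l: "dual_system l"
    using Cons.prems assms by (auto simp: dual_system_def linear_form_def)
  thus ?case using Cons.IH[OF l] dual_sum_closed[OF l assms(3)] assms smult_commute[of "fst q x" r "snd q"]
    by (simp add: smult_r_distr)
qed (use assms in simp)

lemma dual_system_scale: "dual_system l \<Longrightarrow> r \<in> carrier R \<Longrightarrow> dual_system (map (apsnd (\<lambda>m. r \<cdot> m)) l)"
  by (auto simp: dual_system_def)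

end

context dedekind_module
begin

lemma span_empty: "span {} = {\<zero>\<^bsub>M\<^esub>}"
  using span_least[OF submod_singleton_zero, of "{}"] submod_zero[OF submod_span[of "{}"]] by auto



text \<open>
  At a maximal ideal \<open>p\<close>, some \<open>s\<close> outside \<open>p\<close> acts on \<open>M\<close> like \<open>x \<mapsto> \<Sum>\<^sub>i \<phi>\<^sub>i(x) m\<^sub>i\<close>, up to an error whose
  \<open>c\<close>-multiple has no coordinates in \<open>F\<close>. To remove one further coordinate, note that the values
  which this coordinate takes on the errors form an ideal, which is principal at \<open>p\<close>.
\<close>
lemma local_dual_system:
  assumes G: "independent G" and c: "c \<in> carrier R" and cM: "\<forall>x \<in> carrier M. c \<cdot> x \<in> span G"
    and p: "maximalideal p R" and F: "finite F" "F \<subseteq> G"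
  shows "\<exists>s \<in> carrier R - p. \<exists>l. dual_system l \<and>
    (\<forall>x \<in> carrier M. c \<cdot> (s \<cdot> x \<boxminus> dual_sum M l x) \<in> span (G - F))"
  using F
proof (induction F rule: finite_induct)
  case empty
  have "x \<boxminus> \<zero>\<^bsub>M\<^esub> = x" if "x \<in> carrier M" for x using that add_diff[of x "\<zero>\<^bsub>M\<^esub>"] by simp
  hence "c \<cdot> (\<one> \<cdot> x \<boxminus> dual_sum M [] x) \<in> span (G - {})" if "x \<in> carrier M" for x
    using that cM by simp
  moreover have "dual_system []" by (simp add: dual_system_def)
  moreover have "\<one> \<in> carrier R - p" using maximal_one_notin[OF p] by simp
  ultimately show ?case by blast
next
  case (insert g F)
  have Gc: "G \<subseteq> carrier M" using G by (simp add: independent_def)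
  have g: "g \<in> G" "g \<in> carrier M" using insert.prems Gc by auto
  obtain s l where s: "s \<in> carrier R - p" and l: "dual_system l"
    and err: "\<And>x. x \<in> carrier M \<Longrightarrow> c \<cdot> (s \<cdot> x \<boxminus> dual_sum M l x) \<in> span (G - F)"
    using insert by auto
  have sR: "s \<in> carrier R" using s by simp
  define e where "e = (\<lambda>x. s \<cdot> x \<boxminus> dual_sum M l x)"
  have ec: "e x \<in> carrier M" if "x \<in> carrier M" for x using that sR dual_sum_closed[OF l] by (simp add: e_def)
  have e_add: "e (x \<boxplus> y) = e x \<boxplus> e y" if "x \<in> carrier M" "y \<in> carrier M" for x y
    using that sR dual_sum_closed[OF l] dual_sum_add[OF l]
    by (simp add: e_def M.minus_eq smult_r_distr M.minus_add M.a_ac)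
  have e_smult: "e (r \<cdot> x) = r \<cdot> e x" if "r \<in> carrier R" "x \<in> carrier M" for r x
    using that sR dual_sum_closed[OF l] dual_sum_smult[OF l] smult_commute[of s r x]
    by (simp add: e_def smult_diff_r)
  let ?V = "span (G - insert g F)"
  have sV: "submod ?V" using Gc by (intro submod_span) auto
  have Vc: "?V \<subseteq> carrier M" by (rule submoduleE(1)[OF sV])
  have VG: "?V \<subseteq> span (G - {g})" by (rule span_mono) auto
  let ?P = "\<lambda>x a. c \<cdot> e x \<boxminus> a \<cdot> g \<in> ?V"
  obtain \<phi> where \<phi>: "linear_form \<phi>" "\<forall>x \<in> carrier M. ?P x (\<phi> x)"
  proof (rule linear_form_exists[of ?P])
    fix x assume x: "x \<in> carrier M"
    have GF: "insert g (G - insert g F) = G - F" using g insert.hyps by auto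
    have "c \<cdot> e x \<in> span (insert g (G - insert g F))" using err[OF x] GF by (simp add: e_def)
    moreover have "G - insert g F \<subseteq> carrier M" using Gc by auto
    ultimately obtain v a where va: "v \<in> ?V" "a \<in> carrier R" "c \<cdot> e x = v \<boxplus> a \<cdot> g"
      using span_insert_decompose[OF _ g(2)] by metis
    have "c \<cdot> e x \<boxminus> a \<cdot> g = v" using va g submod_carrier[OF sV va(1)] add_diff by simp
    thus "\<exists>a \<in> carrier R. ?P x a" using va by (intro bexI[of _ a]) simp_all
  next
    fix x a b assume x: "x \<in> carrier M" and a: "a \<in> carrier R" and b: "b \<in> carrier R" and Pa: "?P x a" and Pb: "?P x b"
    have "(c \<cdot> e x \<boxminus> a \<cdot> g) \<boxminus> (c \<cdot> e x \<boxminus> b \<cdot> g) \<in> ?V" by (rule submod_diff[OF sV Pa Pb])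
    moreover have "(z \<boxminus> u) \<boxminus> (z \<boxminus> v) = v \<boxminus> u" if "z \<in> carrier M" "u \<in> carrier M" "v \<in> carrier M" for z u v
      using that add_diff[of "v \<boxminus> u" z] by (simp add: M.minus_eq M.minus_add M.a_ac)
    ultimately have "b \<cdot> g \<boxminus> a \<cdot> g \<in> ?V" using c ec[OF x] a b g by simp
    hence "(b \<ominus> a) \<cdot> g \<in> span (G - {g})" using VG a b g by (auto simp: smult_diff_l)
    moreover have "b \<ominus> a \<in> carrier R" using a b by simp
    ultimately have "b \<ominus> a = \<zero>" using G g(1) unfolding independent_def by blast
    thus "a = b" using a b by simp
  next
    fix x y a b assume x: "x \<in> carrier M" "y \<in> carrier M" and a: "a \<in> carrier R" "b \<in> carrier R" and P: "?P x a" "?P y b"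
    have "c \<cdot> e (x \<boxplus> y) \<boxminus> (a \<oplus> b) \<cdot> g = (c \<cdot> e x \<boxminus> a \<cdot> g) \<boxplus> (c \<cdot> e y \<boxminus> b \<cdot> g)"
      using x a c g ec by (simp add: e_add smult_r_distr smult_l_distr M.minus_eq M.minus_add M.a_ac)
    thus "?P (x \<boxplus> y) (a \<oplus> b)" using P submoduleE(5)[OF sV] by simp
  next
    fix r x a assume r: "r \<in> carrier R" and x: "x \<in> carrier M" and a: "a \<in> carrier R" and P: "?P x a"
    have "c \<cdot> e (r \<cdot> x) \<boxminus> (r \<otimes> a) \<cdot> g = r \<cdot> (c \<cdot> e x \<boxminus> a \<cdot> g)"
      using r x a c g ec smult_commute[of c r "e x"] by (simp add: e_smult smult_diff_r smult_assoc1)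
    thus "?P (r \<cdot> x) (r \<otimes> a)" using P submoduleE(4)[OF sV r] by simp
  qed
  have \<phi>R: "\<phi> x \<in> carrier R" if "x \<in> carrier M" for x using \<phi>(1) that by (simp add: linear_form_def)
  have \<phi>P: "?P x (\<phi> x)" if "x \<in> carrier M" for x using \<phi>(2) that by blast
  show ?case
  proof (cases "\<forall>x \<in> carrier M. \<phi> x = \<zero>")
    case True
    have "c \<cdot> e x \<in> ?V" if x: "x \<in> carrier M" for x
    proof -
      have "c \<cdot> e x \<boxminus> \<zero>\<^bsub>M\<^esub> \<in> ?V" using \<phi>P[OF x] True x g by simp
      thus ?thesis using submod_diff_cancel[OF sV _ submod_zero[OF sV]] c ec[OF x] by simp
    qed
    thus ?thesis using s l unfolding e_def by blast
  next
    case False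
    then obtain m0 where m0: "m0 \<in> carrier M" "\<phi> m0 \<noteq> \<zero>" by blast
    let ?I = "\<phi> ` carrier M"
    have "ideal ?I R"
    proof (rule idealI_comm)
      show "?I \<subseteq> carrier R" using \<phi>R by auto
      have "\<phi> (\<zero> \<cdot> m0) = \<zero> \<otimes> \<phi> m0" using \<phi>(1) m0 by (simp add: linear_form_def del: smult_l_null)
      hence "\<zero> = \<phi> (\<zero> \<cdot> m0)" using \<phi>R m0 by simp
      thus "\<zero> \<in> ?I" using m0 by blast
    next
      fix a b assume "a \<in> ?I" "b \<in> ?I"
      then obtain x y where xy: "x \<in> carrier M" "a = \<phi> x" "y \<in> carrier M" "b = \<phi> y" by auto
      hence "a \<oplus> b = \<phi> (x \<boxplus> y)" using \<phi>(1) by (simp add: linear_form_def)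
      thus "a \<oplus> b \<in> ?I" using xy by simp
    next
      fix r a assume "r \<in> carrier R" "a \<in> ?I"
      then obtain x where xy: "x \<in> carrier M" "a = \<phi> x" "r \<in> carrier R" by auto
      hence "r \<otimes> a = \<phi> (r \<cdot> x)" using \<phi>(1) by (simp add: linear_form_def)
      thus "r \<otimes> a \<in> ?I" using xy by simp
    qed
    moreover have "\<phi> m0 \<in> ?I" using m0 by simp
    ultimately obtain b t where b: "b \<in> ?I" "b \<noteq> \<zero>" "t \<in> carrier R - p" "\<forall>a \<in> ?I. \<exists>v \<in> carrier R. t \<otimes> a = v \<otimes> b"
      using locally_principal[OF p _ _ m0(2)] by metis
    obtain m where m: "m \<in> carrier M" "b = \<phi> m" using b(1) by auto
    have bR: "b \<in> carrier R" and tR: "t \<in> carrier R" using m \<phi>R b by auto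
    obtain v where v: "linear_form v" "\<forall>x \<in> carrier M. t \<otimes> \<phi> x = v x \<otimes> b"
    proof (rule linear_form_exists[of "\<lambda>x a. t \<otimes> \<phi> x = a \<otimes> b"])
      show "\<exists>a \<in> carrier R. t \<otimes> \<phi> x = a \<otimes> b" if "x \<in> carrier M" for x using b(4) that by blast
      show "a = a'" if "a \<in> carrier R" "a' \<in> carrier R" "t \<otimes> \<phi> x = a \<otimes> b" "t \<otimes> \<phi> x = a' \<otimes> b" for x a a'
        using that R.m_rcancel[OF b(2) bR, of a a'] by simp
    next
      fix x y a a' assume "x \<in> carrier M" "y \<in> carrier M" "a \<in> carrier R" "a' \<in> carrier R" "t \<otimes> \<phi> x = a \<otimes> b" "t \<otimes> \<phi> y = a' \<otimes> b"
      thus "t \<otimes> \<phi> (x \<boxplus> y) = (a \<oplus> a') \<otimes> b"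
        using \<phi>(1) \<phi>R tR bR by (simp add: linear_form_def R.r_distr R.l_distr)
    next
      fix r x a assume "r \<in> carrier R" "x \<in> carrier M" "a \<in> carrier R" "t \<otimes> \<phi> x = a \<otimes> b"
      thus "t \<otimes> \<phi> (r \<cdot> x) = (r \<otimes> a) \<otimes> b"
        using \<phi>(1) \<phi>R[of x] tR bR R.m_lcomm[of t r "\<phi> x"] by (simp add: linear_form_def R.m_assoc)
    qed
    have vR: "v x \<in> carrier R" if "x \<in> carrier M" for x using v(1) that by (simp add: linear_form_def)
    let ?l = "(v, e m) # map (apsnd (\<lambda>m. t \<cdot> m)) l"
    have l': "dual_system ?l" using dual_system_scale[OF l tR] v(1) ec[OF m(1)] by (simp add: dual_system_def)
    have "c \<cdot> ((t \<otimes> s) \<cdot> x \<boxminus> dual_sum M ?l x) \<in> ?V" if x: "x \<in> carrier M" for x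
    proof -
      have d: "dual_sum M l x \<in> carrier M" using dual_sum_closed[OF l x] .
      have "(t \<otimes> s) \<cdot> x \<boxminus> dual_sum M ?l x = t \<cdot> e x \<boxminus> v x \<cdot> e m"
        using d x tR sR vR[OF x] ec[OF m(1)] dual_sum_scale[OF l tR x]
        by (simp add: e_def smult_r_distr smult_assoc1 M.minus_eq M.minus_add smult_r_minus M.a_ac)
      hence "c \<cdot> ((t \<otimes> s) \<cdot> x \<boxminus> dual_sum M ?l x) = t \<cdot> (c \<cdot> e x) \<boxminus> v x \<cdot> (c \<cdot> e m)"
        using c x tR vR[OF x] ec m(1) smult_commute[of c t "e x"] smult_commute[of c "v x" "e m"] by (simp add: smult_diff_r)
      also have "\<dots> = t \<cdot> (c \<cdot> e x \<boxminus> \<phi> x \<cdot> g) \<boxminus> v x \<cdot> (c \<cdot> e m \<boxminus> b \<cdot> g)"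
      proof -
        have z: "t \<cdot> (\<phi> x \<cdot> g) = v x \<cdot> (b \<cdot> g)"
          using smult_assoc1[OF tR \<phi>R[OF x] g(2)] smult_assoc1[OF vR[OF x] bR g(2)] v(2) x by simp
        have sub: "(u \<boxminus> z) \<boxminus> (w \<boxminus> z) = u \<boxminus> w" if "u \<in> carrier M" "w \<in> carrier M" "z \<in> carrier M" for u w z
          using that add_diff[of "u \<boxminus> w" z] by (simp add: M.minus_eq M.minus_add M.a_ac)
        show ?thesis
          using c x tR vR[OF x] ec[OF x] ec[OF m(1)] g(2) \<phi>R[OF x] bR z by (simp add: smult_diff_r sub)
      qed
      also have "\<dots> \<in> ?V"
        using submod_diff[OF sV submoduleE(4)[OF sV tR \<phi>P[OF x]] submoduleE(4)[OF sV vR[OF x] \<phi>P[OF m(1)]]] m(2) by simp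
      finally show ?thesis .
    qed
    thus ?thesis using l' maximal_mult_notin[OF p b(3) s] by blast
  qed
qed

text \<open>The \<open>s\<close> that act like some \<open>x \<mapsto> \<Sum>\<^sub>i \<phi>\<^sub>i(x) m\<^sub>i\<close> up to elements killed by \<open>c\<close> form an ideal. Taking all of
  \<open>G\<close> for \<open>F\<close> in \<open>local_dual_system\<close> shows that it lies in no maximal ideal, so it contains \<open>1\<close>.\<close>
lemma global_dual_system:
  assumes fin: "finite G" and G: "independent G" and c: "c \<in> carrier R" and cM: "\<forall>x \<in> carrier M. c \<cdot> x \<in> span G"
  obtains l where "dual_system l" "\<forall>x \<in> carrier M. c \<cdot> (x \<boxminus> dual_sum M l x) = \<zero>\<^bsub>M\<^esub>"
proof -
  let ?Q = "\<lambda>s l. dual_system l \<and> (\<forall>x \<in> carrier M. c \<cdot> (s \<cdot> x \<boxminus> dual_sum M l x) = \<zero>\<^bsub>M\<^esub>)"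
  let ?I = "{s \<in> carrier R. \<exists>l. ?Q s l}"
  have "ideal ?I R"
  proof (rule idealI_comm)
    show "?I \<subseteq> carrier R" by auto
    have "\<zero>\<^bsub>M\<^esub> \<boxminus> \<zero>\<^bsub>M\<^esub> = \<zero>\<^bsub>M\<^esub>" by (simp add: M.minus_eq M.r_neg)
    hence "?Q \<zero> []" using c by (simp add: dual_system_def)
    thus "\<zero> \<in> ?I" using R.zero_closed by blast
  next
    fix a b assume "a \<in> ?I" "b \<in> ?I"
    then obtain l l' where a: "a \<in> carrier R" "?Q a l" and b: "b \<in> carrier R" "?Q b l'" by blast
    have "c \<cdot> ((a \<oplus> b) \<cdot> x \<boxminus> dual_sum M (l @ l') x) = \<zero>\<^bsub>M\<^esub>" if x: "x \<in> carrier M" for x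
    proof -
      have d: "dual_sum M l x \<in> carrier M" "dual_sum M l' x \<in> carrier M" using a b dual_sum_closed x by auto
      have "(a \<oplus> b) \<cdot> x \<boxminus> dual_sum M (l @ l') x = (a \<cdot> x \<boxminus> dual_sum M l x) \<boxplus> (b \<cdot> x \<boxminus> dual_sum M l' x)"
        using a(1) b(1) x d dual_sum_append[of l l' x] a(2) b(2) by (simp add: smult_l_distr M.minus_eq M.minus_add M.a_ac)
      thus ?thesis using a b x d c by (simp add: smult_r_distr)
    qed
    thus "a \<oplus> b \<in> ?I" using a b dual_system_append by blast
  next
    fix r a assume r: "r \<in> carrier R" and "a \<in> ?I"
    then obtain l where a: "a \<in> carrier R" "?Q a l" by blast
    have "c \<cdot> ((r \<otimes> a) \<cdot> x \<boxminus> dual_sum M (map (apsnd (\<lambda>m. r \<cdot> m)) l) x) = \<zero>\<^bsub>M\<^esub>" if x: "x \<in> carrier M" for x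
    proof -
      have d: "dual_sum M l x \<in> carrier M" using a dual_sum_closed x by auto
      have "(r \<otimes> a) \<cdot> x \<boxminus> dual_sum M (map (apsnd (\<lambda>m. r \<cdot> m)) l) x = r \<cdot> (a \<cdot> x \<boxminus> dual_sum M l x)"
        using r a x d dual_sum_scale[of l r x] by (simp add: smult_diff_r smult_assoc1)
      thus ?thesis using smult_commute[of c r "a \<cdot> x \<boxminus> dual_sum M l x"] a x d c r by simp
    qed
    thus "r \<otimes> a \<in> ?I" using r a dual_system_scale[of l r] by blast
  qed
  have "\<one> \<in> ?I"
  proof (rule ccontr)
    assume "\<one> \<notin> ?I"
    then obtain p where p: "maximalideal p R" "?I \<subseteq> p" by (rule proper_ideal_below_maximal[OF \<open>ideal ?I R\<close>])
    obtain s l where s: "s \<in> carrier R - p" and l: "dual_system l"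
      and err: "\<forall>x \<in> carrier M. c \<cdot> (s \<cdot> x \<boxminus> dual_sum M l x) \<in> span (G - G)"
      using local_dual_system[OF G c cM p(1) fin subset_refl] by blast
    have "?Q s l" using l err span_empty by simp
    hence "s \<in> ?I" using s by blast
    thus False using p s by blast
  qed
  then obtain l where "?Q \<one> l" by blast
  thus ?thesis using that[of l] by simp
qed

end

lemma hom_dual_sum:
  assumes A: "module R A" and B: "module R B" and f: "f \<in> module_hom R A B"
    and l: "\<forall>q \<in> set l. fst q x \<in> carrier R \<and> snd q \<in> carrier A"
  shows "dual_sum A l x \<in> carrier A \<and> f (dual_sum A l x) = dual_sum B (map (apsnd f) l) x"
  using l
proof (induction l)
  case Nil
  have "f \<zero>\<^bsub>A\<^esub> = \<zero>\<^bsub>B\<^esub>" using module_hom_finsum[OF A B f, of "{}" undefined]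
    abelian_monoid.finsum_empty module.axioms(2)[OF A] module.axioms(2)[OF B] abelian_group.axioms(1)
    by (metis Pi_empty UNIV_I empty_iff finite.emptyI Pi_I')
  thus ?case using abelian_monoid.zero_closed[OF abelian_group.axioms(1)[OF module.axioms(2)[OF A]]] by simp
next
  case (Cons q l)
  interpret A: module R A by fact
  have q: "fst q x \<in> carrier R" "snd q \<in> carrier A" using Cons.prems by auto
  have IH: "dual_sum A l x \<in> carrier A" "f (dual_sum A l x) = dual_sum B (map (apsnd f) l) x" using Cons by auto
  have "f (fst q x \<odot>\<^bsub>A\<^esub> snd q \<oplus>\<^bsub>A\<^esub> dual_sum A l x) = f (fst q x \<odot>\<^bsub>A\<^esub> snd q) \<oplus>\<^bsub>B\<^esub> f (dual_sum A l x)"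
    using f q IH A.smult_closed by (simp add: module_hom_def)
  moreover have "f (fst q x \<odot>\<^bsub>A\<^esub> snd q) = fst q x \<odot>\<^bsub>B\<^esub> f (snd q)" using f q by (simp add: module_hom_def)
  ultimately show ?case using IH q by simp
qed


context dedekind_module
begin

text \<open>
  If \<open>e(x) = \<Sum>\<^sub>i \<phi>\<^sub>i(x) m\<^sub>i\<close> differs from \<open>x\<close> only by elements that \<open>c\<close> kills, then \<open>e\<close> is a projection, because
  linear forms vanish on such elements. Its image is generated by the \<open>e(m\<^sub>i)\<close>, and the \<open>\<phi>\<^sub>i\<close> and
  \<open>e(m\<^sub>i)\<close> form a dual basis of it.
\<close>
lemma splitting_of_dual_system:
  assumes c: "c \<in> carrier R" "c \<noteq> \<zero>" and l: "dual_system l"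
    and cl: "\<forall>x \<in> carrier M. c \<cdot> (x \<boxminus> dual_sum M l x) = \<zero>\<^bsub>M\<^esub>"
    and P: "P = dual_sum M l ` carrier M" and T: "T = {x \<in> carrier M. c \<cdot> x = \<zero>\<^bsub>M\<^esub>}"
  shows "direct_sum_decomposition R M P T"
    and "finitely_generated_module R (M\<lparr>carrier := P\<rparr>)"
    and "projective_module R (M\<lparr>carrier := P\<rparr>)"
    and "bounded_module R (M\<lparr>carrier := T\<rparr>)"
    and "torsion_module R (M\<lparr>carrier := T\<rparr>)"
proof -
  let ?e = "dual_sum M l"
  have lin: "linear_form (fst q)" and mc: "snd q \<in> carrier M" if "q \<in> set l" for q
    using l that by (auto simp: dual_system_def)
  have ec: "?e x \<in> carrier M" if "x \<in> carrier M" for x by (rule dual_sum_closed[OF l that])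
  have form0: "\<phi> x = \<zero>" if \<phi>: "linear_form \<phi>" and x: "x \<in> T" for \<phi> x
  proof -
    have xc: "x \<in> carrier M" "c \<cdot> x = \<zero> \<cdot> x" using x by (auto simp: T)
    hence "c \<otimes> \<phi> x = \<zero> \<otimes> \<phi> x" using \<phi> c unfolding linear_form_def by (metis R.zero_closed)
    moreover have "\<phi> x \<in> carrier R" using \<phi> xc by (simp add: linear_form_def)
    ultimately show ?thesis using R.integral[of c "\<phi> x"] c by auto
  qed
  have eT: "?e x = \<zero>\<^bsub>M\<^esub>" if x: "x \<in> T" for x
    using l
  proof (induction l)
    case (Cons q l)
    hence "fst q x = \<zero>" "snd q \<in> carrier M" "dual_system l" using form0[OF _ x] by (auto simp: dual_system_def)
    thus ?case using Cons by simp
  qed simp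
  have diffT: "x \<boxminus> ?e x \<in> T" if "x \<in> carrier M" for x using that cl ec by (simp add: T)
  have idem: "?e (?e x) = ?e x" if x: "x \<in> carrier M" for x
  proof -
    have "?e x \<boxminus> ?e (?e x) = \<zero>\<^bsub>M\<^esub>" using eT[OF diffT[OF x]] dual_sum_diff[OF l x ec[OF x]] by simp
    thus ?thesis using diff_add[of "?e x" "?e (?e x)"] ec x by simp
  qed
  have eP: "?e x = x" if "x \<in> P" for x using that idem by (auto simp: P)
  have Pc: "P \<subseteq> carrier M" using ec by (auto simp: P)
  have e0: "?e \<zero>\<^bsub>M\<^esub> = \<zero>\<^bsub>M\<^esub>" using eT[of "\<zero>\<^bsub>M\<^esub>"] c by (simp add: T)
  have sP: "submod P"
  proof (rule submodI)
    show "P \<subseteq> carrier M" by (rule Pc)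
    show "\<zero>\<^bsub>M\<^esub> \<in> P" unfolding P using e0 by (intro image_eqI[of _ _ "\<zero>\<^bsub>M\<^esub>"]) auto
  next
    fix a b assume "a \<in> P" "b \<in> P"
    then obtain x y where "x \<in> carrier M" "a = ?e x" "y \<in> carrier M" "b = ?e y" by (auto simp: P)
    thus "a \<boxplus> b \<in> P" unfolding P by (intro image_eqI[of _ _ "x \<boxplus> y"]) (simp_all add: dual_sum_add[OF l])
  next
    fix r a assume "r \<in> carrier R" "a \<in> P"
    then obtain x where "r \<in> carrier R" "x \<in> carrier M" "a = ?e x" by (auto simp: P)
    thus "r \<cdot> a \<in> P" unfolding P by (intro image_eqI[of _ _ "r \<cdot> x"]) (simp_all add: dual_sum_smult[OF l])
  qed
  have sT: "submod T"
  proof (rule submodI)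
    fix r a assume "r \<in> carrier R" "a \<in> T"
    thus "r \<cdot> a \<in> T" using c smult_commute[of c r a] by (simp add: T)
  qed (use c in \<open>auto simp: T smult_r_distr smult_r_minus\<close>)
  let ?P = "M\<lparr>carrier := P\<rparr>" and ?T = "M\<lparr>carrier := T\<rparr>"
  have M: "module R M" by (rule module_axioms)
  have modP: "module R ?P" by (rule submodule.submodule_is_module[OF sP M])
  have modT: "module R ?T" by (rule submodule.submodule_is_module[OF sT M])
  show "direct_sum_decomposition R M P T"
    unfolding direct_sum_decomposition_def
  proof (intro conjI sP sT)
    show "P \<inter> T = {\<zero>\<^bsub>M\<^esub>}" using eP eT submod_zero[OF sP] submod_zero[OF sT] by fastforce
    have "x \<in> P <+>\<^bsub>M\<^esub> T" if x: "x \<in> carrier M" for x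
    proof -
      have "x = ?e x \<boxplus> (x \<boxminus> ?e x)" using x ec[OF x] diff_add[of x "?e x"] by (simp add: M.a_comm)
      moreover have "?e x \<in> P" using x by (simp add: P)
      ultimately show ?thesis using diffT[OF x] unfolding set_add_def' by blast
    qed
    moreover have "P <+>\<^bsub>M\<^esub> T \<subseteq> carrier M" using submod_carrier[OF sP] submod_carrier[OF sT] by (auto simp: set_add_def')
    ultimately show "P <+>\<^bsub>M\<^esub> T = carrier M" by auto
  qed
  have e_hom: "?e \<in> module_hom R M ?P"
    using dual_sum_add[OF l] dual_sum_smult[OF l] by (auto simp: module_hom_def P)
  have mR: "fst q x \<in> carrier R" if "q \<in> set l" "x \<in> carrier M" for q x
    using lin[OF that(1)] that(2) by (simp add: linear_form_def)
  have dual: "dual_sum ?P (map (apsnd ?e) l) x = x" if x: "x \<in> P" for x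
  proof -
    have "?e (?e x) = dual_sum ?P (map (apsnd ?e) l) x"
      using hom_dual_sum[OF M modP e_hom, of l x] mR mc x Pc by blast
    thus ?thesis using eP[OF x] by simp
  qed
  show "finitely_generated_module R ?P"
    unfolding finitely_generated_module_def generates_def
  proof (intro exI conjI)
    let ?X = "(\<lambda>q. ?e (snd q)) ` set l"
    show "finite ?X" by simp
    show XP: "?X \<subseteq> carrier ?P" using mc by (auto simp: P)
    show "module_span R ?P ?X = carrier ?P"
    proof
      have "submodule P R ?P" using module.carrier_is_submodule[OF modP] by simp
      thus "module_span R ?P ?X \<subseteq> carrier ?P" using XP by (auto simp: module_span_def)
      have "x \<in> N" if N: "submodule N R ?P" "?X \<subseteq> N" and x: "x \<in> P" for x N
      proof -
        have "dual_sum ?P (map (apsnd ?e) l') x \<in> N" if "set l' \<subseteq> set l" for l'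
          using that
        proof (induction l')
          case Nil
          have "\<zero>\<^bsub>?P\<^esub> \<in> N" by (rule module.submod_zero[OF modP N(1)])
          thus ?case by simp
        next
          case (Cons q l')
          have ql: "q \<in> set l" and xc: "x \<in> carrier M" using Cons.prems x Pc by auto
          have q: "fst q x \<in> carrier R" "?e (snd q) \<in> N" using mR[OF ql xc] N(2) ql by auto
          have "fst q x \<odot>\<^bsub>?P\<^esub> ?e (snd q) \<in> N" by (rule module.submoduleE(4)[OF modP N(1) q])
          hence "fst q x \<odot>\<^bsub>?P\<^esub> ?e (snd q) \<oplus>\<^bsub>?P\<^esub> dual_sum ?P (map (apsnd ?e) l') x \<in> N"
            using module.submoduleE(5)[OF modP N(1)] Cons by simp
          thus ?case by simp
        qed
        thus ?thesis using dual[OF x] by force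
      qed
      thus "carrier ?P \<subseteq> module_span R ?P ?X" by (auto simp: module_span_def)
    qed
  qed
  show "projective_module R ?P"
    unfolding projective_module_def
  proof (intro conjI allI impI modP)
    fix A :: "('a, 'c \<Rightarrow> 'a) module" and B :: "('a, 'c, 'd) module_scheme" and f g
    assume H: "module R A \<and> module R B \<and> f \<in> module_hom R A B \<and> f ` carrier A = carrier B \<and> g \<in> module_hom R ?P B"
    hence A: "module R A" and B: "module R B" and f: "f \<in> module_hom R A B" and surj: "f ` carrier A = carrier B"
      and g: "g \<in> module_hom R ?P B" by auto
    interpret A: module R A by fact
    have "\<forall>y \<in> P. \<exists>a. a \<in> carrier A \<and> f a = g y"
    proof
      fix y assume "y \<in> P"
      hence "g y \<in> f ` carrier A" using g surj by (auto simp: module_hom_def)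
      thus "\<exists>a. a \<in> carrier A \<and> f a = g y" by auto
    qed
    then obtain t where t: "\<forall>y \<in> P. t y \<in> carrier A \<and> f (t y) = g y" by (rule bchoice[THEN exE])
    have emP: "?e (snd q) \<in> P" if "q \<in> set l" for q using mc[OF that] by (simp add: P)
    \<comment> \<open>Lift the images of the dual basis.\<close>
    let ?l = "map (apsnd (\<lambda>m. t (?e m))) l"
    let ?h = "dual_sum A ?l"
    have hc: "dual_sum A (map (apsnd (\<lambda>m. t (?e m))) l') x \<in> carrier A" if "set l' \<subseteq> set l" "x \<in> P" for l' x
      using that(1)
    proof (induction l')
      case (Cons q l')
      hence ql: "q \<in> set l" and xc: "x \<in> carrier M" using that(2) Pc by auto
      have "t (?e (snd q)) \<in> carrier A" using t emP[OF ql] by blast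
      thus ?case using Cons mR[OF ql xc] by simp
    qed simp
    have "dual_sum A (map (apsnd (\<lambda>m. t (?e m))) l') (x \<boxplus> y) =
        dual_sum A (map (apsnd (\<lambda>m. t (?e m))) l') x \<oplus>\<^bsub>A\<^esub> dual_sum A (map (apsnd (\<lambda>m. t (?e m))) l') y"
      if "set l' \<subseteq> set l" and xy: "x \<in> P" "y \<in> P" for l' x y
      using that(1)
    proof (induction l')
      case (Cons q l')
      have xyc: "x \<in> carrier M" "y \<in> carrier M" using xy Pc by auto
      have q: "q \<in> set l" "set l' \<subseteq> set l" using Cons.prems by auto
      have "fst q (x \<boxplus> y) = fst q x \<oplus>\<^bsub>R\<^esub> fst q y" using lin[OF q(1)] xyc by (simp add: linear_form_def)
      thus ?case using Cons.IH[OF q(2)] mR[OF q(1)] xyc emP[OF q(1)] t hc[OF q(2)] xy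
        by (simp add: A.smult_l_distr A.M.a_ac)
    qed simp
    moreover have "dual_sum A (map (apsnd (\<lambda>m. t (?e m))) l') (r \<cdot> x) = r \<odot>\<^bsub>A\<^esub> dual_sum A (map (apsnd (\<lambda>m. t (?e m))) l') x"
      if "set l' \<subseteq> set l" and r: "r \<in> carrier R" and x: "x \<in> P" for l' r x
      using that(1)
    proof (induction l')
      case (Cons q l')
      have xc: "x \<in> carrier M" using x Pc by auto
      have q: "q \<in> set l" "set l' \<subseteq> set l" using Cons.prems by auto
      have "fst q (r \<cdot> x) = r \<otimes>\<^bsub>R\<^esub> fst q x" using lin[OF q(1)] xc r by (simp add: linear_form_def)
      thus ?case using Cons.IH[OF q(2)] mR[OF q(1) xc] xc emP[OF q(1)] t hc[OF q(2) x] r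
        by (simp add: A.smult_r_distr A.smult_assoc1)
    qed (use r in simp)
    ultimately have h: "?h \<in> module_hom R ?P A" using hc by (simp add: module_hom_def)
    have "f (?h x) = g x" if x: "x \<in> P" for x
    proof -
      have xc: "x \<in> carrier M" using x Pc by auto
      have "f (?h x) = dual_sum B (map (apsnd f) ?l) x"
        using hom_dual_sum[OF A B f, of ?l x] mR xc emP t by auto
      also have "map (apsnd f) ?l = map (apsnd g) (map (apsnd ?e) l)" using emP t by (auto simp: apsnd_def map_prod_def split_beta)
      also have "dual_sum B \<dots> x = g (dual_sum ?P (map (apsnd ?e) l) x)"
        using hom_dual_sum[OF modP B g, of "map (apsnd ?e) l" x] mR xc emP by auto
      finally show ?thesis using dual[OF x] by simp
    qed
    thus "\<exists>h \<in> module_hom R ?P A. \<forall>x \<in> carrier ?P. f (h x) = g x" using h by auto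
  qed
  show "bounded_module R ?T"
    unfolding bounded_module_def
  proof (intro exI conjI)
    show "ideal (PIdl c) R" by (rule R.cgenideal_ideal[OF c(1)])
    show "PIdl c \<noteq> {\<zero>}" using R.cgenideal_self[OF c(1)] c(2) by auto
    have "a \<cdot> x = \<zero>\<^bsub>M\<^esub>" if aI: "a \<in> PIdl c" and xT: "x \<in> T" for a x
    proof -
      obtain r where r: "r \<in> carrier R" "a = r \<otimes> c" using aI by (auto simp: cgenideal_def)
      thus ?thesis using xT c by (simp add: T smult_assoc1)
    qed
    hence sub: "{a \<odot>\<^bsub>?T\<^esub> x | a x. a \<in> PIdl c \<and> x \<in> carrier ?T} \<subseteq> {\<zero>\<^bsub>?T\<^esub>}" by auto
    have "ideal_smult R (PIdl c) ?T \<subseteq> {\<zero>\<^bsub>?T\<^esub>}"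
      unfolding ideal_smult_def by (rule module.span_least[OF modT module.submod_singleton_zero[OF modT] sub])
    moreover have "\<zero>\<^bsub>?T\<^esub> \<in> ideal_smult R (PIdl c) ?T"
      unfolding ideal_smult_def module_span_def using module.submod_zero[OF modT] by blast
    ultimately show "ideal_smult R (PIdl c) ?T = {\<zero>\<^bsub>?T\<^esub>}" by blast
  qed
  show "torsion_module R ?T"
    using c by (auto simp: torsion_module_def annihilator_def T)
qed

end

theorem theorem4p5:
  fixes R :: "('a, 'm) ring_scheme" and M :: "('a, 'b, 'n) module_scheme"
  assumes "dedekind_domain R"
    and "\<not> field R"
    and "module R M"
    and "regularly_weakly_based R M"
  shows "\<exists>P T. direct_sum_decomposition R M P T \<and>
    finitely_generated_module R (M\<lparr>carrier := P\<rparr>) \<and> projective_module R (M\<lparr>carrier := P\<rparr>) \<and>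
    bounded_module R (M\<lparr>carrier := T\<rparr>) \<and> torsion_module R (M\<lparr>carrier := T\<rparr>)"
proof -
  have "dedekind_ring R"
    using assms(1,2) by (simp add: dedekind_domain_def dedekind_ring_def dedekind_ring_axioms_def)
  then interpret dedekind_module R M
    using assms(3) by (rule dedekind_module.intro)
  obtain G c where G: "finite G" "independent G"
    and c: "c \<in> carrier R" "c \<noteq> \<zero>\<^bsub>R\<^esub>" "\<forall>x \<in> carrier M. c \<odot>\<^bsub>M\<^esub> x \<in> span G"
    by (rule multiple_in_finite_free_submodule[OF rwb_mod_zero[OF assms(4)]])
  obtain l where l: "dual_system l" "\<forall>x \<in> carrier M. c \<odot>\<^bsub>M\<^esub> (x \<ominus>\<^bsub>M\<^esub> dual_sum M l x) = \<zero>\<^bsub>M\<^esub>"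
    by (rule global_dual_system[OF G c(1,3)])
  show ?thesis
    using splitting_of_dual_system[OF c(1,2) l refl refl] by blast
qed


end
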